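(* Let $G$ be a locally compact group, let $A$ be a $C^{*}$-algebra, let $X$ be a full Hilbert $A$-module, and let $t\mapsto\eta_t$ be a continuous action of $G$ on $X$. Let $H,K$ be Hilbert spaces, let $t\mapsto u_t$ and $t\mapsto u'_t$ be unitary representations of $G$ on $H$ and $K$ respectively, and let $\Phi:X\to L(H,K)$ be a completely positive map which is $(u',u)$-covariant with respect to $(G,\eta,X)$, i.e. $\Phi(\eta_t(x))=u'_t\,\Phi(x)\,u_t^{*}$ for all $x\in X$, $t\in G$. Then: (1) There are two Hilbert spaces $H_\Phi$ and $K_\Phi$, a covariant representation $(\pi_\Phi,v^\Phi,w^\Phi,H_\Phi,K_\Phi)$ of $(G,\eta,X)$, a bounded linear operator $V_\Phi:H\to H_\Phi$ and a coisometry $W_\Phi:K\to K_\Phi$ such that: (a) $\Phi(x)=W_\Phi^{*}\,\pi_\Phi(x)\,V_\Phi$ for all $x\in X$; (b) $v^\Phi_t V_\Phi=V_\Phi u_t$ for all $t\in G$; (c) $w^\Phi_t W_\Phi=W_\Phi u'_t$ for all $t\in G$; (d) $[\pi_\Phi(X)V_\Phi H]=K_\Phi$; (e) $[\pi_\Phi(X)^{*}W_\Phi K]=H_\Phi$. (2) Let $H_\Phi,K_\Phi,\pi_\Phi,v^\Phi,w^\Phi,V_\Phi,W_\Phi$ be as in (1). If $H'$ and $K'$ are two Hilbert spaces, $(\pi_X,v,w,H',K')$ is a covariant representation of $(G,\eta,X)$, $V'\in L(H,H')$, and $W':K\to K'$ is a coisometry, satisfying (a) $\Phi(x)=W'^{*}\,\pi_X(x)\,V'$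 for all $x\in X$; (b) $v_tV'=V'u_t$ for all $t\in G$; (c) $w_tW'=W'u'_t$ for all $t\in G$; (d) $[\pi_X(X)V'H]=K'$; (e) $[\pi_X(X)^{*}W'K]=H'$, then there are two unitary operators $U_1\in L(H_\Phi,H')$ and $U_2\in L(K_\Phi,K')$ such that $U_2\pi_\Phi(x)=\pi_X(x)U_1$ for all $x\in X$, $v_tU_1=U_1v^\Phi_t$ and $w_tU_2=U_2w^\Phi_t$ for all $t\in G$, $V'=U_1V_\Phi$ and $W'=U_2W_\Phi$.
   Context: $L(H,K)$ is the space of bounded linear operators between Hilbert spaces $H$ and $K$, $L(H)=L(H,H)$. A coisometry is a bounded operator $W$ with $WW^{*}=\mathrm{id}$. $[Y]$ denotes the closed linear span of a subset $Y$ of a Hilbert space; e.g. $[\pi(X)VH]$ is the closed linear span of $\{\pi(x)Vh: x\in X,h\in H\}$ and $[\pi(X)^{*}WK]$ is that of $\{\pi(x)^{*}Wk: x\in X,k\in K\}$. A Hilbert $A$-module $X$ is a right $A$-module with an $A$-valued inner product $\langle\cdot,\cdot\rangle$, linear over $\mathbb C$ and $A$ in the second variable and conjugate linear in the first, complete for the norm $\|x\|=\|\langle x,x\rangle\|^{1/2}$. It is full if the closed two-sided ideal of $A$ generated by $\{\langle x,y\rangle:x,y\in X\}$ equals $A$. A representation of $X$ on Hilbert spaces $H$ and $K$ is a map $\pi_X:X\to L(H,K)$ for which there is a $*$-representation $\pi_A$ of $A$ on $H$ with $\pi_X(x)^{*}\pi_X(y)=\pi_A(\langle x,y\rangle)$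 for all $x,y\in X$. A map $\Phi:X\to L(H,K)$ is called completely positive if there is a completely positive linear map $\varphi:A\to L(H)$ with $\Phi(x)^{*}\Phi(y)=\varphi(\langle x,y\rangle)$ for all $x,y\in X$. A morphism of Hilbert $C^{*}$-modules from a Hilbert $A$-module $X$ to a Hilbert $B$-module $Y$ is a map $\Psi:X\to Y$ for which there is a $*$-homomorphism $\psi:A\to B$ with $\langle\Psi(x),\Psi(y)\rangle=\psi(\langle x,y\rangle)$ for all $x,y\in X$; it is an isomorphism if it is invertible and both $\Psi$ and $\Psi^{-1}$ are morphisms. $\mathrm{Aut}(X)$ is the group of isomorphisms of Hilbert $C^{*}$-modules from $X$ to $X$. A continuous action of $G$ on a full Hilbert $A$-module $X$ is a group homomorphism $t\mapsto\eta_t$ from $G$ to $\mathrm{Aut}(X)$ such that $(t,x)\mapsto\eta_t(x)$ is continuous from $G\times X$ to $X$; $(G,\eta,X)$ is then called a dynamical system on Hilbert $C^{*}$-modules. Unitary representations of $G$ are understood to be strongly continuous. A covariant representation of $(G,\eta,X)$, written $(\pi_X,v,w,H,K)$, consists of Hilbert spaces $H,K$, a representation $\pi_X:X\to L(H,K)$ of $X$, and unitary representations $t\mapsto v_t$ of $G$ on $H$ and $t\mapsto w_t$ of $G$ on $K$, such that $\pi_X(\eta_t(x))=w_t\,\pi_X(x)\,v_t^{*}$ for all $x\in X$, $t\in G$. *)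

theory Defs
  imports "HOL-Analysis.Analysis"
begin

section \<open>Complex Banach and Hilbert spaces\<close>

class complex_vector = real_vector +
  fixes scaleC :: "complex \<Rightarrow> 'a \<Rightarrow> 'a"  (infixr "*\<^sub>C" 75)
  assumes scaleC_add_right: "c *\<^sub>C (x + y) = c *\<^sub>C x + c *\<^sub>C y"
    and scaleC_add_left: "(c + d) *\<^sub>C x = c *\<^sub>C x + d *\<^sub>C x"
    and scaleC_scaleC: "c *\<^sub>C (d *\<^sub>C x) = (c * d) *\<^sub>C x"
    and scaleC_one: "1 *\<^sub>C x = x"
    and scaleR_scaleC: "r *\<^sub>R x = complex_of_real r *\<^sub>C x"

global_interpretation complex_vector: vector_space "scaleC :: complex \<Rightarrow> 'a \<Rightarrow> 'a::complex_vector"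
  defines csubspace = complex_vector.subspace
    and cspan = complex_vector.span
  by unfold_locales (simp_all add: scaleC_add_right scaleC_add_left scaleC_scaleC scaleC_one)

class complex_normed_vector = complex_vector + real_normed_vector +
  assumes norm_scaleC: "norm (c *\<^sub>C x) = cmod c * norm x"

class cbanach = complex_normed_vector + complete_space

text \<open>The complex inner product is conjugate linear in the first variable; its real part is the
  library's real inner product, which fixes the norm and gives definiteness.\<close>

class complex_inner = complex_vector + real_inner +
  fixes cinner :: "'a \<Rightarrow> 'a \<Rightarrow> complex"
  assumes cinner_commute: "cinner x y = cnj (cinner y x)"
    and cinner_add_right: "cinner x (y + z) = cinner x y + cinner x z"
    and cinner_scaleC_right: "cinner x (c *\<^sub>C y) = c * cinner x y"
    and Re_cinner: "Re (cinner x y) = inner x y"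
begin

lemma cinner_scaleC_left: "cinner (c *\<^sub>C x) y = cnj c * cinner x y"
  by (metis cinner_commute cinner_scaleC_right complex_cnj_mult)

subclass complex_normed_vector
proof
  fix c :: complex and x :: 'a
  have im: "Im (cinner x x) = 0"
    using arg_cong[OF cinner_commute[of x x], of Im] by simp
  have "inner (c *\<^sub>C x) (c *\<^sub>C x) = Re ((cnj c * c) * cinner x x)"
    by (simp only: Re_cinner[symmetric] cinner_scaleC_left cinner_scaleC_right mult.assoc mult.left_commute)
  also have "cnj c * c = complex_of_real ((cmod c)\<^sup>2)"
    by (metis complex_norm_square mult.commute)
  also have "Re (complex_of_real ((cmod c)\<^sup>2) * cinner x x) = (cmod c)\<^sup>2 * inner x x"
    by (simp add: im Re_cinner)
  finally show "norm (c *\<^sub>C x) = cmod c * norm x"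
    by (simp add: norm_eq_sqrt_inner real_sqrt_mult)
qed

end

class chilbert_space = complex_inner + complete_space

text \<open>Hilbert spaces are represented as closed subspaces of a type of class
  \<^class>\<open>chilbert_space\<close>, so that their existence can be asserted by quantifying over sets.
  Every Hilbert space occurs in this form, as \<^term>\<open>UNIV\<close> of a type.
  Operators between Hilbert spaces are functions of which only the values on the domain matter.\<close>

definition hilbert_space :: "'h::chilbert_space set \<Rightarrow> bool" where
  "hilbert_space H \<longleftrightarrow> csubspace H \<and> closed H"

definition bounded_op :: "'h::chilbert_space set \<Rightarrow> 'k::chilbert_space set \<Rightarrow> ('h \<Rightarrow> 'k) \<Rightarrow> bool" where
  "bounded_op H K T \<longleftrightarrow> T \<in> H \<rightarrow> K \<and>
     (\<forall>x\<in>H. \<forall>y\<in>H. T (x + y) = T x + T y) \<and>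
     (\<forall>c. \<forall>x\<in>H. T (c *\<^sub>C x) = c *\<^sub>C T x) \<and>
     (\<exists>B. \<forall>x\<in>H. norm (T x) \<le> B * norm x)"

text \<open>The adjoint of an operator with domain \<open>H\<close>; the vector exists and is unique by the
  Riesz theorem when \<open>H\<close> is a Hilbert space and \<open>T\<close> is bounded on it.\<close>

definition adj :: "'h::chilbert_space set \<Rightarrow> ('h \<Rightarrow> 'k::chilbert_space) \<Rightarrow> 'k \<Rightarrow> 'h" where
  "adj H T y = (THE z. z \<in> H \<and> (\<forall>x\<in>H. cinner (T x) y = cinner x z))"

definition coisometry :: "'h::chilbert_space set \<Rightarrow> 'k::chilbert_space set \<Rightarrow> ('h \<Rightarrow> 'k) \<Rightarrow> bool" where
  "coisometry H K W \<longleftrightarrow> bounded_op H K W \<and> (\<forall>y\<in>K. W (adj H W y) = y)"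

definition unitary_op :: "'h::chilbert_space set \<Rightarrow> 'k::chilbert_space set \<Rightarrow> ('h \<Rightarrow> 'k) \<Rightarrow> bool" where
  "unitary_op H K U \<longleftrightarrow> bounded_op H K U \<and>
     (\<forall>x\<in>H. adj H U (U x) = x) \<and> (\<forall>y\<in>K. U (adj H U y) = y)"


section \<open>The Hilbert space of square-summable families\<close>

text \<open>Up to isomorphism the closed subspaces of \<open>'i ell2\<close> are all Hilbert spaces
  of dimension at most the cardinality of \<open>'i\<close>.\<close>

typedef 'i ell2 = "{f :: 'i \<Rightarrow> complex. (\<lambda>i. (cmod (f i))\<^sup>2) summable_on UNIV}"
  morphisms ell2_nth Abs_ell2
  by (rule exI[of _ "\<lambda>_. 0"]) simp

setup_lifting type_definition_ell2

lemma ell2_summable_mult: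
  fixes f g :: "'i \<Rightarrow> complex"
  assumes "(\<lambda>i. (cmod (f i))\<^sup>2) summable_on UNIV" "(\<lambda>i. (cmod (g i))\<^sup>2) summable_on UNIV"
  shows "(\<lambda>i. cnj (f i) * g i) summable_on UNIV"
proof -
  have "(\<lambda>i. (cmod (f i))\<^sup>2 + (cmod (g i))\<^sup>2) summable_on UNIV"
    using assms by (rule summable_on_add)
  then have "(\<lambda>i. norm (cnj (f i) * g i)) summable_on UNIV"
  proof (rule summable_on_comparison_test)
    fix i
    have "0 \<le> (cmod (f i) - cmod (g i))\<^sup>2 + (cmod (f i))\<^sup>2 + (cmod (g i))\<^sup>2"
      by simp
    then show "norm (cnj (f i) * g i) \<le> (cmod (f i))\<^sup>2 + (cmod (g i))\<^sup>2"
      by (simp add: norm_mult power2_diff)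
  qed simp
  then show ?thesis
    by (rule abs_summable_summable)
qed

lemma ell2_summable_add:
  fixes f g :: "'i \<Rightarrow> complex"
  assumes "(\<lambda>i. (cmod (f i))\<^sup>2) summable_on UNIV" "(\<lambda>i. (cmod (g i))\<^sup>2) summable_on UNIV"
  shows "(\<lambda>i. (cmod (f i + g i))\<^sup>2) summable_on UNIV"
proof -
  have "(\<lambda>i. 2 * ((cmod (f i))\<^sup>2 + (cmod (g i))\<^sup>2)) summable_on UNIV"
    using assms by (intro summable_on_cmult_right summable_on_add)
  then show ?thesis
  proof (rule summable_on_comparison_test)
    fix i
    have "(cmod (f i + g i))\<^sup>2 \<le> (cmod (f i) + cmod (g i))\<^sup>2"
      by (simp add: norm_triangle_ineq power_mono)
    also have "\<dots> \<le> 2 * ((cmod (f i))\<^sup>2 + (cmod (g i))\<^sup>2)"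
      using zero_le_power2[of "cmod (f i) - cmod (g i)"] by (simp add: power2_sum power2_diff)
    finally show "(cmod (f i + g i))\<^sup>2 \<le> 2 * ((cmod (f i))\<^sup>2 + (cmod (g i))\<^sup>2)" .
  qed simp
qed

lemma ell2_summable_scale:
  fixes f :: "'i \<Rightarrow> complex"
  assumes "(\<lambda>i. (cmod (f i))\<^sup>2) summable_on UNIV"
  shows "(\<lambda>i. (cmod (c * f i))\<^sup>2) summable_on UNIV"
  using summable_on_cmult_right[OF assms, of "(cmod c)\<^sup>2"]
  by (simp add: norm_mult power_mult_distrib)

instantiation ell2 :: (type) complex_inner
begin

lift_definition zero_ell2 :: "'a ell2" is "\<lambda>_. 0" by simp
lift_definition plus_ell2 :: "'a ell2 \<Rightarrow> 'a ell2 \<Rightarrow> 'a ell2" is "\<lambda>f g i. f i + g i"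
  by (rule ell2_summable_add)
lift_definition uminus_ell2 :: "'a ell2 \<Rightarrow> 'a ell2" is "\<lambda>f i. - f i" by simp
lift_definition minus_ell2 :: "'a ell2 \<Rightarrow> 'a ell2 \<Rightarrow> 'a ell2" is "\<lambda>f g i. f i - g i"
  using ell2_summable_add[of _ "\<lambda>i. - _ i"] by simp
lift_definition scaleR_ell2 :: "real \<Rightarrow> 'a ell2 \<Rightarrow> 'a ell2" is "\<lambda>r f i. complex_of_real r * f i"
  by (rule ell2_summable_scale)
lift_definition scaleC_ell2 :: "complex \<Rightarrow> 'a ell2 \<Rightarrow> 'a ell2" is "\<lambda>c f i. c * f i"
  by (rule ell2_summable_scale)
lift_definition cinner_ell2 :: "'a ell2 \<Rightarrow> 'a ell2 \<Rightarrow> complex"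
  is "\<lambda>f g. \<Sum>\<^sub>\<infinity>i. cnj (f i) * g i" .

definition inner_ell2 :: "'a ell2 \<Rightarrow> 'a ell2 \<Rightarrow> real" where
  "inner_ell2 f g = Re (cinner f g)"
definition norm_ell2 :: "'a ell2 \<Rightarrow> real" where
  "norm_ell2 f = sqrt (inner f f)"
definition sgn_ell2 :: "'a ell2 \<Rightarrow> 'a ell2" where
  "sgn_ell2 f = inverse (norm f) *\<^sub>R f"
definition dist_ell2 :: "'a ell2 \<Rightarrow> 'a ell2 \<Rightarrow> real" where
  "dist_ell2 f g = norm (f - g)"
definition uniformity_ell2 :: "('a ell2 \<times> 'a ell2) filter" where
  "uniformity_ell2 = (INF e\<in>{0<..}. principal {(x, y). dist x y < e})"
definition open_ell2 :: "'a ell2 set \<Rightarrow> bool" where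
  "open_ell2 U = (\<forall>x\<in>U. eventually (\<lambda>(x', y). x' = x \<longrightarrow> y \<in> U) uniformity)"

lemma inner_ell2_self: "inner f f = (\<Sum>\<^sub>\<infinity>i. (cmod (ell2_nth f i))\<^sup>2)"
proof -
  have "(\<lambda>i. cnj (ell2_nth f i) * ell2_nth f i) summable_on UNIV"
    using ell2_nth[of f] by (simp add: ell2_summable_mult)
  then have "inner f f = (\<Sum>\<^sub>\<infinity>i. Re (cnj (ell2_nth f i) * ell2_nth f i))"
    unfolding inner_ell2_def cinner_ell2.rep_eq by (rule infsum_Re[symmetric])
  also have "\<dots> = (\<Sum>\<^sub>\<infinity>i. (cmod (ell2_nth f i))\<^sup>2)"
    by (intro infsum_cong) (simp add: cmod_power2 flip: power2_eq_square)
  finally show ?thesis .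
qed

instance
proof
  fix a b r :: real and c d :: complex and x y z :: "'a ell2"
  show "x + y + z = x + (y + z)" "x + y = y + x" "0 + x = x" "- x + x = 0" "x - y = x + - y"
    by (transfer; simp add: fun_eq_iff)+
  show "a *\<^sub>R (x + y) = a *\<^sub>R x + a *\<^sub>R y" "(a + b) *\<^sub>R x = a *\<^sub>R x + b *\<^sub>R x"
    "a *\<^sub>R b *\<^sub>R x = (a * b) *\<^sub>R x" "1 *\<^sub>R x = x"
    by (transfer; simp add: fun_eq_iff algebra_simps)+
  show "c *\<^sub>C (x + y) = c *\<^sub>C x + c *\<^sub>C y" "(c + d) *\<^sub>C x = c *\<^sub>C x + d *\<^sub>C x"
    "c *\<^sub>C d *\<^sub>C x = (c * d) *\<^sub>C x" "1 *\<^sub>C x = x"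
    by (transfer; simp add: fun_eq_iff algebra_simps)+
  show scaleR: "r *\<^sub>R x = complex_of_real r *\<^sub>C x" for r and x :: "'a ell2"
    by transfer simp
  show comm: "cinner x y = cnj (cinner y x)" for x y :: "'a ell2"
    by transfer (simp add: infsum_cnj[symmetric] mult.commute del: infsum_cnj)
  show add: "cinner x (y + z) = cinner x y + cinner x z" for x y z :: "'a ell2"
    by transfer (simp add: distrib_left infsum_add ell2_summable_mult)
  show scale: "cinner x (c *\<^sub>C y) = c * cinner x y" for c and x y :: "'a ell2"
    by transfer (simp add: mult.left_commute[of "cnj _"] infsum_cmult_right')
  show "Re (cinner x y) = inner x y"
    by (simp add: inner_ell2_def)
  show comm': "inner x y = inner y x" for x y :: "'a ell2"
    unfolding inner_ell2_def by (subst comm) simp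
  have "inner z (x + y) = inner z x + inner z y"
    by (simp add: inner_ell2_def add)
  then show "inner (x + y) z = inner x z + inner y z"
    by (metis comm')
  have "inner y (r *\<^sub>R x) = r * inner y x"
    by (simp add: inner_ell2_def scale scaleR)
  then show "inner (r *\<^sub>R x) y = r * inner x y"
    by (metis comm')
  show "0 \<le> inner x x"
    unfolding inner_ell2_self by (simp add: infsum_nonneg)
  show "inner x x = 0 \<longleftrightarrow> x = 0"
  proof
    assume *: "inner x x = 0"
    have "(cmod (ell2_nth x i))\<^sup>2 = 0" for i
      using * ell2_nth[of x] unfolding inner_ell2_self
      by (intro nonneg_infsum_le_0D[where A = UNIV]) auto
    then show "x = 0"
      by transfer auto
  next
    assume "x = 0"
    then show "inner x x = 0"
      unfolding inner_ell2_self by (simp add: zero_ell2.rep_eq)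
  qed
qed (fact norm_ell2_def sgn_ell2_def dist_ell2_def uniformity_ell2_def open_ell2_def)+

end

lemma norm_ell2_sq: "(norm f)\<^sup>2 = (\<Sum>\<^sub>\<infinity>i. (cmod (ell2_nth f i))\<^sup>2)"
  by (simp add: power2_norm_eq_inner inner_ell2_self)

lemma ell2_finite_sum_le: "finite F \<Longrightarrow> (\<Sum>i\<in>F. (cmod (ell2_nth f i))\<^sup>2) \<le> (norm f)\<^sup>2"
  unfolding norm_ell2_sq using ell2_nth[of f] by (intro finite_sum_le_infsum) auto

lemma cmod_ell2_nth_le: "cmod (ell2_nth f i) \<le> norm f"
  using ell2_finite_sum_le[of "{i}" f] by (simp add: power2_le_iff_abs_le)

instance ell2 :: (type) chilbert_space
proof
  fix X :: "nat \<Rightarrow> 'a ell2"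
  assume X: "Cauchy X"
  have "Cauchy (\<lambda>n. ell2_nth (X n) i)" for i
  proof (rule metric_CauchyI)
    fix e :: real assume "0 < e"
    then obtain M where M: "\<forall>m\<ge>M. \<forall>n\<ge>M. norm (X m - X n) < e"
      using X unfolding Cauchy_def dist_norm by blast
    have "dist (ell2_nth (X m) i) (ell2_nth (X n) i) < e" if "m \<ge> M" "n \<ge> M" for m n
      using M that cmod_ell2_nth_le[of "X m - X n" i]
      by (force simp: dist_norm minus_ell2.rep_eq)
    then show "\<exists>M. \<forall>m\<ge>M. \<forall>n\<ge>M. dist (ell2_nth (X m) i) (ell2_nth (X n) i) < e"
      by blast
  qed
  then obtain g where g: "\<And>i. (\<lambda>n. ell2_nth (X n) i) \<longlonglongrightarrow> g i"
    unfolding Cauchy_convergent_iff convergent_def by metis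
  have fin: "\<exists>M. \<forall>n\<ge>M. \<forall>F. finite F \<longrightarrow> (\<Sum>i\<in>F. (cmod (ell2_nth (X n) i - g i))\<^sup>2) \<le> e\<^sup>2"
    if "0 < e" for e
  proof -
    from that X obtain M where M: "\<forall>m\<ge>M. \<forall>n\<ge>M. norm (X m - X n) < e"
      unfolding Cauchy_def dist_norm by blast
    have "(\<Sum>i\<in>F. (cmod (ell2_nth (X n) i - g i))\<^sup>2) \<le> e\<^sup>2" if "n \<ge> M" "finite F" for n F
    proof (rule LIMSEQ_le_const2)
      show "(\<lambda>m. \<Sum>i\<in>F. (cmod (ell2_nth (X n) i - ell2_nth (X m) i))\<^sup>2)
              \<longlonglongrightarrow> (\<Sum>i\<in>F. (cmod (ell2_nth (X n) i - g i))\<^sup>2)"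
        by (intro tendsto_intros g)
      have "(\<Sum>i\<in>F. (cmod (ell2_nth (X n) i - ell2_nth (X m) i))\<^sup>2) \<le> e\<^sup>2" if "m \<ge> M" for m
      proof -
        have "(\<Sum>i\<in>F. (cmod (ell2_nth (X n) i - ell2_nth (X m) i))\<^sup>2) \<le> (norm (X n - X m))\<^sup>2"
          using ell2_finite_sum_le[OF \<open>finite F\<close>, of "X n - X m"] by (simp add: minus_ell2.rep_eq)
        also have "\<dots> \<le> e\<^sup>2"
          using M \<open>n \<ge> M\<close> that by (simp add: power_mono less_imp_le)
        finally show ?thesis .
      qed
      then show "\<exists>N. \<forall>m\<ge>N. (\<Sum>i\<in>F. (cmod (ell2_nth (X n) i - ell2_nth (X m) i))\<^sup>2) \<le> e\<^sup>2"
        by blast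
    qed
    then show ?thesis
      by blast
  qed
  have summable: "(\<lambda>i. (cmod (ell2_nth (X n) i - g i))\<^sup>2) summable_on UNIV"
    if "\<forall>F. finite F \<longrightarrow> (\<Sum>i\<in>F. (cmod (ell2_nth (X n) i - g i))\<^sup>2) \<le> e\<^sup>2" for n e
    using that by (intro nonneg_bdd_above_summable_on bdd_aboveI[where M = "e\<^sup>2"]) auto
  obtain N where "\<forall>F. finite F \<longrightarrow> (\<Sum>i\<in>F. (cmod (ell2_nth (X N) i - g i))\<^sup>2) \<le> 1\<^sup>2"
    using fin[of 1] by auto
  then have "(\<lambda>i. (cmod (ell2_nth (X N) i - g i))\<^sup>2) summable_on UNIV"
    by (rule summable)
  then have "(\<lambda>i. (cmod (g i - ell2_nth (X N) i))\<^sup>2) summable_on UNIV"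
    by (simp add: norm_minus_commute)
  then have "(\<lambda>i. (cmod (g i))\<^sup>2) summable_on UNIV"
    using ell2_summable_add[of "ell2_nth (X N)" "\<lambda>i. g i - ell2_nth (X N) i"] ell2_nth[of "X N"]
    by simp
  then obtain L where L: "ell2_nth L = g"
    using Abs_ell2_inverse by blast
  have "X \<longlonglongrightarrow> L"
  proof (rule LIMSEQ_I)
    fix r :: real assume "0 < r"
    then obtain M where M: "\<forall>n\<ge>M. \<forall>F. finite F \<longrightarrow> (\<Sum>i\<in>F. (cmod (ell2_nth (X n) i - g i))\<^sup>2) \<le> (r/2)\<^sup>2"
      using fin[of "r/2"] by auto
    have "norm (X n - L) < r" if "n \<ge> M" for n
    proof -
      have "(norm (X n - L))\<^sup>2 \<le> (r/2)\<^sup>2"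
        unfolding norm_ell2_sq minus_ell2.rep_eq L using M that
        by (intro infsum_le_finite_sums summable) auto
      then have "norm (X n - L) \<le> r/2"
        using \<open>0 < r\<close> by (simp add: power2_le_iff_abs_le)
      then show ?thesis
        using \<open>0 < r\<close> by simp
    qed
    then show "\<exists>M. \<forall>n\<ge>M. norm (X n - L) < r"
      by blast
  qed
  then show "convergent X"
    by (auto simp: convergent_def)
qed


section \<open>C*-algebras and completely positive maps\<close>

class cstar_algebra = cbanach + real_normed_algebra +
  fixes star :: "'a \<Rightarrow> 'a"
  assumes scaleC_mult_left: "(c *\<^sub>C a) * b = c *\<^sub>C (a * b)"
    and scaleC_mult_right: "a * (c *\<^sub>C b) = c *\<^sub>C (a * b)"
    and star_star: "star (star a) = a"
    and star_add: "star (a + b) = star a + star b"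
    and star_scaleC: "star (c *\<^sub>C a) = cnj c *\<^sub>C star a"
    and star_mult: "star (a * b) = star b * star a"
    and cstar_identity: "norm (star a * a) = (norm a)\<^sup>2"

definition star_hom :: "('a::cstar_algebra \<Rightarrow> 'b::cstar_algebra) \<Rightarrow> bool" where
  "star_hom \<psi> \<longleftrightarrow> (\<forall>a b. \<psi> (a + b) = \<psi> a + \<psi> b) \<and> (\<forall>c a. \<psi> (c *\<^sub>C a) = c *\<^sub>C \<psi> a) \<and>
     (\<forall>a b. \<psi> (a * b) = \<psi> a * \<psi> b) \<and> (\<forall>a. \<psi> (star a) = star (\<psi> a))"

definition closed_ideal :: "'a::cstar_algebra set \<Rightarrow> bool" where
  "closed_ideal I \<longleftrightarrow> csubspace I \<and> closed I \<and> (\<forall>a. \<forall>i\<in>I. a * i \<in> I \<and> i * a \<in> I)"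

definition linear_into_ops :: "'h::chilbert_space set \<Rightarrow> ('a::complex_vector \<Rightarrow> 'h \<Rightarrow> 'h) \<Rightarrow> bool" where
  "linear_into_ops H \<phi> \<longleftrightarrow> (\<forall>a. bounded_op H H (\<phi> a)) \<and>
     (\<forall>a b. \<forall>h\<in>H. \<phi> (a + b) h = \<phi> a h + \<phi> b h) \<and>
     (\<forall>c a. \<forall>h\<in>H. \<phi> (c *\<^sub>C a) h = c *\<^sub>C \<phi> a h)"

definition star_rep :: "'h::chilbert_space set \<Rightarrow> ('a::cstar_algebra \<Rightarrow> 'h \<Rightarrow> 'h) \<Rightarrow> bool" where
  "star_rep H \<pi> \<longleftrightarrow> linear_into_ops H \<pi> \<and>
     (\<forall>a b. \<forall>h\<in>H. \<pi> (a * b) h = \<pi> a (\<pi> b h)) \<and>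
     (\<forall>a. \<forall>h\<in>H. \<pi> (star a) h = adj H (\<pi> a) h)"

text \<open>Complete positivity says that all amplifications \<open>M\<^sub>n(A) \<rightarrow> M\<^sub>n(L(H)) = L(H\<^sup>n)\<close>
  preserve positivity, where an element of \<open>M\<^sub>n(A)\<close> is positive if it is of the form \<open>b\<^sup>*b\<close>
  and an operator \<open>T\<close> on \<open>H\<^sup>n\<close> is positive if \<open>\<langle>h, T h\<rangle> \<ge> 0\<close> for all \<open>h\<close>.\<close>

definition positive_matrix :: "nat \<Rightarrow> (nat \<Rightarrow> nat \<Rightarrow> 'a::cstar_algebra) \<Rightarrow> bool" where
  "positive_matrix n a \<longleftrightarrow> (\<exists>b. \<forall>i<n. \<forall>j<n. a i j = (\<Sum>k<n. star (b k i) * b k j))"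

definition positive_op_matrix :: "'h::chilbert_space set \<Rightarrow> nat \<Rightarrow> (nat \<Rightarrow> nat \<Rightarrow> 'h \<Rightarrow> 'h) \<Rightarrow> bool" where
  "positive_op_matrix H n T \<longleftrightarrow>
     (\<forall>h. (\<forall>i<n. h i \<in> H) \<longrightarrow> (\<Sum>i<n. \<Sum>j<n. cinner (h i) (T i j (h j))) \<in> \<real>\<^sub>\<ge>\<^sub>0)"

definition completely_positive :: "'h::chilbert_space set \<Rightarrow> ('a::cstar_algebra \<Rightarrow> 'h \<Rightarrow> 'h) \<Rightarrow> bool" where
  "completely_positive H \<phi> \<longleftrightarrow> linear_into_ops H \<phi> \<and>
     (\<forall>n a. positive_matrix n a \<longrightarrow> positive_op_matrix H n (\<lambda>i j. \<phi> (a i j)))"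


section \<open>Hilbert modules\<close>

text \<open>The module is a Banach space type whose norm is the one given by the inner product \<open>ip\<close>;
  \<open>act\<close> is the right action of the algebra.\<close>

locale hilbert_module =
  fixes act :: "'x::cbanach \<Rightarrow> 'a::cstar_algebra \<Rightarrow> 'x"
    and ip :: "'x \<Rightarrow> 'x \<Rightarrow> 'a"
  assumes act_add_left: "act (x + y) a = act x a + act y a"
    and act_add_right: "act x (a + b) = act x a + act x b"
    and act_mult: "act x (a * b) = act (act x a) b"
    and act_scaleC_left: "act (c *\<^sub>C x) a = c *\<^sub>C act x a"
    and act_scaleC_right: "act x (c *\<^sub>C a) = c *\<^sub>C act x a"
    and ip_add_right: "ip x (y + z) = ip x y + ip x z"
    and ip_scaleC_right: "ip x (c *\<^sub>C y) = c *\<^sub>C ip x y"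
    and ip_act_right: "ip x (act y a) = ip x y * a"
    and ip_star: "star (ip x y) = ip y x"
    and ip_positive: "\<exists>b. ip x x = star b * b"
    and ip_definite: "ip x x = 0 \<Longrightarrow> x = 0"
    and norm_eq_ip: "norm x = sqrt (norm (ip x x))"

definition full_module :: "('x \<Rightarrow> 'x \<Rightarrow> 'a::cstar_algebra) \<Rightarrow> bool" where
  "full_module ip \<longleftrightarrow> closed_ideal hull {ip x y | x y. True} = UNIV"

definition module_morphism ::
    "('x \<Rightarrow> 'x \<Rightarrow> 'a::cstar_algebra) \<Rightarrow> ('y \<Rightarrow> 'y \<Rightarrow> 'b::cstar_algebra) \<Rightarrow> ('x \<Rightarrow> 'y) \<Rightarrow> bool" where
  "module_morphism ipX ipY \<Psi> \<longleftrightarrow> (\<exists>\<psi>. star_hom \<psi> \<and> (\<forall>x y. ipY (\<Psi> x) (\<Psi> y) = \<psi> (ipX x y)))"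

definition module_isomorphism ::
    "('x \<Rightarrow> 'x \<Rightarrow> 'a::cstar_algebra) \<Rightarrow> ('y \<Rightarrow> 'y \<Rightarrow> 'b::cstar_algebra) \<Rightarrow> ('x \<Rightarrow> 'y) \<Rightarrow> bool" where
  "module_isomorphism ipX ipY \<Psi> \<longleftrightarrow>
     bij \<Psi> \<and> module_morphism ipX ipY \<Psi> \<and> module_morphism ipY ipX (inv \<Psi>)"

text \<open>The library's class of topological groups is written additively; it is not assumed
  to be commutative.\<close>

definition continuous_action ::
    "('x::topological_space \<Rightarrow> 'x \<Rightarrow> 'a::cstar_algebra) \<Rightarrow> ('g::topological_group_add \<Rightarrow> 'x \<Rightarrow> 'x) \<Rightarrow> bool" where
  "continuous_action ip \<eta> \<longleftrightarrow> (\<forall>t. module_isomorphism ip ip (\<eta> t)) \<and>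
     (\<forall>s t. \<eta> (s + t) = \<eta> s \<circ> \<eta> t) \<and> continuous_on UNIV (\<lambda>(t, x). \<eta> t x)"

definition module_rep ::
    "('x \<Rightarrow> 'x \<Rightarrow> 'a::cstar_algebra) \<Rightarrow> 'h::chilbert_space set \<Rightarrow> 'k::chilbert_space set
      \<Rightarrow> ('x \<Rightarrow> 'h \<Rightarrow> 'k) \<Rightarrow> bool" where
  "module_rep ip H K \<pi> \<longleftrightarrow> (\<forall>x. bounded_op H K (\<pi> x)) \<and>
     (\<exists>\<pi>A. star_rep H \<pi>A \<and> (\<forall>x y. \<forall>h\<in>H. adj H (\<pi> x) (\<pi> y h) = \<pi>A (ip x y) h))"

definition module_completely_positive ::
    "('x \<Rightarrow> 'x \<Rightarrow> 'a::cstar_algebra) \<Rightarrow> 'h::chilbert_space set \<Rightarrow> 'k::chilbert_space set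
      \<Rightarrow> ('x \<Rightarrow> 'h \<Rightarrow> 'k) \<Rightarrow> bool" where
  "module_completely_positive ip H K \<Phi> \<longleftrightarrow> (\<forall>x. bounded_op H K (\<Phi> x)) \<and>
     (\<exists>\<phi>. completely_positive H \<phi> \<and> (\<forall>x y. \<forall>h\<in>H. adj H (\<Phi> x) (\<Phi> y h) = \<phi> (ip x y) h))"


section \<open>Covariance\<close>

definition unitary_rep :: "'h::chilbert_space set \<Rightarrow> ('g::topological_group_add \<Rightarrow> 'h \<Rightarrow> 'h) \<Rightarrow> bool" where
  "unitary_rep H u \<longleftrightarrow> (\<forall>t. unitary_op H H (u t)) \<and>
     (\<forall>s t. \<forall>h\<in>H. u (s + t) h = u s (u t h)) \<and>
     (\<forall>h\<in>H. continuous_on UNIV (\<lambda>t. u t h))"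

definition covariant ::
    "('g \<Rightarrow> 'x \<Rightarrow> 'x) \<Rightarrow> 'h::chilbert_space set \<Rightarrow> ('x \<Rightarrow> 'h \<Rightarrow> 'k::chilbert_space)
      \<Rightarrow> ('g \<Rightarrow> 'h \<Rightarrow> 'h) \<Rightarrow> ('g \<Rightarrow> 'k \<Rightarrow> 'k) \<Rightarrow> bool" where
  "covariant \<eta> H \<Phi> u u' \<longleftrightarrow> (\<forall>t x. \<forall>h\<in>H. \<Phi> (\<eta> t x) h = u' t (\<Phi> x (adj H (u t) h)))"

definition covariant_rep ::
    "('x \<Rightarrow> 'x \<Rightarrow> 'a::cstar_algebra) \<Rightarrow> ('g::topological_group_add \<Rightarrow> 'x \<Rightarrow> 'x)
      \<Rightarrow> ('x \<Rightarrow> 'h \<Rightarrow> 'k) \<Rightarrow> ('g \<Rightarrow> 'h \<Rightarrow> 'h) \<Rightarrow> ('g \<Rightarrow> 'k \<Rightarrow> 'k)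
      \<Rightarrow> 'h::chilbert_space set \<Rightarrow> 'k::chilbert_space set \<Rightarrow> bool" where
  "covariant_rep ip \<eta> \<pi> v w H K \<longleftrightarrow> hilbert_space H \<and> hilbert_space K \<and>
     module_rep ip H K \<pi> \<and> unitary_rep H v \<and> unitary_rep K w \<and> covariant \<eta> H \<pi> v w"

text \<open>A covariant Stinespring construction for \<open>\<Phi> : X \<rightarrow> L(H, K)\<close>: a covariant representation
  on \<open>H1\<close> and \<open>K1\<close> with an operator \<open>V : H \<rightarrow> H1\<close> and a coisometry \<open>W : K \<rightarrow> K1\<close>.
  When the module is full, the two spanning conditions make \<open>H1\<close> the closed linear span of a family
  indexed by \<open>A \<times> H\<close>, so it embeds into \<open>('a \<times> 'h) ell2\<close>, and the coisometry \<open>W\<close>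
  makes \<open>K1\<close> unitarily equivalent to a closed subspace of \<open>K\<close>; existence may therefore be
  asserted with these ambient types without loss of generality.\<close>

definition covariant_stinespring ::
    "('x \<Rightarrow> 'x \<Rightarrow> 'a::cstar_algebra) \<Rightarrow> ('g::topological_group_add \<Rightarrow> 'x \<Rightarrow> 'x)
      \<Rightarrow> 'h::chilbert_space set \<Rightarrow> 'k::chilbert_space set
      \<Rightarrow> ('g \<Rightarrow> 'h \<Rightarrow> 'h) \<Rightarrow> ('g \<Rightarrow> 'k \<Rightarrow> 'k) \<Rightarrow> ('x \<Rightarrow> 'h \<Rightarrow> 'k)
      \<Rightarrow> 'h1::chilbert_space set \<Rightarrow> 'k1::chilbert_space set
      \<Rightarrow> ('x \<Rightarrow> 'h1 \<Rightarrow> 'k1) \<Rightarrow> ('g \<Rightarrow> 'h1 \<Rightarrow> 'h1) \<Rightarrow> ('g \<Rightarrow> 'k1 \<Rightarrow> 'k1)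
      \<Rightarrow> ('h \<Rightarrow> 'h1) \<Rightarrow> ('k \<Rightarrow> 'k1) \<Rightarrow> bool" where
  "covariant_stinespring ip \<eta> H K u u' \<Phi> H1 K1 \<pi> v w V W \<longleftrightarrow>
     covariant_rep ip \<eta> \<pi> v w H1 K1 \<and> bounded_op H H1 V \<and> coisometry K K1 W \<and>
     (\<forall>x. \<forall>h\<in>H. \<Phi> x h = adj K W (\<pi> x (V h))) \<and>
     (\<forall>t. \<forall>h\<in>H. v t (V h) = V (u t h)) \<and>
     (\<forall>t. \<forall>k\<in>K. w t (W k) = W (u' t k)) \<and>
     closure (cspan {\<pi> x (V h) | x h. h \<in> H}) = K1 \<and>
     closure (cspan {adj H1 (\<pi> x) (W k) | x k. k \<in> K}) = H1"

end

theory Submission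
  imports Defs
begin

text \<open>Let \<open>\<phi>\<close> be the completely positive map with \<open>\<Phi>(x)\<^sup>* \<Phi>(y) = \<phi>(\<langle>x, y\<rangle>)\<close>. The Hilbert space \<open>H\<^sub>\<Phi>\<close>
  is spanned by the vectors \<open>\<langle>x, y\<rangle> \<odot> h\<close> of the completion of \<open>A \<otimes> H\<close> for the form
  \<open>\<langle>a \<odot> g, b \<odot> h\<rangle> = \<langle>g, \<phi>(a\<^sup>* b) h\<rangle>\<close>, with \<open>\<pi>\<^sub>\<Phi>(x) (a \<odot> h) = \<Phi>(x a) h\<close>; the space \<open>K\<^sub>\<Phi>\<close> is the closed span
  of \<open>\<Phi>(X) H\<close>, and \<open>W\<^sub>\<Phi>\<close> is the projection onto it. The operator \<open>V\<^sub>\<Phi>\<close> is the adjoint of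
  \<open>\<langle>x, y\<rangle> \<odot> h \<mapsto> \<phi>(\<langle>x, y\<rangle>) h\<close>. Its boundedness is where non-unital \<open>A\<close> needs care: positivity forces
  \<open>\<langle>h, \<phi>(a\<^sup>* a) h\<rangle> \<le> C \<parallel>a\<parallel>\<^sup>2 \<parallel>h\<parallel>\<^sup>2\<close>, and bounded approximate units do the rest. Both halves use only
  square roots of elements \<open>1 - y\<close> of the unitization with \<open>\<parallel>y\<parallel> \<le> 1\<close>, given by an iteration, and no
  functional calculus. The group acts by \<open>\<langle>x, y\<rangle> \<odot> h \<mapsto> \<langle>\<eta>\<^sub>t x, \<eta>\<^sub>t y\<rangle> \<odot> u\<^sub>t h\<close>, and uniqueness is the comparison
  of the Gram matrices of the spanning families \<open>\<pi>(x) V h\<close> and \<open>\<pi>(x)\<^sup>* W k\<close>.\<close>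

section \<open>Complex inner products\<close>

\<comment> \<open>With a unit one would set \<open>V\<^sub>\<Phi> h = 1 \<odot> h\<close>. Without
  one this vector is missing, but its inner product with \<open>a \<odot> g\<close> would be that of
  \<open>h\<close> with \<open>\<phi> a g\<close>, and this dictates the formula for the adjoint. An
  approximate unit \<open>e\<close> can replace \<open>1\<close> only if \<open>e \<odot> h\<close>
  stays bounded, which is why the quadratic bound on \<open>\<phi>\<close> has to precede the
  operator. Elements \<open>1 - y\<close> are handled through their left multiplication on the
  algebra, so the unitization is never constructed. The type that holds
  \<open>H\<^sub>\<Phi>\<close> is fixed beforehand, so the completion is not built as a quotient:
  complete positivity makes the form a positive definite kernel on pairs \<open>(a, h)\<close>, and
  such a kernel is realised by vectors of \<open>('a \<times> 'h) ell2\<close> with exactly these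
  inner products. Linearity of \<open>\<odot>\<close> then has to be recovered from the inner
  products.\<close>
subclass (in cbanach) banach ..

lemma cinner_add_left: "cinner (x + y) z = cinner x z + cinner y z"
  by (metis cinner_add_right cinner_commute complex_cnj_add)

lemma cinner_zero_right [simp]: "cinner x 0 = 0"
  using cinner_add_right[of x 0 0] by simp

lemma cinner_zero_left [simp]: "cinner 0 x = 0"
  using cinner_add_left[of 0 0 x] by simp

lemma cinner_minus_right: "cinner x (- y) = - cinner x y"
  using cinner_add_right[of x y "- y"] by (simp add: eq_neg_iff_add_eq_0 add.commute)

lemma cinner_minus_left: "cinner (- x) y = - cinner x y"
  using cinner_add_left[of x "- x" y] by (simp add: eq_neg_iff_add_eq_0 add.commute)

lemma cinner_diff_right: "cinner x (y - z) = cinner x y - cinner x z"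
  using cinner_add_right[of x y "- z"] by (simp add: cinner_minus_right)

lemma cinner_diff_left: "cinner (x - y) z = cinner x z - cinner y z"
  using cinner_add_left[of x "- y" z] by (simp add: cinner_minus_left)

lemma cinner_sum_right: "cinner x (\<Sum>i\<in>F. f i) = (\<Sum>i\<in>F. cinner x (f i))"
  by (induction F rule: infinite_finite_induct) (auto simp: cinner_add_right)

lemma cinner_sum_left: "cinner (\<Sum>i\<in>F. f i) x = (\<Sum>i\<in>F. cinner (f i) x)"
  by (induction F rule: infinite_finite_induct) (auto simp: cinner_add_left)

lemma cinner_scaleR_right: "cinner x (r *\<^sub>R y) = complex_of_real r * cinner x y"
  by (simp add: scaleR_scaleC cinner_scaleC_right)

lemma cinner_scaleR_left: "cinner (r *\<^sub>R x) y = complex_of_real r * cinner x y"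
  by (simp add: scaleR_scaleC cinner_scaleC_left)

lemma cinner_self: "cinner x x = complex_of_real ((norm x)\<^sup>2)"
proof (rule complex_eqI)
  show "Im (cinner x x) = Im (complex_of_real ((norm x)\<^sup>2))"
    using arg_cong[OF cinner_commute[of x x], of Im] by simp
qed (simp add: Re_cinner power2_norm_eq_inner)

lemma cinner_self_eq_0: "cinner x x = 0 \<longleftrightarrow> x = 0"
  by (simp add: cinner_self)

text \<open>Multiplying \<open>y\<close> by a phase makes the product real and nonnegative, where
  the real Cauchy-Schwarz inequality applies.\<close>

lemma cmod_cinner_le: "cmod (cinner x y) \<le> norm x * norm y"
proof (cases "cinner x y = 0")
  case False
  define c where "c = cnj (cinner x y) / cmod (cinner x y)"
  have c: "cmod c = 1"
    using False by (simp add: c_def norm_divide)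
  have "cinner x (c *\<^sub>C y) = cmod (cinner x y)"
  proof -
    have "cnj (cinner x y) * cinner x y = of_real ((cmod (cinner x y))\<^sup>2)"
      by (metis complex_norm_square mult.commute)
    then show ?thesis
      using False by (simp add: c_def cinner_scaleC_right power2_eq_square)
  qed
  then have "cmod (cinner x y) = inner x (c *\<^sub>C y)"
    by (metis Re_cinner Re_complex_of_real)
  also have "\<dots> \<le> norm x * norm (c *\<^sub>C y)"
    by (rule norm_cauchy_schwarz)
  finally show ?thesis
    by (simp add: norm_scaleC c)
qed simp

lemma scaleC_diff_right: "c *\<^sub>C (x - y) = c *\<^sub>C x - c *\<^sub>C (y::'a::complex_vector)"
  by (rule complex_vector.scale_right_diff_distrib)

lemma bounded_linear_scaleC: "bounded_linear (\<lambda>x. c *\<^sub>C (x::'a::complex_normed_vector))"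
proof (rule bounded_linear_intro[where K = "cmod c"])
  show "c *\<^sub>C r *\<^sub>R x = r *\<^sub>R c *\<^sub>C x" for r and x :: 'a
    by (simp add: scaleR_scaleC scaleC_scaleC mult.commute)
qed (simp_all add: scaleC_add_right norm_scaleC mult.commute)

lemma bounded_bilinear_cinner: "bounded_bilinear (cinner :: 'a::complex_inner \<Rightarrow> 'a \<Rightarrow> complex)"
proof
  show "\<exists>K. \<forall>a b::'a. norm (cinner a b) \<le> norm a * norm b * K"
    using cmod_cinner_le by (intro exI[of _ 1]) auto
qed (simp_all add: cinner_add_left cinner_add_right scaleR_scaleC cinner_scaleC_left
    cinner_scaleC_right scaleR_conv_of_real)

lemmas tendsto_scaleC = bounded_linear.tendsto[OF bounded_linear_scaleC]
lemmas tendsto_cinner = bounded_bilinear.tendsto[OF bounded_bilinear_cinner]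

section \<open>Closed subspaces and dense spans\<close>

lemma csubspace_closure:
  fixes S :: "'a::complex_normed_vector set"
  assumes "csubspace S"
  shows "csubspace (closure S)"
  unfolding complex_vector.subspace_def
proof (intro conjI ballI allI)
  show "0 \<in> closure S"
    using complex_vector.subspace_0[OF assms] closure_subset by blast
  show "x + y \<in> closure S" if xy: "x \<in> closure S" "y \<in> closure S" for x y
  proof -
    obtain f g where "\<And>n. f n \<in> S" "f \<longlonglongrightarrow> x" "\<And>n. g n \<in> S" "g \<longlonglongrightarrow> y"
      using xy by (auto simp: closure_sequential)
    then have "(\<lambda>n. f n + g n) \<longlonglongrightarrow> x + y" "\<And>n. f n + g n \<in> S"
      using assms by (auto intro: tendsto_add complex_vector.subspace_add)
    then show ?thesis
      unfolding closure_sequential by (intro exI[of _ "\<lambda>n. f n + g n"]) simp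
  qed
  show "c *\<^sub>C x \<in> closure S" if x: "x \<in> closure S" for c x
  proof -
    obtain f where "\<And>n. f n \<in> S" "f \<longlonglongrightarrow> x"
      using x by (auto simp: closure_sequential)
    then have "(\<lambda>n. c *\<^sub>C f n) \<longlonglongrightarrow> c *\<^sub>C x" "\<And>n. c *\<^sub>C f n \<in> S"
      using assms by (auto intro: tendsto_scaleC complex_vector.subspace_scale)
    then show ?thesis
      unfolding closure_sequential by (intro exI[of _ "\<lambda>n. c *\<^sub>C f n"]) simp
  qed
qed

lemma hilbert_space_closure_cspan: "hilbert_space (closure (cspan S))"
  by (simp add: hilbert_space_def csubspace_closure complex_vector.subspace_span)

lemma closure_cspan_superset: "x \<in> S \<Longrightarrow> x \<in> closure (cspan S)"
  using closure_subset complex_vector.span_base by blast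

lemma closure_cspan_minimal:
  "S \<subseteq> M \<Longrightarrow> hilbert_space M \<Longrightarrow> closure (cspan S) \<subseteq> M"
  unfolding hilbert_space_def by (intro closure_minimal complex_vector.span_minimal) auto

lemma hilbert_space_UNIV: "hilbert_space UNIV"
  by (simp add: hilbert_space_def)

lemma hilbert_space_add: "hilbert_space H \<Longrightarrow> x \<in> H \<Longrightarrow> y \<in> H \<Longrightarrow> x + y \<in> H"
  and hilbert_space_diff: "hilbert_space H \<Longrightarrow> x \<in> H \<Longrightarrow> y \<in> H \<Longrightarrow> x - y \<in> H"
  and hilbert_space_scaleC: "hilbert_space H \<Longrightarrow> x \<in> H \<Longrightarrow> c *\<^sub>C x \<in> H"
  and hilbert_space_0: "hilbert_space H \<Longrightarrow> 0 \<in> H"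
  unfolding hilbert_space_def
  by (auto intro: complex_vector.subspace_add complex_vector.subspace_diff
      complex_vector.subspace_scale complex_vector.subspace_0)

lemma hilbert_space_scaleR: "hilbert_space H \<Longrightarrow> x \<in> H \<Longrightarrow> r *\<^sub>R x \<in> H"
  by (simp add: scaleR_scaleC hilbert_space_scaleC)

lemma cinner_eqI:
  assumes "hilbert_space H" "y \<in> H" "z \<in> H" "\<And>x. x \<in> H \<Longrightarrow> cinner x y = cinner x z"
  shows "y = z"
proof -
  have "cinner (y - z) (y - z) = 0"
    using assms(4)[OF hilbert_space_diff[OF assms(1-3)]] by (simp add: cinner_diff_right)
  then show ?thesis
    by (simp add: cinner_self_eq_0)
qed

text \<open>For fixed \<open>y\<close> and \<open>z\<close>, the vectors on which the two
  functionals agree form a closed subspace.\<close>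

lemma cinner_eq_on_dense:
  fixes y z :: "'a::chilbert_space"
  assumes S: "\<And>x. x \<in> S \<Longrightarrow> cinner x y = cinner x z" and x: "x \<in> closure (cspan S)"
  shows "cinner x y = cinner x z"
proof -
  have "closed {x. cinner x y = cinner x z}"
    by (intro closed_Collect_eq continuous_intros
        bounded_linear.continuous_on[OF bounded_bilinear.bounded_linear_left[OF bounded_bilinear_cinner]])
  then have "hilbert_space {x. cinner x y = cinner x z}"
    by (auto simp: hilbert_space_def complex_vector.subspace_def cinner_add_left cinner_scaleC_left)
  then show ?thesis
    using closure_cspan_minimal[of S "{x. cinner x y = cinner x z}"] S x by auto
qed

lemma cinner_eqI_dense:
  fixes y z :: "'a::chilbert_space"
  assumes "y \<in> closure (cspan S)" "z \<in> closure (cspan S)"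
    and "\<And>x. x \<in> S \<Longrightarrow> cinner x y = cinner x z"
  shows "y = z"
  using cinner_eqI[OF hilbert_space_closure_cspan assms(1,2)] cinner_eq_on_dense[OF assms(3)] by blast


section \<open>Bounded operators and adjoints\<close>

lemma bounded_op_mem: "bounded_op H K T \<Longrightarrow> x \<in> H \<Longrightarrow> T x \<in> K"
  and bounded_op_add: "bounded_op H K T \<Longrightarrow> x \<in> H \<Longrightarrow> y \<in> H \<Longrightarrow> T (x + y) = T x + T y"
  and bounded_op_scaleC: "bounded_op H K T \<Longrightarrow> x \<in> H \<Longrightarrow> T (c *\<^sub>C x) = c *\<^sub>C T x"
  by (auto simp: bounded_op_def)

lemma bounded_op_scaleR: "bounded_op H K T \<Longrightarrow> x \<in> H \<Longrightarrow> T (r *\<^sub>R x) = r *\<^sub>R T x"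
  by (simp add: scaleR_scaleC bounded_op_scaleC)

lemma bounded_op_diff:
  assumes "bounded_op H K T" "hilbert_space H" "x \<in> H" "y \<in> H"
  shows "T (x - y) = T x - T y"
  using bounded_op_add[OF assms(1) hilbert_space_diff[OF assms(2-4)] assms(4)] by simp

lemma bounded_op_bound:
  assumes "bounded_op H K T"
  obtains B where "B \<ge> 0" "\<And>x. x \<in> H \<Longrightarrow> norm (T x) \<le> B * norm x"
proof -
  obtain B where B: "\<forall>x\<in>H. norm (T x) \<le> B * norm x"
    using assms by (auto simp: bounded_op_def)
  have "norm (T x) \<le> \<bar>B\<bar> * norm x" if "x \<in> H" for x
    using B that by (meson abs_ge_self mult_right_mono norm_ge_zero order_trans)
  then show thesis
    using that[of "\<bar>B\<bar>"] by simp
qed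

lemma bounded_opI:
  assumes "\<And>x. x \<in> H \<Longrightarrow> T x \<in> K"
    and "\<And>x y. x \<in> H \<Longrightarrow> y \<in> H \<Longrightarrow> T (x + y) = T x + T y"
    and "\<And>c x. x \<in> H \<Longrightarrow> T (c *\<^sub>C x) = c *\<^sub>C T x"
    and "\<And>x. x \<in> H \<Longrightarrow> norm (T x) \<le> B * norm x"
  shows "bounded_op H K T"
  using assms unfolding bounded_op_def by blast

lemma bounded_op_compose:
  assumes "bounded_op H K S" "bounded_op K L T"
  shows "bounded_op H L (\<lambda>x. T (S x))"
proof -
  obtain A where A: "A \<ge> 0" "\<And>x. x \<in> H \<Longrightarrow> norm (S x) \<le> A * norm x"
    using bounded_op_bound[OF assms(1)] by blast
  obtain B where B: "B \<ge> 0" "\<And>x. x \<in> K \<Longrightarrow> norm (T x) \<le> B * norm x"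
    using bounded_op_bound[OF assms(2)] by blast
  have "norm (T (S x)) \<le> (B * A) * norm x" if "x \<in> H" for x
    using B(2)[OF bounded_op_mem[OF assms(1) that]] mult_left_mono[OF A(2)[OF that] B(1)]
    by (simp add: mult.assoc)
  then show ?thesis
    using assms
    by (intro bounded_opI) (auto simp: bounded_op_mem bounded_op_add bounded_op_scaleC)
qed

lemma bounded_op_plus:
  assumes "bounded_op H K S" "bounded_op H K T" "hilbert_space K"
  shows "bounded_op H K (\<lambda>x. S x + T x)"
proof -
  obtain A where A: "A \<ge> 0" "\<And>x. x \<in> H \<Longrightarrow> norm (S x) \<le> A * norm x"
    using bounded_op_bound[OF assms(1)] by blast
  obtain B where B: "B \<ge> 0" "\<And>x. x \<in> H \<Longrightarrow> norm (T x) \<le> B * norm x"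
    using bounded_op_bound[OF assms(2)] by blast
  have "norm (S x + T x) \<le> (A + B) * norm x" if "x \<in> H" for x
    using norm_triangle_ineq[of "S x" "T x"] A(2)[OF that] B(2)[OF that] by (simp add: distrib_right)
  then show ?thesis
    using assms by (intro bounded_opI)
      (auto simp: bounded_op_mem hilbert_space_add bounded_op_add bounded_op_scaleC scaleC_add_right)
qed

lemma bounded_op_scaled:
  assumes "bounded_op H K T" "hilbert_space K"
  shows "bounded_op H K (\<lambda>x. c *\<^sub>C T x)"
proof (rule bounded_op_compose[OF assms(1)])
  show "bounded_op K K (\<lambda>x. c *\<^sub>C x)"
    using assms(2) by (intro bounded_opI[where B = "cmod c"])
      (auto simp: hilbert_space_scaleC scaleC_add_right scaleC_scaleC norm_scaleC mult.commute)
qed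

lemma bounded_op_subset:
  "bounded_op H K T \<Longrightarrow> H' \<subseteq> H \<Longrightarrow> (\<And>x. x \<in> H' \<Longrightarrow> T x \<in> K') \<Longrightarrow> bounded_op H' K' T"
  unfolding bounded_op_def by (simp add: subset_iff Pi_iff) blast

lemma bounded_op_continuous_on:
  assumes "bounded_op H K T" "hilbert_space H"
  shows "continuous_on H T"
proof -
  obtain B where "B \<ge> 0" "\<And>x. x \<in> H \<Longrightarrow> norm (T x) \<le> B * norm x"
    using bounded_op_bound[OF assms(1)] by blast
  then have "B-lipschitz_on H T"
    using assms by (intro lipschitz_onI) (auto simp: dist_norm hilbert_space_diff simp flip: bounded_op_diff)
  then show ?thesis
    by (rule lipschitz_on_continuous_on)
qed

text \<open>The equaliser of two continuous operators is a closed subspace. The codomains may differ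
  because only values are compared.\<close>

lemma bounded_op_eq_on_dense:
  assumes S: "bounded_op (closure (cspan E)) K S" and T: "bounded_op (closure (cspan E)) L T"
    and eq: "\<And>x. x \<in> E \<Longrightarrow> S x = T x" and x: "x \<in> closure (cspan E)"
  shows "S x = T x"
proof -
  let ?H = "closure (cspan E)"
  let ?M = "?H \<inter> (\<lambda>x. S x - T x) -` {0}"
  note H = hilbert_space_closure_cspan[of E]
  have "closed ?M"
    using bounded_op_continuous_on[OF S H] bounded_op_continuous_on[OF T H]
    by (intro continuous_closed_preimage continuous_on_diff) auto
  moreover have "csubspace ?M"
    using H bounded_op_scaleC[OF S, of 0 0] bounded_op_scaleC[OF T, of 0 0]
    by (auto simp: complex_vector.subspace_def hilbert_space_0 hilbert_space_add hilbert_space_scaleC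
        bounded_op_add[OF S] bounded_op_add[OF T] bounded_op_scaleC[OF S] bounded_op_scaleC[OF T])
  ultimately have "?H \<subseteq> ?M"
    using eq by (intro closure_cspan_minimal) (auto simp: hilbert_space_def closure_cspan_superset)
  then show ?thesis
    using x by auto
qed

section \<open>Riesz representation and adjoints\<close>

text \<open>If \<open>z\<close> represents \<open>f\<close>, then \<open>q\<close> is the squared
  distance to \<open>z\<close> up to a constant; so \<open>z\<close> is found by minimising
  \<open>q\<close>, and completeness provides the minimiser.\<close>

lemma Riesz_real:
  fixes f :: "'a::chilbert_space \<Rightarrow> real"
  assumes H: "hilbert_space H"
    and add: "\<And>x y. x \<in> H \<Longrightarrow> y \<in> H \<Longrightarrow> f (x + y) = f x + f y"
    and scale: "\<And>r x. x \<in> H \<Longrightarrow> f (r *\<^sub>R x) = r * f x"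
    and bound: "\<And>x. x \<in> H \<Longrightarrow> \<bar>f x\<bar> \<le> B * norm x"
  shows "\<exists>z\<in>H. \<forall>x\<in>H. f x = inner x z"
proof -
  define q where "q x = (norm x)\<^sup>2 - 2 * f x" for x
  define m where "m = Inf (q ` H)"
  have lb: "- B\<^sup>2 \<le> q x" if "x \<in> H" for x
  proof -
    have "0 \<le> (norm x - B)\<^sup>2"
      by simp
    then show ?thesis
      using bound[OF that] by (simp add: q_def power2_diff mult.commute)
  qed
  have bdd: "bdd_below (q ` H)"
    by (rule bdd_belowI[of _ "- B\<^sup>2"]) (use lb in auto)
  have m: "m \<le> q x" if "x \<in> H" for x
    unfolding m_def using that bdd by (simp add: cInf_lower)
  have "\<exists>x\<in>H. q x < m + inverse (Suc n)" for n
  proof -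
    have "q ` H \<noteq> {}"
      using hilbert_space_0[OF H] by auto
    then show ?thesis
      using cInf_lessD[of "q ` H" "m + inverse (Suc n)"] by (auto simp: m_def[symmetric])
  qed
  then obtain X where X: "\<And>n. X n \<in> H" "\<And>n. q (X n) < m + inverse (Suc n)"
    by metis
  \<comment> \<open>The value of \<open>q\<close> at the midpoint is at least \<open>m\<close>; with
    the parallelogram law, two near minimisers are close to each other.\<close>
  have dist: "(norm (x - y))\<^sup>2 \<le> 2 * (q x - m) + 2 * (q y - m)" if "x \<in> H" "y \<in> H" for x y
  proof -
    have "m \<le> q ((1/2) *\<^sub>R (x + y))"
      using that H by (intro m hilbert_space_scaleR hilbert_space_add)
    also have "\<dots> = (norm (x + y))\<^sup>2 / 4 - (f x + f y)"
      using that H by (simp add: q_def power_mult_distrib scale add hilbert_space_add power_divide diff_divide_distrib add_divide_distrib)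
    also have "\<dots> = ((norm (x + y))\<^sup>2 - 4 * (f x + f y)) / 4"
      by (simp add: field_simps)
    finally have "4 * m \<le> (norm (x + y))\<^sup>2 - 4 * (f x + f y)"
      by simp
    moreover have "(norm (x + y))\<^sup>2 + (norm (x - y))\<^sup>2 = 2 * (norm x)\<^sup>2 + 2 * (norm y)\<^sup>2"
      by (simp add: power2_norm_eq_inner algebra_simps inner_commute)
    ultimately show ?thesis
      by (simp add: q_def)
  qed
  have "Cauchy X"
  proof (rule metric_CauchyI)
    fix e :: real assume e: "0 < e"
    then obtain N where N: "inverse (real (Suc N)) < e\<^sup>2 / 4"
      using reals_Archimedean[of "e\<^sup>2 / 4"] by auto
    have "dist (X i) (X j) < e" if "i \<ge> N" "j \<ge> N" for i j
    proof -
      have *: "q (X k) < m + e\<^sup>2 / 4" if "k \<ge> N" for k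
      proof -
        have "inverse (real (Suc k)) \<le> inverse (real (Suc N))"
          using that by (intro le_imp_inverse_le) auto
        then show ?thesis
          using X(2)[of k] N by (smt (verit))
      qed
      have "(norm (X i - X j))\<^sup>2 < e\<^sup>2"
        using dist[OF X(1) X(1), of i j] *[OF \<open>i \<ge> N\<close>] *[OF \<open>j \<ge> N\<close>] by argo
      then show ?thesis
        using e by (simp add: dist_norm power2_less_imp_less)
    qed
    then show "\<exists>N. \<forall>i\<ge>N. \<forall>j\<ge>N. dist (X i) (X j) < e"
      by blast
  qed
  then obtain z where z: "X \<longlonglongrightarrow> z"
    by (auto simp: Cauchy_convergent_iff convergent_def)
  have zH: "z \<in> H"
    using H X(1) z by (auto simp: hilbert_space_def intro: closed_sequentially)
  have "(\<lambda>n. f (X n)) \<longlonglongrightarrow> f z"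
  proof (rule Lim_null_comparison[THEN LIM_zero_cancel])
    show "\<forall>\<^sub>F n in sequentially. norm (f (X n) - f z) \<le> B * norm (X n - z)"
    proof (intro always_eventually allI)
      fix n
      have "f (X n) = f (X n - z) + f z"
        using add[OF hilbert_space_diff[OF H X(1)[of n] zH] zH] by simp
      then show "norm (f (X n) - f z) \<le> B * norm (X n - z)"
        using bound[OF hilbert_space_diff[OF H X(1)[of n] zH]] by simp
    qed
    show "(\<lambda>n. B * norm (X n - z)) \<longlonglongrightarrow> 0"
      by (rule tendsto_eq_intros z refl | simp)+
  qed
  then have "(\<lambda>n. q (X n)) \<longlonglongrightarrow> q z"
    unfolding q_def by (intro tendsto_intros z)
  moreover have "(\<lambda>n. m + inverse (real (Suc n))) \<longlonglongrightarrow> m"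
    using LIMSEQ_inverse_real_of_nat_add[of m] by simp
  ultimately have qz: "q z \<le> m"
    using X(2) by (intro LIMSEQ_le[of _ "q z" _ m]) (auto intro: less_imp_le)
  have "f x = inner x z" if x: "x \<in> H" for x
  proof (rule ccontr)
    define a where "a = inner x z - f x"
    assume "f x \<noteq> inner x z"
    then have a: "a \<noteq> 0"
      by (simp add: a_def)
    \<comment> \<open>Minimality of \<open>q\<close> along the line through \<open>z\<close> in
      direction \<open>x\<close>; the linear coefficient \<open>a\<close> must therefore
      vanish.\<close>
    have ineq: "0 \<le> 2 * t * a + t\<^sup>2 * (norm x)\<^sup>2" for t
    proof -
      have "q z \<le> q (z + t *\<^sub>R x)"
        using m[of "z + t *\<^sub>R x"] qz x zH H by (simp add: hilbert_space_add hilbert_space_scaleR)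
      also have "q (z + t *\<^sub>R x) = q z + 2 * t * a + t\<^sup>2 * (norm x)\<^sup>2"
        using x zH H unfolding q_def a_def
        by (simp add: add scale hilbert_space_scaleR power2_norm_eq_inner algebra_simps inner_commute
            power2_eq_square[of t])
      finally show ?thesis by simp
    qed
    \<comment> \<open>\<open>- a / N\<close> nearly minimises the quadratic in \<open>t\<close>; the
      summand \<open>1\<close> keeps \<open>N\<close> positive without a separate case for
      \<open>x = 0\<close>.\<close>
    define N where "N = (norm x)\<^sup>2 + 1"
    have N: "N > 0" "(norm x)\<^sup>2 \<le> N"
      by (auto simp: N_def add_nonneg_pos)
    have "0 \<le> 2 * (- a / N) * a + (- a / N)\<^sup>2 * (norm x)\<^sup>2"
      by (rule ineq)
    also have "\<dots> \<le> 2 * (- a / N) * a + (- a / N)\<^sup>2 * N"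
      using N by (intro add_left_mono mult_left_mono) auto
    also have "\<dots> = - (a\<^sup>2 / N)"
      using N by (simp add: power2_eq_square field_simps)
    finally show False
      using a N by (simp add: field_simps)
  qed
  then show ?thesis
    using zH by blast
qed

lemma adj_exists:
  assumes H: "hilbert_space H" and T: "bounded_op H K T"
  shows "\<exists>z\<in>H. \<forall>x\<in>H. cinner (T x) y = cinner x z"
proof -
  obtain B where B: "B \<ge> 0" "\<And>x. x \<in> H \<Longrightarrow> norm (T x) \<le> B * norm x"
    using bounded_op_bound[OF T] by blast
  obtain z where z: "z \<in> H" "\<And>x. x \<in> H \<Longrightarrow> inner (T x) y = inner x z"
  proof (rule Riesz_real[OF H, THEN bexE])
    show "\<bar>inner (T x) y\<bar> \<le> (B * norm y) * norm x" if "x \<in> H" for x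
      using Cauchy_Schwarz_ineq2[of "T x" y] mult_right_mono[OF B(2)[OF that], of "norm y"]
      by (simp add: mult.assoc mult.commute[of "norm x"])
  qed (auto simp: bounded_op_add[OF T] bounded_op_scaleR[OF T] inner_add_left)
  have "cinner (T x) y = cinner x z" if x: "x \<in> H" for x
  proof (rule complex_eqI)
    \<comment> \<open>Real parts at \<open>\<i> *\<^sub>C x\<close> are imaginary parts at
      \<open>x\<close>.\<close>
    have "Re (cinner (T (\<i> *\<^sub>C x)) y) = Re (cinner (\<i> *\<^sub>C x) z)"
      unfolding Re_cinner using H x by (simp add: z(2) hilbert_space_scaleC)
    then show "Im (cinner (T x) y) = Im (cinner x z)"
      by (simp add: bounded_op_scaleC[OF T x] cinner_scaleC_left)
  qed (simp add: Re_cinner z(2) x)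
  then show ?thesis
    using z(1) by blast
qed

lemma adj_eqI:
  assumes "hilbert_space H" "z \<in> H" "\<And>x. x \<in> H \<Longrightarrow> cinner (T x) y = cinner x z"
  shows "adj H T y = z"
  unfolding adj_def using assms by (intro the_equality) (auto intro!: cinner_eqI[OF assms(1)])

lemma
  assumes "hilbert_space H" "bounded_op H K T"
  shows adj_mem: "adj H T y \<in> H"
    and cinner_adj: "x \<in> H \<Longrightarrow> cinner x (adj H T y) = cinner (T x) y"
proof -
  obtain z where z: "z \<in> H" "\<forall>x\<in>H. cinner (T x) y = cinner x z"
    using adj_exists[OF assms] by blast
  then have "adj H T y = z"
    by (intro adj_eqI[OF assms(1)]) auto
  then show "adj H T y \<in> H" "x \<in> H \<Longrightarrow> cinner x (adj H T y) = cinner (T x) y"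
    using z by auto
qed

lemma cinner_adj_left:
  assumes "hilbert_space H" "bounded_op H K T" "x \<in> H"
  shows "cinner (adj H T y) x = cinner y (T x)"
  using cinner_adj[OF assms] by (metis cinner_commute)

text \<open>\<open>adj H T\<close> has a value at every vector of the type, hence the arbitrary
  domain \<open>K'\<close>. Its bound is that of \<open>T\<close>.\<close>

lemma bounded_op_adj:
  assumes H: "hilbert_space H" and T: "bounded_op H K T"
  shows "bounded_op K' H (adj H T)"
proof -
  note A = adj_mem[OF H T] cinner_adj[OF H T]
  obtain B where B: "B \<ge> 0" "\<And>x. x \<in> H \<Longrightarrow> norm (T x) \<le> B * norm x"
    using bounded_op_bound[OF T] by blast
  show ?thesis
  proof (rule bounded_opI)
    show "adj H T (x + y) = adj H T x + adj H T y" for x y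
      by (intro adj_eqI H) (auto simp: A cinner_add_right hilbert_space_add[OF H])
    show "adj H T (c *\<^sub>C x) = c *\<^sub>C adj H T x" for c x
      by (intro adj_eqI H) (auto simp: A cinner_scaleC_right hilbert_space_scaleC[OF H])
    show "norm (adj H T y) \<le> B * norm y" for y
    proof (cases "adj H T y = 0")
      case False
      have "(norm (adj H T y))\<^sup>2 = cmod (cinner (T (adj H T y)) y)"
        by (simp add: A(2)[symmetric] A(1) cinner_self norm_power del: of_real_power)
      also have "\<dots> \<le> norm (T (adj H T y)) * norm y"
        by (rule cmod_cinner_le)
      also have "\<dots> \<le> (B * norm (adj H T y)) * norm y"
        by (intro mult_right_mono B A) simp
      finally show ?thesis
        using False by (simp add: power2_eq_square algebra_simps)
    qed (simp add: B(1))
  qed (rule A)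
qed

lemma adj_adj:
  assumes "hilbert_space H" "bounded_op H K T" "hilbert_space K" "x \<in> H"
  shows "adj K (adj H T) x = T x"
  using assms by (intro adj_eqI) (auto simp: bounded_op_mem cinner_adj_left)

section \<open>Extending operators from generators\<close>

text \<open>The family may repeat vectors, so the combination is pulled back along a set of indices
  on which \<open>e\<close> is injective.\<close>

lemma cspan_image_explicit:
  assumes "x \<in> cspan (e ` J)"
  obtains F c where "finite F" "F \<subseteq> J" "x = (\<Sum>i\<in>F. c i *\<^sub>C e i)"
proof -
  obtain t r where t: "finite t" "t \<subseteq> e ` J" "x = (\<Sum>a\<in>t. r a *\<^sub>C a)"
    using assms unfolding complex_vector.span_explicit by blast
  obtain F where F: "F \<subseteq> J" "inj_on e F" "t = e ` F"
    using t(2) by (auto simp: subset_image_inj)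
  show thesis
  proof (rule that[of F "r \<circ> e"])
    show "finite F"
      using F t(1) by (simp add: finite_image_iff)
    show "x = (\<Sum>i\<in>F. (r \<circ> e) i *\<^sub>C e i)"
      unfolding t(3) F(3) by (simp add: sum.reindex F(2))
  qed (rule F)
qed

lemma cspan_explicit_mem: "F \<subseteq> J \<Longrightarrow> (\<Sum>i\<in>F. c i *\<^sub>C e i) \<in> cspan (e ` J)"
  by (intro complex_vector.span_sum complex_vector.span_scale complex_vector.span_base) auto

text \<open>The estimate on finite combinations does double work: it makes the assignment of
  \<open>g i\<close> to \<open>e i\<close> well defined although the \<open>e i\<close> may be
  linearly dependent, and it makes the resulting map Lipschitz, so that it extends to the
  closure.\<close>

lemma bounded_extension:
  fixes e :: "'i \<Rightarrow> 'h::chilbert_space" and g :: "'i \<Rightarrow> 'k::chilbert_space"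
  assumes bound: "\<And>F c. finite F \<Longrightarrow> F \<subseteq> J \<Longrightarrow>
      norm (\<Sum>i\<in>F. c i *\<^sub>C g i) \<le> B * norm (\<Sum>i\<in>F. c i *\<^sub>C e i)"
    and K: "hilbert_space K" "g ` J \<subseteq> K" and B: "B \<ge> 0"
  shows "\<exists>T. bounded_op (closure (cspan (e ` J))) K T \<and> (\<forall>i\<in>J. T (e i) = g i) \<and>
    (\<forall>x\<in>closure (cspan (e ` J)). norm (T x) \<le> B * norm x)"
proof -
  let ?D = "cspan (e ` J)"
  define P where "P x y \<longleftrightarrow> (\<exists>F c. finite F \<and> F \<subseteq> J \<and>
      x = (\<Sum>i\<in>F. c i *\<^sub>C e i) \<and> y = (\<Sum>i\<in>F. c i *\<^sub>C g i))" for x y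
  have P_scale: "P (a *\<^sub>C x) (a *\<^sub>C y)" if P: "P x y" for a x y
  proof -
    obtain F c where F: "finite F" "F \<subseteq> J" "x = (\<Sum>i\<in>F. c i *\<^sub>C e i)" "y = (\<Sum>i\<in>F. c i *\<^sub>C g i)"
      using P unfolding P_def by blast
    show ?thesis
      unfolding P_def
    proof (intro exI conjI)
      show "a *\<^sub>C x = (\<Sum>i\<in>F. (a * c i) *\<^sub>C e i)" "a *\<^sub>C y = (\<Sum>i\<in>F. (a * c i) *\<^sub>C g i)"
        unfolding F(3,4) complex_vector.scale_sum_right scaleC_scaleC by (rule refl)+
    qed (rule F)+
  qed
  have P_add: "P (x + x') (y + y')" if P: "P x y" "P x' y'" for x y x' y'
  proof -
    obtain F c where 1: "finite F" "F \<subseteq> J" "x = (\<Sum>i\<in>F. c i *\<^sub>C e i)" "y = (\<Sum>i\<in>F. c i *\<^sub>C g i)"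
      using P(1) unfolding P_def by blast
    obtain F' c' where 2: "finite F'" "F' \<subseteq> J" "x' = (\<Sum>i\<in>F'. c' i *\<^sub>C e i)" "y' = (\<Sum>i\<in>F'. c' i *\<^sub>C g i)"
      using P(2) unfolding P_def by blast
    \<comment> \<open>Padding with zero coefficients brings both combinations to the index set
      \<open>F \<union> F'\<close>.\<close>
    let ?c = "\<lambda>i. if i \<in> F then c i else 0" and ?c' = "\<lambda>i. if i \<in> F' then c' i else 0"
    have *: "(\<Sum>i\<in>F. c i *\<^sub>C f i) = (\<Sum>i\<in>F \<union> F'. ?c i *\<^sub>C f i)"
      "(\<Sum>i\<in>F'. c' i *\<^sub>C f i) = (\<Sum>i\<in>F \<union> F'. ?c' i *\<^sub>C f i)" for f :: "'i \<Rightarrow> 'z::complex_vector"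
      using 1 2 by (auto intro!: sum.mono_neutral_cong_left)
    show ?thesis
      unfolding P_def
    proof (intro exI conjI)
      show "x + x' = (\<Sum>i\<in>F \<union> F'. (?c i + ?c' i) *\<^sub>C e i)"
        "y + y' = (\<Sum>i\<in>F \<union> F'. (?c i + ?c' i) *\<^sub>C g i)"
        unfolding 1(3,4) 2(3,4) * scaleC_add_left sum.distrib by (rule refl)+
    qed (use 1 2 in auto)
  qed
  have P_bound: "norm y \<le> B * norm x" if "P x y" for x y
    using that bound unfolding P_def by blast
  have P_diff: "P (x - x') (y - y')" if "P x y" "P x' y'" for x y x' y'
    using P_add[OF that(1) P_scale[OF that(2), of "-1"]] by simp
  have P_unique: "y = y'" if "P x y" "P x y'" for x y y'
    using P_bound[OF P_diff[OF that]] by simp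
  have P_ex: "\<exists>y. P x y" if "x \<in> ?D" for x
    using cspan_image_explicit[OF that] unfolding P_def by metis
  have P_K: "y \<in> K" if P: "P x y" for x y
  proof -
    obtain F c where F: "F \<subseteq> J" "y = (\<Sum>i\<in>F. c i *\<^sub>C g i)"
      using P unfolding P_def by blast
    then have "y \<in> cspan (g ` J)"
      by (simp add: cspan_explicit_mem)
    then show ?thesis
      using K complex_vector.span_minimal unfolding hilbert_space_def by blast
  qed
  define f where "f x = (THE y. P x y)" for x
  have f: "f x = y" if "P x y" for x y
    unfolding f_def using that P_unique by blast
  have Pf: "P x (f x)" if "x \<in> ?D" for x
    using P_ex[OF that] f by metis
  have "B-lipschitz_on ?D f"
    using B P_bound[OF P_diff[OF Pf Pf]] by (intro lipschitz_onI) (auto simp: dist_norm)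
  then obtain T where T: "uniformly_continuous_on (closure ?D) T" "\<And>x. x \<in> ?D \<Longrightarrow> f x = T x"
    using uniformly_continuous_on_extension_on_closure[OF lipschitz_on_uniformly_continuous] by metis
  have PT: "P x (T x)" if "x \<in> ?D" for x
    using Pf[OF that] T(2)[OF that] by simp
  have lim: "(\<lambda>n. T (X n)) \<longlonglongrightarrow> T x" if "\<And>n. X n \<in> ?D" "X \<longlonglongrightarrow> x" for X x
  proof -
    have "x \<in> closure ?D"
      using that by (auto simp: closure_sequential)
    then show ?thesis
      using uniformly_continuous_imp_continuous[OF T(1)] that
      unfolding continuous_on_closure_sequentially comp_def by blast
  qed
  have seq: "\<exists>X. (\<forall>n. X n \<in> ?D) \<and> X \<longlonglongrightarrow> x" if "x \<in> closure ?D" for x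
    using that by (simp add: closure_sequential)
  have Tbound: "norm (T x) \<le> B * norm x" if x: "x \<in> closure ?D" for x
  proof -
    obtain X where X: "\<And>n. X n \<in> ?D" "X \<longlonglongrightarrow> x"
      using seq[OF x] by blast
    show ?thesis
      by (rule LIMSEQ_le[OF tendsto_norm[OF lim[OF X]] tendsto_mult[OF tendsto_const tendsto_norm[OF X(2)]]])
        (use P_bound PT X in blast)
  qed
  have "bounded_op (closure ?D) K T"
  proof (rule bounded_opI)
    fix x assume "x \<in> closure ?D"
    then obtain X where X: "\<And>n. X n \<in> ?D" "X \<longlonglongrightarrow> x"
      using seq by blast
    show "T x \<in> K"
      using K(1) lim[OF X] P_K[OF PT[OF X(1)]] unfolding hilbert_space_def
      by (metis closed_sequentially)
    show "T (c *\<^sub>C x) = c *\<^sub>C T x" for c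
    proof (rule LIMSEQ_unique)
      show "(\<lambda>n. T (c *\<^sub>C X n)) \<longlonglongrightarrow> T (c *\<^sub>C x)"
        using X by (intro lim tendsto_scaleC complex_vector.span_scale)
      have "T (c *\<^sub>C X n) = c *\<^sub>C T (X n)" for n
        using P_unique[OF PT P_scale[OF PT]] X(1) by (simp add: complex_vector.span_scale)
      then show "(\<lambda>n. T (c *\<^sub>C X n)) \<longlonglongrightarrow> c *\<^sub>C T x"
        using X by (simp add: lim tendsto_scaleC)
    qed
    fix y assume "y \<in> closure ?D"
    then obtain Y where Y: "\<And>n. Y n \<in> ?D" "Y \<longlonglongrightarrow> y"
      using seq by blast
    show "T (x + y) = T x + T y"
    proof (rule LIMSEQ_unique)
      show "(\<lambda>n. T (X n + Y n)) \<longlonglongrightarrow> T (x + y)"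
        using X Y by (intro lim tendsto_add complex_vector.span_add)
      have "T (X n + Y n) = T (X n) + T (Y n)" for n
        using P_unique[OF PT P_add[OF PT PT]] X(1) Y(1) by (simp add: complex_vector.span_add)
      then show "(\<lambda>n. T (X n + Y n)) \<longlonglongrightarrow> T x + T y"
        using X Y by (simp add: lim tendsto_add)
    qed
  qed (rule Tbound)
  moreover have "T (e i) = g i" if "i \<in> J" for i
  proof -
    have "P (e i) (g i)"
      unfolding P_def using that by (intro exI[of _ "{i}"] exI[of _ "\<lambda>_. 1"]) (simp add: scaleC_one)
    then show ?thesis
      using that by (intro P_unique[OF PT]) (auto intro: complex_vector.span_base)
  qed
  ultimately show ?thesis
    using Tbound by blast
qed

section \<open>Unitary operators determined by Gram matrices\<close>

lemma cinner_sum_sum: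
  "cinner (\<Sum>i\<in>F. c i *\<^sub>C e i) (\<Sum>j\<in>G. d j *\<^sub>C f j) = (\<Sum>i\<in>F. \<Sum>j\<in>G. cnj (c i) * d j * cinner (e i) (f j))"
  unfolding cinner_sum_left unfolding cinner_sum_right cinner_scaleC_left cinner_scaleC_right
  by (simp add: ac_simps)

lemma norm_sum_sq:
  "(norm (\<Sum>i\<in>F. c i *\<^sub>C e i))\<^sup>2 = Re (\<Sum>i\<in>F. \<Sum>j\<in>F. cnj (c i) * c j * cinner (e i) (e j))"
  using arg_cong[OF cinner_self[of "\<Sum>i\<in>F. c i *\<^sub>C e i"], of Re] by (simp add: cinner_sum_sum)

lemma cinner_polarization:
  "4 * cinner x y = complex_of_real ((norm (x + y))\<^sup>2 - (norm (x - y))\<^sup>2)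
     + \<i> * complex_of_real ((norm (x - \<i> *\<^sub>C y))\<^sup>2 - (norm (x + \<i> *\<^sub>C y))\<^sup>2)"
proof -
  have "cinner (x + y) (x + y) - cinner (x - y) (x - y)
      + \<i> * (cinner (x - \<i> *\<^sub>C y) (x - \<i> *\<^sub>C y) - cinner (x + \<i> *\<^sub>C y) (x + \<i> *\<^sub>C y)) = 4 * cinner x y"
    by (simp add: cinner_add_left cinner_add_right cinner_diff_left cinner_diff_right
        cinner_scaleC_left cinner_scaleC_right algebra_simps)
  then show ?thesis
    by (simp add: cinner_self)
qed

text \<open>By polarization an isometry preserves inner products, so its adjoint is a left inverse;
  surjectivity makes it a right inverse too.\<close>

lemma unitary_opI:
  assumes H: "hilbert_space H" and U: "bounded_op H K U"
    and iso: "\<And>x. x \<in> H \<Longrightarrow> norm (U x) = norm x" and surj: "K \<subseteq> U ` H"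
  shows "unitary_op H K U"
proof -
  have ci: "cinner (U x) (U y) = cinner x y" if "x \<in> H" "y \<in> H" for x y
  proof -
    have "4 * cinner (U x) (U y) = 4 * cinner x y"
      unfolding cinner_polarization using that H
      by (simp add: iso hilbert_space_add hilbert_space_diff hilbert_space_scaleC
          flip: bounded_op_add[OF U] bounded_op_diff[OF U H] bounded_op_scaleC[OF U])
    then show ?thesis
      by simp
  qed
  then have *: "adj H U (U x) = x" if "x \<in> H" for x
    using H that by (intro adj_eqI) auto
  then show ?thesis
    using U surj unfolding unitary_op_def by auto
qed

text \<open>Equal Gram matrices give equal norms to corresponding combinations. Hence both
  directions extend to contractions, and these are mutually inverse because they are so on the
  generators.\<close>

lemma unitary_op_of_gram:
  fixes e :: "'i \<Rightarrow> 'h::chilbert_space" and g :: "'i \<Rightarrow> 'k::chilbert_space"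
  assumes gram: "\<And>i j. i \<in> J \<Longrightarrow> j \<in> J \<Longrightarrow> cinner (g i) (g j) = cinner (e i) (e j)"
    and H: "closure (cspan (e ` J)) = H" and K: "closure (cspan (g ` J)) = K"
  shows "\<exists>U. unitary_op H K U \<and> (\<forall>i\<in>J. U (e i) = g i)"
proof -
  have norm_eq: "norm (\<Sum>i\<in>F. c i *\<^sub>C g i) = norm (\<Sum>i\<in>F. c i *\<^sub>C e i)" if "F \<subseteq> J" for F c
  proof -
    have "(norm (\<Sum>i\<in>F. c i *\<^sub>C g i))\<^sup>2 = (norm (\<Sum>i\<in>F. c i *\<^sub>C e i))\<^sup>2"
      unfolding norm_sum_sq using that
      by (intro arg_cong[where f = Re] sum.cong refl) (auto simp: gram subset_iff)
    then show ?thesis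
      by simp
  qed
  note hs = hilbert_space_closure_cspan[of "e ` J", unfolded H] hilbert_space_closure_cspan[of "g ` J", unfolded K]
  have sub: "g ` J \<subseteq> K" "e ` J \<subseteq> H"
    unfolding H[symmetric] K[symmetric] by (auto intro: closure_cspan_superset)
  obtain U where U: "bounded_op H K U" "\<forall>i\<in>J. U (e i) = g i" "\<forall>x\<in>H. norm (U x) \<le> 1 * norm x"
    using bounded_extension[of J g 1 e K] norm_eq hs(2) sub(1) unfolding H by auto
  obtain U' where U': "bounded_op K H U'" "\<forall>i\<in>J. U' (g i) = e i" "\<forall>x\<in>K. norm (U' x) \<le> 1 * norm x"
    using bounded_extension[of J e 1 g H] norm_eq hs(1) sub(2) unfolding K by auto
  have id: "bounded_op L L (\<lambda>x. x)" for L :: "'z::chilbert_space set"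
    by (auto intro!: bounded_opI[where B = 1])
  have inv: "U' (U x) = x" if "x \<in> H" for x
    by (rule bounded_op_eq_on_dense[of "e ` J", unfolded H, OF bounded_op_compose[OF U(1) U'(1)] id])
      (use U(2) U'(2) that in auto)
  have inv': "U (U' x) = x" if "x \<in> K" for x
    by (rule bounded_op_eq_on_dense[of "g ` J", unfolded K, OF bounded_op_compose[OF U'(1) U(1)] id])
      (use U(2) U'(2) that in auto)
  have "unitary_op H K U"
  proof (rule unitary_opI[OF hs(1) U(1)])
    show "norm (U x) = norm x" if "x \<in> H" for x
    proof (rule antisym)
      show "norm (U x) \<le> norm x"
        using U(3) that by simp
      show "norm x \<le> norm (U x)"
        using U'(3) bounded_op_mem[OF U(1) that] inv[OF that] by force
    qed
    show "K \<subseteq> U ` H"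
      using inv' bounded_op_mem[OF U'(1)] by (metis image_eqI subsetI)
  qed
  then show ?thesis
    using U(2) by blast
qed

lemma
  assumes H: "hilbert_space H" and U: "unitary_op H K U"
  shows unitary_op_bounded: "bounded_op H K U"
    and unitary_op_cinner: "x \<in> H \<Longrightarrow> y \<in> H \<Longrightarrow> cinner (U x) (U y) = cinner x y"
    and unitary_op_norm: "x \<in> H \<Longrightarrow> norm (U x) = norm x"
    and unitary_op_adj_left: "x \<in> H \<Longrightarrow> adj H U (U x) = x"
    and unitary_op_adj_right: "z \<in> K \<Longrightarrow> U (adj H U z) = z"
proof -
  show B: "bounded_op H K U" and a: "x \<in> H \<Longrightarrow> adj H U (U x) = x" for x
    using U by (auto simp: unitary_op_def)
  show "z \<in> K \<Longrightarrow> U (adj H U z) = z"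
    using U by (auto simp: unitary_op_def)
  show ci: "cinner (U x) (U y) = cinner x y" if "x \<in> H" "y \<in> H" for x y
    using cinner_adj[OF H B that(1), of "U y"] a[OF that(2)] by simp
  show "norm (U x) = norm x" if "x \<in> H"
    using arg_cong[OF ci[OF that that], of Re] by (simp add: cinner_self)
qed


section \<open>Realising positive definite kernels\<close>

definition ket :: "'i \<Rightarrow> 'i ell2" where
  "ket i = Abs_ell2 (\<lambda>j. if j = i then 1 else 0)"

lemma ell2_nth_ket: "ell2_nth (ket i) = (\<lambda>j. if j = i then 1 else 0)"
  unfolding ket_def
proof (rule Abs_ell2_inverse, rule CollectI)
  show "(\<lambda>j. (cmod (if j = i then 1 else 0))\<^sup>2) summable_on UNIV"
    proof -
    have "(\<lambda>j. (cmod (if j = i then 1 else 0))\<^sup>2) summable_on {i}"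
      by simp
    then show ?thesis
      by (rule summable_on_cong_neutral[THEN iffD1, rotated -1]) auto
  qed
qed

lemma cinner_ket: "cinner (ket i) x = ell2_nth x i"
proof -
  have "cinner (ket i) x = (\<Sum>\<^sub>\<infinity>j. cnj (if j = i then 1 else 0) * ell2_nth x j)"
    by (simp add: cinner_ell2.rep_eq ell2_nth_ket)
  also have "\<dots> = (\<Sum>\<^sub>\<infinity>j\<in>{i}. ell2_nth x j)"
    by (intro infsum_cong_neutral) auto
  finally show ?thesis
    by simp
qed

lemma norm_ket [simp]: "norm (ket i) = 1"
proof -
  have "complex_of_real ((norm (ket i))\<^sup>2) = 1"
    by (simp only: cinner_self[symmetric] cinner_ket ell2_nth_ket if_True simp_thms)
  then have "(norm (ket i))\<^sup>2 = 1"
    by (simp only: of_real_eq_1_iff)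
  then show ?thesis
    using norm_ge_zero[of "ket i"] by (simp add: power2_eq_1_iff)
qed

text \<open>Testing the form on \<open>{i, j}\<close> with coefficients \<open>(1, 1)\<close> and
  \<open>(1, \<i>)\<close> settles the imaginary and the real part.\<close>

lemma psd_kernel_hermitian:
  fixes \<kappa> :: "'i \<Rightarrow> 'i \<Rightarrow> complex"
  assumes psd: "\<And>F c. finite F \<Longrightarrow> F \<subseteq> J \<Longrightarrow>
      (\<Sum>i\<in>F. \<Sum>j\<in>F. cnj (c i) * c j * \<kappa> i j) \<in> \<real>\<^sub>\<ge>\<^sub>0"
    and ij: "i \<in> J" "j \<in> J"
  shows "\<kappa> j i = cnj (\<kappa> i j)"
proof -
  have diag: "Im (\<kappa> i i) = 0" if "i \<in> J" for i
    using psd[of "{i}" "\<lambda>_. 1"] that by (simp add: complex_nonneg_Reals_iff)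
  show ?thesis
  proof (cases "i = j")
    case True
    then show ?thesis
      using diag[of i] ij by (simp add: complex_eq_iff)
  next
    case False
    have "Im (cnj (c i) * c i * \<kappa> i i + cnj (c i) * c j * \<kappa> i j +
        (cnj (c j) * c i * \<kappa> j i + cnj (c j) * c j * \<kappa> j j)) = 0" for c
      using psd[of "{i, j}" c] ij False by (simp add: complex_nonneg_Reals_iff)
    from this[of "\<lambda>_. 1"] this[of "\<lambda>k. if k = i then 1 else \<i>"] show ?thesis
      using diag[of i] diag[of j] ij False by (simp add: complex_eq_iff)
  qed
qed

text \<open>The quadratic in \<open>t\<close> has its minimum at \<open>t = 1 / k\<close>. For
  \<open>k = 0\<close> it is linear and bounded below, which forces \<open>s = 0\<close>.\<close>

lemma discriminant_le:
  fixes k s x :: real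
  assumes "\<And>t. 0 \<le> t\<^sup>2 * s * k - 2 * t * s + x" "k \<ge> 0" "s \<ge> 0"
  shows "s \<le> k * x"
proof (cases "k = 0")
  case True
  have "s = 0"
  proof (rule ccontr)
    assume "s \<noteq> 0"
    \<comment> \<open>At \<open>t = (x + 1) / (2 * s)\<close> the linear function takes the value
      \<open>-1\<close>.\<close>
    then show False
      using assms(1)[of "(x + 1) / (2 * s)"] True by (simp add: field_simps)
  qed
  then show ?thesis
    using True by simp
next
  case False
  then show ?thesis
    using assms(1)[of "1 / k"] assms(2) by (simp add: power2_eq_square field_simps)
qed

text \<open>Zorn's lemma on the graphs of partial realisations whose vectors are supported on the domain; the
  basis vector of a missing index is then orthogonal to all of them and can carry the defect of the norm.\<close>

lemma kernel_realization:
  fixes \<kappa> :: "'i \<Rightarrow> 'i \<Rightarrow> complex"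
  assumes psd: "\<And>F c. finite F \<Longrightarrow> F \<subseteq> J \<Longrightarrow>
      (\<Sum>i\<in>F. \<Sum>j\<in>F. cnj (c i) * c j * \<kappa> i j) \<in> \<real>\<^sub>\<ge>\<^sub>0"
  shows "\<exists>e :: 'i \<Rightarrow> 'i ell2. \<forall>i\<in>J. \<forall>j\<in>J. cinner (e i) (e j) = \<kappa> i j"
proof -
  have herm: "\<kappa> j i = cnj (\<kappa> i j)" if "i \<in> J" "j \<in> J" for i j
    using psd that by (rule psd_kernel_hermitian)
  have diag: "\<kappa> i i = complex_of_real (Re (\<kappa> i i))" "0 \<le> Re (\<kappa> i i)" if "i \<in> J" for i
    using psd[of "{i}" "\<lambda>_. 1"] that by (auto simp: complex_nonneg_Reals_iff complex_eq_iff)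
  define A :: "('i \<times> 'i ell2) set set" where
    "A = {G. (\<forall>(i, x)\<in>G. i \<in> J \<and> (\<forall>l. l \<notin> Domain G \<longrightarrow> ell2_nth x l = 0)) \<and>
             (\<forall>(i, x)\<in>G. \<forall>(j, y)\<in>G. cinner x y = \<kappa> i j)}"
  have A_I: "G \<in> A" if "\<And>i x. (i, x) \<in> G \<Longrightarrow> i \<in> J"
    "\<And>i x l. (i, x) \<in> G \<Longrightarrow> l \<notin> Domain G \<Longrightarrow> ell2_nth x l = 0"
    "\<And>i x j y. (i, x) \<in> G \<Longrightarrow> (j, y) \<in> G \<Longrightarrow> cinner x y = \<kappa> i j" for G
    using that unfolding A_def by (auto simp del: Domain_iff)
  have A_J: "i \<in> J" if "G \<in> A" "(i, x) \<in> G" for G i x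
    using that unfolding A_def by auto
  have A_supp: "ell2_nth x l = 0" if "G \<in> A" "(i, x) \<in> G" "l \<notin> Domain G" for G i x l
    using that unfolding A_def by (auto simp del: Domain_iff)
  have A_gram: "cinner x y = \<kappa> i j" if "G \<in> A" "(i, x) \<in> G" "(j, y) \<in> G" for G i x j y
    using that unfolding A_def by auto
  have "\<exists>M\<in>A. \<forall>X\<in>A. M \<subseteq> X \<longrightarrow> X = M"
  proof (rule subset_Zorn')
    fix C assume "subset.chain A C"
    then have C: "C \<subseteq> A" "\<And>X Y. X \<in> C \<Longrightarrow> Y \<in> C \<Longrightarrow> X \<subseteq> Y \<or> Y \<subseteq> X"
      by (auto simp: subset.chain_def)
    show "\<Union>C \<in> A"
    proof (rule A_I)
      fix i x assume "(i, x) \<in> \<Union>C"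
      then obtain X where X: "X \<in> C" "(i, x) \<in> X"
        by blast
      then show "i \<in> J"
        using C(1) A_J by blast
      show "ell2_nth x l = 0" if "l \<notin> Domain (\<Union>C)" for l
        using that X C(1) by (intro A_supp[of X i x]) auto
      fix j y assume "(j, y) \<in> \<Union>C"
      then obtain Y where Y: "Y \<in> C" "(j, y) \<in> Y"
        by blast
      then show "cinner x y = \<kappa> i j"
        using C(2)[OF X(1) Y(1)] X C(1) A_gram[of X] A_gram[of Y] by blast
    qed
  qed
  then obtain G where GA: "G \<in> A" and max: "\<And>X. X \<in> A \<Longrightarrow> G \<subseteq> X \<Longrightarrow> X = G"
    by blast
  note GJ = A_J[OF GA] and supp = A_supp[OF GA] and gram = A_gram[OF GA]
  \<comment> \<open>Equal Gram entries force two vectors with the same index to coincide, so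
    \<open>G\<close> is the graph of a function.\<close>
  have single: "x = y" if "(i, x) \<in> G" "(i, y) \<in> G" for i x y
  proof -
    have "cinner (x - y) (x - y) = 0"
      using that by (simp add: cinner_diff_left cinner_diff_right gram)
    then show ?thesis
      by (simp add: cinner_self_eq_0)
  qed
  have "J \<subseteq> Domain G"
  proof (rule ccontr)
    assume "\<not> J \<subseteq> Domain G"
    then obtain i where i: "i \<in> J" "i \<notin> Domain G"
      by blast
    define k where "k = Re (\<kappa> i i)"
    have k: "\<kappa> i i = complex_of_real k" "0 \<le> k"
      using diag[OF i(1)] by (auto simp: k_def)
    let ?M = "closure (cspan (snd ` G))"
    note hM = hilbert_space_closure_cspan[of "snd ` G"]
    \<comment> \<open>The prescribed inner products with the new vector define a functional on the
      span of the old ones; positivity on \<open>F\<close> with \<open>i\<close> adjoined bounds it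
      by \<open>sqrt k\<close>. Its values are multiples of \<open>ket i\<close> because
      \<open>bounded_extension\<close> produces operators.\<close>
    have bound: "norm (\<Sum>p\<in>F. c p *\<^sub>C (\<kappa> i (fst p) *\<^sub>C ket i)) \<le> sqrt k * norm (\<Sum>p\<in>F. c p *\<^sub>C snd p)"
      if F: "finite F" "F \<subseteq> G" for F c
    proof -
      define s where "s = (\<Sum>p\<in>F. c p * \<kappa> i (fst p))"
      define y where "y = (\<Sum>p\<in>F. c p *\<^sub>C snd p)"
      have inj: "inj_on fst F"
        using F(2) by (intro inj_onI) (metis prod.collapse single subsetD)
      have iF: "i \<notin> fst ` F" "fst ` F \<subseteq> J"
        using i F(2) GJ by force+
      have "0 \<le> t\<^sup>2 * (cmod s)\<^sup>2 * k - 2 * t * (cmod s)\<^sup>2 + (norm y)\<^sup>2" for t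
      proof -
        \<comment> \<open>The test coefficient \<open>- t * s\<close> at \<open>i\<close> turns
          positivity of the kernel into a quadratic inequality in \<open>t\<close>.\<close>
        define d where "d j = (if j = i then - complex_of_real t * s else c (the_inv_into F fst j))" for j
        have d: "d (fst p) = c p" "d i = - complex_of_real t * s" if "p \<in> F" for p
          using that iF inj by (auto simp: d_def the_inv_into_f_f)
        have di: "d i = - complex_of_real t * s"
          by (simp add: d_def)
        have "(\<Sum>a\<in>insert i (fst ` F). \<Sum>b\<in>insert i (fst ` F). cnj (d a) * d b * \<kappa> a b)
            = cnj (d i) * d i * \<kappa> i i + (\<Sum>p\<in>F. cnj (d i) * c p * \<kappa> i (fst p))
              + ((\<Sum>p\<in>F. cnj (c p) * d i * \<kappa> (fst p) i)
              + (\<Sum>p\<in>F. \<Sum>q\<in>F. cnj (c p) * c q * \<kappa> (fst p) (fst q)))"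
          using F iF by (simp add: sum.reindex inj d(1) sum.distrib cong: sum.cong)
        also have "(\<Sum>p\<in>F. cnj (d i) * c p * \<kappa> i (fst p)) = cnj (d i) * s"
          by (simp add: s_def sum_distrib_left mult.assoc)
        also have "(\<Sum>p\<in>F. cnj (c p) * d i * \<kappa> (fst p) i) = d i * cnj s"
          unfolding s_def cnj_sum sum_distrib_left
          using iF i by (intro sum.cong refl) (auto simp: herm[OF i(1)] subset_iff)
        also have "(\<Sum>p\<in>F. \<Sum>q\<in>F. cnj (c p) * c q * \<kappa> (fst p) (fst q)) = cinner y y"
          unfolding y_def cinner_sum_sum using F(2)
          by (intro sum.cong refl) (metis gram prod.collapse subsetD)
        also have "cnj (d i) * d i * \<kappa> i i + cnj (d i) * s + (d i * cnj s + cinner y y)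
            = complex_of_real (t\<^sup>2 * (cmod s)\<^sup>2 * k - 2 * t * (cmod s)\<^sup>2 + (norm y)\<^sup>2)"
          unfolding di k(1) cinner_self of_real_add of_real_diff of_real_mult complex_norm_square
          by (simp add: algebra_simps power2_eq_square)
        finally show ?thesis
          using psd[of "insert i (fst ` F)" d] F iF i by (simp add: complex_nonneg_Reals_iff)
      qed
      then have "(cmod s)\<^sup>2 \<le> k * (norm y)\<^sup>2"
        using k(2) by (intro discriminant_le) auto
      then have "cmod s \<le> sqrt k * norm y"
        using k(2) by - (rule power2_le_imp_le, auto simp: power_mult_distrib)
      moreover have "(\<Sum>p\<in>F. c p *\<^sub>C (\<kappa> i (fst p) *\<^sub>C ket i)) = s *\<^sub>C ket i"
        by (simp add: s_def complex_vector.scale_sum_left scaleC_scaleC)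
      ultimately show ?thesis
        by (simp add: norm_scaleC y_def)
    qed
    have "\<exists>T. bounded_op ?M UNIV T \<and> (\<forall>p\<in>G. T (snd p) = \<kappa> i (fst p) *\<^sub>C ket i) \<and>
        (\<forall>x\<in>?M. norm (T x) \<le> sqrt k * norm x)"
      using bound hilbert_space_UNIV subset_UNIV real_sqrt_ge_zero[OF k(2)] by (rule bounded_extension)
    then obtain T where T: "bounded_op ?M UNIV T" "\<And>p. p \<in> G \<Longrightarrow> T (snd p) = \<kappa> i (fst p) *\<^sub>C ket i"
      "\<And>x. x \<in> ?M \<Longrightarrow> norm (T x) \<le> sqrt k * norm x"
      by auto
    \<comment> \<open>The Riesz vector of this functional: it has the right products with all old
      vectors, but its norm may be too small.\<close>
    define p where "p = adj ?M T (ket i)"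
    have p: "p \<in> ?M" "\<And>x. x \<in> ?M \<Longrightarrow> cinner x p = cinner (T x) (ket i)"
      unfolding p_def using adj_mem[OF hM T(1)] cinner_adj[OF hM T(1)] by auto
    have norm_p: "norm p \<le> sqrt k"
    proof (cases "p = 0")
      case False
      have "(norm p)\<^sup>2 = cmod (cinner (T p) (ket i))"
        by (simp add: p(1) cinner_self norm_power del: of_real_power flip: p(2))
      also have "\<dots> \<le> norm (T p)"
        using cmod_cinner_le[of "T p" "ket i"] by (simp add: norm_ket)
      also have "\<dots> \<le> sqrt k * norm p"
        by (rule T(3)[OF p(1)])
      finally show ?thesis
        using False by (simp add: power2_eq_square)
    qed (simp add: k(2))
    have x_p: "cinner x p = \<kappa> j i" if "(j, x) \<in> G" for j x
    proof -
      have "x \<in> ?M"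
        using that by (force intro: closure_cspan_superset)
      then have "cinner x p = cnj (\<kappa> i j)"
        using T(2)[OF that] by (simp add: p(2) cinner_scaleC_left cinner_self norm_ket)
      then show ?thesis
        using herm[OF i(1) GJ[OF that]] by simp
    qed
    \<comment> \<open>\<open>p\<close> lies in the closed span of vectors that vanish at
      \<open>l\<close>.\<close>
    have p_supp: "ell2_nth p l = 0" if "l \<notin> Domain G" for l
    proof -
      have "cinner z (ket l) = cinner z 0" if "z \<in> ?M" for z
      proof (rule cinner_eq_on_dense[OF _ that])
        show "cinner x (ket l) = cinner x 0" if "x \<in> snd ` G" for x
          using supp \<open>l \<notin> Domain G\<close> that by (auto simp: cinner_commute[of x "ket l"] cinner_ket)
      qed
      from this[OF p(1)] show ?thesis
        by (simp add: cinner_commute[of p "ket l"] cinner_ket)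
    qed
    define y where "y = p + complex_of_real (sqrt (k - (norm p)\<^sup>2)) *\<^sub>C ket i"
    have "(norm p)\<^sup>2 \<le> k"
      using power_mono[OF norm_p, of 2] k(2) by simp
    moreover have "cinner p (ket i) = 0" "cinner (ket i) p = 0"
      using p_supp[OF i(2)] by (simp_all add: cinner_ket cinner_commute[of p "ket i"])
    then have "cinner y y = cinner p p + complex_of_real (sqrt (k - (norm p)\<^sup>2)) *
        complex_of_real (sqrt (k - (norm p)\<^sup>2)) * cinner (ket i) (ket i)"
      unfolding y_def by (simp only: cinner_add_left cinner_add_right cinner_scaleC_left cinner_scaleC_right) simp
    ultimately have yy: "cinner y y = \<kappa> i i"
      by (simp add: k(1) cinner_self flip: of_real_mult of_real_power)
    have xy: "cinner x y = \<kappa> j i" if "(j, x) \<in> G" for j x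
      using x_p[OF that] supp[OF that i(2)]
      by (simp add: y_def cinner_add_right cinner_scaleC_right cinner_commute[of x "ket i"] cinner_ket)
    have yx: "cinner y x = \<kappa> i j" if "(j, x) \<in> G" for j x
      using xy[OF that] herm[OF GJ[OF that] i(1)] cinner_commute[of y x] by simp
    have y_supp: "ell2_nth y l = 0" if "l \<notin> insert i (Domain G)" for l
      using p_supp[of l] that by (simp add: y_def plus_ell2.rep_eq scaleC_ell2.rep_eq ell2_nth_ket)
    have "insert (i, y) G \<in> A"
      by (rule A_I) (use GJ supp gram xy yx yy y_supp i(1) in auto)
    then have "(i, y) \<in> G"
      using max by blast
    then show False
      using i(2) by blast
  qed
  then have "\<forall>i\<in>J. \<exists>x. (i, x) \<in> G"
    by blast
  then obtain e where "\<forall>i\<in>J. (i, e i) \<in> G"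
    by (rule bchoice[THEN exE])
  then show ?thesis
    using gram by (intro exI[of _ e]) auto
qed

section \<open>C*-algebras\<close>

context cstar_algebra
begin

lemma star_zero [simp]: "star 0 = 0"
  using star_add[of 0 0] by simp

lemma star_minus: "star (- a) = - star a"
  using star_add[of a "- a"] by (simp add: eq_neg_iff_add_eq_0 add.commute)

lemma star_diff: "star (a - b) = star a - star b"
  using star_add[of a "- b"] by (simp add: star_minus)

lemma star_scaleR: "star (r *\<^sub>R a) = r *\<^sub>R star a"
  by (simp add: scaleR_scaleC star_scaleC)

lemma norm_star [simp]: "norm (star a) = norm a"
proof -
  have "norm a \<le> norm (star a)" for a
  proof (cases "a = 0")
    case False
    have "norm a * norm a \<le> norm (star a) * norm a"
      using norm_mult_ineq[of "star a" a] by (simp add: cstar_identity power2_eq_square)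
    then show ?thesis
      using False by simp
  qed simp
  from this[of a] this[of "star a"] show ?thesis
    by (simp add: star_star)
qed

lemma norm_mult_star: "norm (a * star a) = (norm a)\<^sup>2"
  using cstar_identity[of "star a"] by (simp add: star_star)

text \<open>At \<open>x = star a\<close> the C*-identity turns the estimate into one for the square
  of the norm of \<open>a\<close>.\<close>

lemma norm_le_of_left_mult:
  assumes "0 \<le> M" "\<And>x. norm (a * x) \<le> M * norm x"
  shows "norm a \<le> M"
proof (cases "a = 0")
  case False
  have "norm a * norm a \<le> M * norm a"
    using assms(2)[of "star a"] by (simp add: norm_mult_star power2_eq_square)
  then show ?thesis
    using False by simp
qed (simp add: assms)

end

lemma bounded_linear_star: "bounded_linear (star :: 'a::cstar_algebra \<Rightarrow> 'a)"
  by (rule bounded_linear_intro[where K = 1]) (simp_all add: star_add star_scaleR)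

lemmas tendsto_star = bounded_linear.tendsto[OF bounded_linear_star]

section \<open>Square roots in the unitization\<close>

lemma convergent_if_summable_steps:
  fixes f :: "nat \<Rightarrow> 'a::banach"
  assumes "\<And>n. norm (f (Suc n) - f n) \<le> s n" "summable s"
  shows "convergent f"
proof -
  have "summable (\<lambda>n. f (Suc n) - f n)"
    by (rule summable_comparison_test'[OF assms(2), where N = 0]) (use assms(1) in auto)
  then have "convergent (\<lambda>n. (\<Sum>i<n. f (Suc i) - f i) + f 0)"
    unfolding summable_iff_convergent by (rule convergent_add[OF _ convergent_const])
  moreover have "(\<lambda>n. (\<Sum>i<n. f (Suc i) - f i) + f 0) = f"
    unfolding sum_lessThan_telescope by simp
  ultimately show ?thesis
    by simp
qed

text \<open>In the unitization, \<open>\<rho> + c\<close> is \<open>1 - sqrt (1 - y)\<close> for the contraction \<open>y = \<eta> + d\<close>. It is the limit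
  of \<open>r \<mapsto> (y + r\<^sup>2) / 2\<close> started at \<open>0\<close>; all estimates are dominated by the scalar iteration
  for \<open>y = 1\<close>, which converges to \<open>1\<close>.\<close>

lemma cstar_sqrt:
  fixes d :: "'a::cstar_algebra" and \<eta> :: real
  assumes \<eta>: "0 \<le> \<eta>" "\<eta> \<le> 1" and d: "star d = d"
    and contr: "\<And>x. norm (\<eta> *\<^sub>R x + d * x) \<le> norm x"
  obtains \<rho> :: real and c :: 'a
  where "\<rho>\<^sup>2 - 2 * \<rho> + \<eta> = 0" "0 \<le> \<rho>" "\<rho> \<le> 1" "c * c + (2 * \<rho>) *\<^sub>R c - 2 *\<^sub>R c + d = 0"
    "star c = c" "\<And>b. d * b = b * d \<Longrightarrow> c * b = b * c"
proof -
  \<comment> \<open>The iteration for \<open>y = 1\<close>; it bounds the norms of all iterates, and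
    its increments bound theirs.\<close>
  define \<sigma> where "\<sigma> = rec_nat (0::real) (\<lambda>_ r. (1 + r\<^sup>2) / 2)"
  \<comment> \<open>The unit need not lie in the algebra, so an iterate is kept as the pair of its
    scalar part and its algebra part.\<close>
  define rc where "rc = rec_nat (0::real, 0::'a) (\<lambda>_ (r, c). ((\<eta> + r\<^sup>2) / 2, (1/2) *\<^sub>R (d + (2 * r) *\<^sub>R c + c * c)))"
  define \<rho> where "\<rho> n = fst (rc n)" for n
  define c where "c n = snd (rc n)" for n
  have \<sigma>_0: "\<sigma> 0 = 0" and \<sigma>_Suc: "\<sigma> (Suc n) = (1 + (\<sigma> n)\<^sup>2) / 2" for n
    by (simp_all add: \<sigma>_def)
  have \<rho>_0: "\<rho> 0 = 0" and \<rho>_Suc: "\<rho> (Suc n) = (\<eta> + (\<rho> n)\<^sup>2) / 2" for n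
    by (simp_all add: \<rho>_def rc_def split_beta)
  have c_0: "c 0 = 0" and c_Suc: "c (Suc n) = (1/2) *\<^sub>R (d + (2 * \<rho> n) *\<^sub>R c n + c n * c n)" for n
    by (simp_all add: \<rho>_def c_def rc_def split_beta)
  have \<sigma>: "0 \<le> \<sigma> n \<and> \<sigma> n \<le> 1" for n
  proof (induction n)
    case (Suc n)
    then have "(\<sigma> n)\<^sup>2 \<le> 1"
      by (simp add: power_le_one)
    then show ?case
      by (simp add: \<sigma>_Suc)
  qed (simp add: \<sigma>_0)
  have \<rho>: "0 \<le> \<rho> n \<and> \<rho> n \<le> \<sigma> n" for n
  proof (induction n)
    case (Suc n)
    then show ?case
      using \<eta> by (simp add: \<rho>_Suc \<sigma>_Suc add_mono power_mono)
  qed (simp add: \<rho>_0 \<sigma>_0)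
  \<comment> \<open>Left multiplication by the iterate \<open>\<rho> n + c n\<close> of the
    unitization; it acts on the algebra itself.\<close>
  define R where "R n x = \<rho> n *\<^sub>R x + c n * x" for n x
  have R_diff: "R n x - R n y = R n (x - y)" for n x y
    by (simp add: R_def algebra_simps)
  have R_Suc: "R (Suc n) x = (1/2) *\<^sub>R ((\<eta> *\<^sub>R x + d * x) + R n (R n x))" for n x
  proof -
    have two: "(2 * \<rho> n) *\<^sub>R z = \<rho> n *\<^sub>R z + \<rho> n *\<^sub>R z" for z :: 'a
      by (simp flip: scaleR_add_left)
    have "R n (R n x) = (\<rho> n)\<^sup>2 *\<^sub>R x + (2 * \<rho> n) *\<^sub>R (c n * x) + c n * c n * x"
      by (simp add: R_def two scaleR_add_right distrib_left power2_eq_square mult.assoc)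
    moreover have "R (Suc n) x = (1/2) *\<^sub>R ((\<eta> + (\<rho> n)\<^sup>2) *\<^sub>R x + (d + (2 * \<rho> n) *\<^sub>R c n + c n * c n) * x)"
      unfolding R_def \<rho>_Suc c_Suc mult_scaleR_left by (simp add: scaleR_add_right)
    ultimately show ?thesis
      by (simp add: distrib_right scaleR_add_left add.assoc add.left_commute)
  qed
  have R_bound: "norm (R n x) \<le> \<sigma> n * norm x" for n x
  proof (induction n arbitrary: x)
    case (Suc n)
    have "norm (R n (R n x)) \<le> \<sigma> n * (\<sigma> n * norm x)"
      using Suc[of "R n x"] mult_left_mono[OF Suc[of x], of "\<sigma> n"] \<sigma>[of n] by linarith
    then have "norm (R (Suc n) x) \<le> (norm x + \<sigma> n * (\<sigma> n * norm x)) / 2"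
      using norm_triangle_ineq[of "\<eta> *\<^sub>R x + d * x" "R n (R n x)"] contr[of x] by (simp add: R_Suc)
    also have "\<dots> = \<sigma> (Suc n) * norm x"
      by (simp add: \<sigma>_Suc power2_eq_square algebra_simps)
    finally show ?case .
  qed (simp add: R_def \<rho>_0 c_0 \<sigma>_0)
  have \<rho>_step: "\<bar>\<rho> (Suc n) - \<rho> n\<bar> \<le> \<sigma> (Suc n) - \<sigma> n" for n
  proof (induction n)
    case 0
    then show ?case
      using \<eta> by (simp add: \<rho>_0 \<rho>_Suc \<sigma>_0 \<sigma>_Suc)
  next
    case (Suc n)
    have "\<rho> (Suc (Suc n)) - \<rho> (Suc n) = (\<rho> (Suc n) - \<rho> n) * (\<rho> (Suc n) + \<rho> n) / 2"
      unfolding \<rho>_Suc[of "Suc n"] \<rho>_Suc[of n] by (simp add: power2_eq_square field_simps)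
    then have "\<bar>\<rho> (Suc (Suc n)) - \<rho> (Suc n)\<bar> = \<bar>(\<rho> (Suc n) - \<rho> n) * (\<rho> (Suc n) + \<rho> n) / 2\<bar>"
      by (rule arg_cong)
    also have "\<dots> = \<bar>\<rho> (Suc n) - \<rho> n\<bar> * (\<rho> (Suc n) + \<rho> n) / 2"
      using \<rho>[of n] \<rho>[of "Suc n"] by (simp add: abs_mult)
    also have "\<dots> \<le> (\<sigma> (Suc n) - \<sigma> n) * (\<sigma> (Suc n) + \<sigma> n) / 2"
      using Suc \<rho>[of n] \<rho>[of "Suc n"] by (intro divide_right_mono mult_mono add_mono) auto
    also have "\<dots> = \<sigma> (Suc (Suc n)) - \<sigma> (Suc n)"
      unfolding \<sigma>_Suc[of "Suc n"] \<sigma>_Suc[of n] by (simp add: power2_eq_square field_simps)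
    finally show ?case .
  qed
  have R_step: "norm (R (Suc n) x - R n x) \<le> (\<sigma> (Suc n) - \<sigma> n) * norm x" for n x
  proof (induction n arbitrary: x)
    case 0
    then show ?case
      using R_bound[of "Suc 0" x] by (simp add: R_def \<rho>_0 c_0 \<sigma>_0)
  next
    case (Suc n)
    let ?\<delta> = "\<sigma> (Suc n) - \<sigma> n"
    have \<delta>: "0 \<le> ?\<delta>"
      using \<rho>_step[of n] by linarith
    have "R (Suc (Suc n)) x - R (Suc n) x = (1/2) *\<^sub>R (R (Suc n) (R (Suc n) x) - R n (R n x))"
      unfolding R_Suc[of "Suc n" x] R_Suc[of n x] by (simp add: algebra_simps)
    \<comment> \<open>The difference of squares is split so that each term contains one difference
      of consecutive iterates, without commuting any factors.\<close>
    also have "R (Suc n) (R (Suc n) x) - R n (R n x)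
        = R (Suc n) (R (Suc n) x - R n x) + (R (Suc n) (R n x) - R n (R n x))"
      by (simp flip: R_diff)
    also have "norm ((1/2) *\<^sub>R \<dots>) \<le> (\<sigma> (Suc n) * (?\<delta> * norm x) + ?\<delta> * (\<sigma> n * norm x)) / 2"
    proof -
      have "norm (R (Suc n) (R (Suc n) x - R n x)) \<le> \<sigma> (Suc n) * (?\<delta> * norm x)"
        using R_bound[of "Suc n" "R (Suc n) x - R n x"] mult_left_mono[OF Suc[of x], of "\<sigma> (Suc n)"] \<sigma>[of "Suc n"]
        by linarith
      moreover have "norm (R (Suc n) (R n x) - R n (R n x)) \<le> ?\<delta> * (\<sigma> n * norm x)"
        using Suc[of "R n x"] mult_left_mono[OF R_bound[of n x] \<delta>] by linarith
      ultimately show ?thesis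
        using norm_triangle_ineq[of "R (Suc n) (R (Suc n) x - R n x)" "R (Suc n) (R n x) - R n (R n x)"]
        by simp
    qed
    also have "\<dots> = (\<sigma> (Suc (Suc n)) - \<sigma> (Suc n)) * norm x"
      unfolding \<sigma>_Suc[of "Suc n"] \<sigma>_Suc[of n] by (simp add: power2_eq_square field_simps)
    finally show ?case .
  qed
  \<comment> \<open>The algebra part is the full difference minus the scalar one, which gives the
    factor \<open>2\<close>.\<close>
  have c_step: "norm (c (Suc n) - c n) \<le> 2 * (\<sigma> (Suc n) - \<sigma> n)" for n
  proof (rule norm_le_of_left_mult)
    show "0 \<le> 2 * (\<sigma> (Suc n) - \<sigma> n)"
      using order_trans[OF abs_ge_zero \<rho>_step[of n]] by simp
    fix x
    have "(c (Suc n) - c n) * x = (R (Suc n) x - R n x) - (\<rho> (Suc n) - \<rho> n) *\<^sub>R x"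
      by (simp add: R_def algebra_simps)
    also have "norm \<dots> \<le> norm (R (Suc n) x - R n x) + \<bar>\<rho> (Suc n) - \<rho> n\<bar> * norm x"
      by (rule order_trans[OF norm_triangle_ineq4]) simp
    also have "\<dots> \<le> 2 * (\<sigma> (Suc n) - \<sigma> n) * norm x"
      using R_step[of n x] mult_right_mono[OF \<rho>_step[of n], of "norm x"] by (simp add: algebra_simps)
    finally show "norm ((c (Suc n) - c n) * x) \<le> 2 * (\<sigma> (Suc n) - \<sigma> n) * norm x" .
  qed
  have summ: "summable (\<lambda>n. \<sigma> (Suc n) - \<sigma> n)"
  proof (rule summableI_nonneg_bounded[where x = 1])
    show "0 \<le> \<sigma> (Suc n) - \<sigma> n" for n
      using \<rho>_step[of n] by linarith
    show "(\<Sum>i<n. \<sigma> (Suc i) - \<sigma> i) \<le> 1" for n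
      using \<sigma>[of n] by (simp add: sum_lessThan_telescope \<sigma>_0)
  qed
  have "convergent \<rho>"
    using \<rho>_step summ by (intro convergent_if_summable_steps[of \<rho> "\<lambda>n. \<sigma> (Suc n) - \<sigma> n"]) auto
  then obtain r where r: "\<rho> \<longlonglongrightarrow> r"
    by (auto simp: convergent_def)
  have "convergent c"
    using c_step summable_mult[OF summ] by (rule convergent_if_summable_steps)
  then obtain z where z: "c \<longlonglongrightarrow> z"
    by (auto simp: convergent_def)
  show thesis
  proof
    have "(\<lambda>n. \<rho> (Suc n)) \<longlonglongrightarrow> (\<eta> + r\<^sup>2) / 2"
      unfolding \<rho>_Suc by (intro tendsto_intros r) simp
    then have "r = (\<eta> + r\<^sup>2) / 2"
      using LIMSEQ_unique[OF LIMSEQ_Suc[OF r]] by blast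
    then show "r\<^sup>2 - 2 * r + \<eta> = 0"
      by simp
    show "0 \<le> r"
      using r \<rho> by (intro LIMSEQ_le_const[OF r]) auto
    show "r \<le> 1"
      using \<rho> \<sigma> by (intro LIMSEQ_le_const2[OF r]) (meson order_trans)
    have "(\<lambda>n. c (Suc n)) \<longlonglongrightarrow> (1/2) *\<^sub>R (d + (2 * r) *\<^sub>R z + z * z)"
      unfolding c_Suc by (intro tendsto_intros r z)
    then have "z = (1/2) *\<^sub>R (d + (2 * r) *\<^sub>R z + z * z)"
      using LIMSEQ_unique[OF LIMSEQ_Suc[OF z]] by blast
    from arg_cong[OF this, of "\<lambda>w. 2 *\<^sub>R w"] have "2 *\<^sub>R z = d + (2 * r) *\<^sub>R z + z * z"
      unfolding scaleR_scaleR by simp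
    then show "z * z + (2 * r) *\<^sub>R z - 2 *\<^sub>R z + d = 0"
      by simp
    have "star (c n) = c n" for n
      by (induction n) (simp_all add: c_0 c_Suc star_scaleR star_add star_mult d)
    with tendsto_star[OF z] have "c \<longlonglongrightarrow> star z"
      by simp
    then show "star z = z"
      using z by (rule LIMSEQ_unique)
    show "z * b = b * z" if b: "d * b = b * d" for b
    proof -
      have "c n * b = b * c n" for n
      proof (induction n)
        case (Suc n)
        have "c n * c n * b = b * (c n * c n)"
          using Suc by (metis mult.assoc)
        then show ?case
          using Suc b by (simp add: c_Suc distrib_left distrib_right)
      qed (simp add: c_0)
      with tendsto_mult[OF z tendsto_const[of b]] have "(\<lambda>n. b * c n) \<longlonglongrightarrow> z * b"
        by simp
      then show ?thesis
        using tendsto_mult[OF tendsto_const[of b] z] by (rule LIMSEQ_unique)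
    qed
  qed
qed

text \<open>With \<open>s = sqrt (1 - x\<^sup>2)\<close>, the element \<open>w = x + \<i>s\<close> of the unitization is unitary,
  and \<open>1 - x\<^sup>2 = (2 - w\<^sup>2 - w\<^sup>*\<^sup>2) / 4\<close>.\<close>

lemma norm_diff_square_le:
  fixes x :: "'a::cstar_algebra"
  assumes x: "star x = x" "norm x \<le> 1"
  shows "norm (y - x * (x * y)) \<le> norm y"
proof -
  have xx: "norm (0 *\<^sub>R z + x * x * z) \<le> norm z" for z
  proof -
    have "norm (x * x * z) \<le> norm x * (norm x * norm z)"
      using norm_mult_ineq[of x "x * z"] mult_left_mono[OF norm_mult_ineq[of x z], of "norm x"]
      by (simp add: mult.assoc)
    also have "\<dots> \<le> 1 * (1 * norm z)"
      using x(2) by (intro mult_mono) auto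
    finally show ?thesis by simp
  qed
  have "star (x * x) = x * x"
    by (simp add: star_mult x(1))
  then obtain \<rho> :: real and c where c: "\<rho>\<^sup>2 - 2 * \<rho> + 0 = 0" "0 \<le> \<rho>" "\<rho> \<le> 1"
    "c * c + (2 * \<rho>) *\<^sub>R c - 2 *\<^sub>R c + x * x = 0" "star c = c"
    "\<And>b. x * x * b = b * (x * x) \<Longrightarrow> c * b = b * c"
    using cstar_sqrt[of 0 "x * x", OF order_refl zero_le_one _ xx] by blast
  \<comment> \<open>The scalar roots are \<open>0\<close> and \<open>2\<close>, and
    \<open>\<rho> \<le> 1\<close> excludes the second. So the square root of
    \<open>1 - x * x\<close> is \<open>1 - c\<close> with \<open>c\<close> in the algebra.\<close>
  have "\<rho> = 0"
    using c(1,3) by (auto simp: power2_eq_square right_diff_distrib[symmetric] mult_2[symmetric])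
  then have cc: "c * c = 2 *\<^sub>R c - x * x"
    using c(4) by (simp add: algebra_simps)
  have cx: "c * x = x * c"
    by (intro c(6)) (simp add: mult.assoc)
  define s where "s y = y - c * y" for y
  have ss: "s (s y) = y - x * (x * y)" for y
  proof -
    have "c * (c * y) = 2 *\<^sub>R (c * y) - x * (x * y)"
      using arg_cong[OF cc, of "\<lambda>z. z * y"] by (simp add: mult.assoc left_diff_distrib)
    then show ?thesis
      by (simp add: s_def algebra_simps scaleR_2)
  qed
  have xs: "x * s y = s (x * y)" for y
    using arg_cong[OF cx, of "\<lambda>z. z * y"] by (simp add: s_def algebra_simps)
  have star_s: "star (s y) * z = star y * s z" for y z
    by (simp add: s_def star_diff star_mult c(5) algebra_simps)
  define w where "w k y = x * y + k *\<^sub>C s y" for k y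
  \<comment> \<open>\<open>x\<close> commutes with the square root and \<open>k\<close> is
    imaginary, so the mixed terms cancel; the two squares add up to
    \<open>star y * y\<close>.\<close>
  have w_norm: "norm (w k y) = norm y" if k: "k = \<i> \<or> k = - \<i>" for k y
  proof -
    have "star (w k y) * w k y = star y * (x * (x * y)) + star y * s (s y)"
    proof -
      have "star (w k y) * w k y = star y * x * (x * y) + k *\<^sub>C (star y * x * s y)
          + cnj k *\<^sub>C (star (s y) * (x * y)) + (cnj k * k) *\<^sub>C (star (s y) * s y)"
        by (simp add: w_def star_add star_scaleC star_mult x(1) distrib_left distrib_right scaleC_mult_left
            scaleC_mult_right scaleC_add_right scaleC_scaleC)
      also have "star y * x * s y = star (s y) * (x * y)"
        by (simp add: star_s xs mult.assoc)
      also have "star (s y) * s y = star y * s (s y)"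
        by (rule star_s)
      finally show ?thesis
        using k by (auto simp: mult.assoc scaleC_one)
    qed
    also have "\<dots> = star y * y"
      by (simp add: ss algebra_simps)
    finally have "(norm (w k y))\<^sup>2 = (norm y)\<^sup>2"
      by (simp flip: cstar_identity)
    then show ?thesis
      by simp
  qed
  have ww: "w \<i> (w \<i> y) + w (-\<i>) (w (-\<i>) y) = 2 *\<^sub>R y - 4 *\<^sub>R (y - x * (x * y))"
  proof -
    have sadd: "s (a + b) = s a + s b" "s (k *\<^sub>C a) = k *\<^sub>C s a" for a b k
      by (simp_all add: s_def algebra_simps scaleC_diff_right scaleC_mult_right)
    have w: "w k (w k y) = x * (x * y) + k *\<^sub>C s (x * y) + (k *\<^sub>C s (x * y) + (k * k) *\<^sub>C s (s y))" for k
      by (simp only: w_def sadd distrib_left scaleC_mult_right xs scaleC_add_right scaleC_scaleC)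
    have "w \<i> (w \<i> y) + w (-\<i>) (w (-\<i>) y) = 2 *\<^sub>R (x * (x * y)) - 2 *\<^sub>R s (s y)"
      unfolding w by (simp add: scaleR_2)
    moreover have "4 *\<^sub>R z = 2 *\<^sub>R z + 2 *\<^sub>R z" for z :: 'a
      by (simp flip: scaleR_add_left)
    ultimately show ?thesis
      by (simp add: ss scaleR_diff_right)
  qed
  have "4 * norm (y - x * (x * y)) = norm (2 *\<^sub>R y - (w \<i> (w \<i> y) + w (-\<i>) (w (-\<i>) y)))"
    by (simp add: ww)
  also have "\<dots> \<le> norm (2 *\<^sub>R y) + (norm (w \<i> (w \<i> y)) + norm (w (-\<i>) (w (-\<i>) y)))"
    by (meson add_left_mono norm_triangle_ineq norm_triangle_ineq4 order_trans)
  also have "\<dots> = 4 * norm y"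
    by (simp add: w_norm)
  finally show ?thesis
    by simp
qed

section \<open>Approximate units\<close>

text \<open>Trades smallness at \<open>y\<close> for smallness at \<open>y * star y\<close>. In
  \<open>z * star z\<close> the factor \<open>1 - e\<close> on the left is dropped by contractivity,
  and the one on the right is moved to the left by taking adjoints.\<close>

lemma square_norm_diff_mult_le:
  fixes e :: "'a::cstar_algebra"
  assumes e: "\<And>x. norm (x - e * x) \<le> norm x"
  shows "(norm (y - e * y))\<^sup>2 \<le> norm (y * star y - e * (y * star y))"
proof -
  define z where "z = y - e * y"
  have "(norm z)\<^sup>2 = norm (y * star z - e * (y * star z))"
    by (simp add: z_def left_diff_distrib mult.assoc flip: norm_mult_star)
  also have "\<dots> \<le> norm (y * star z)"
    by (rule e)
  also have "\<dots> = norm (z * star y)"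
    by (metis norm_star star_mult star_star)
  also have "z * star y = y * star y - e * (y * star y)"
    by (simp add: z_def left_diff_distrib mult.assoc)
  finally show ?thesis
    by (simp add: z_def)
qed

text \<open>\<open>1 - e\<close> is a Cesaro mean of the powers of the contraction \<open>1 - b\<^sup>2\<close>, where \<open>b\<close> is a multiple
  of \<open>a a\<^sup>*\<close>; as in the mean ergodic theorem it tends to \<open>0\<close> on the range of \<open>b\<^sup>2\<close>.\<close>

lemma approximate_unit_single:
  fixes a :: "'a::cstar_algebra"
  assumes \<epsilon>: "0 < \<epsilon>"
  shows "\<exists>e. (\<forall>x. norm (x - e * x) \<le> norm x) \<and> norm (a - e * a) < \<epsilon>"
proof -
  define d where "d = a * star a"
  \<comment> \<open>The scaling makes \<open>b\<close> a contraction; adding \<open>1\<close> avoids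
    a division by zero.\<close>
  define s where "s = 1 / (1 + norm d)"
  define b where "b = s *\<^sub>R d"
  have s: "0 < s"
    by (simp add: s_def add_pos_nonneg)
  have b: "star b = b" "norm b \<le> 1"
    using s by (simp_all add: b_def d_def star_scaleR star_mult star_star)
      (simp add: s_def d_def field_simps add_pos_nonneg)
  define R where "R x = x - b * (b * x)" for x
  \<comment> \<open>\<open>e k\<close> is \<open>1 - (1 - b * b) ^ k\<close>, expanded so as to
    remain in the algebra.\<close>
  define e where "e = rec_nat (0::'a) (\<lambda>_ c. c + b * b - b * b * c)"
  have Rk: "(R ^^ k) x = x - e k * x" for k x
  proof (induction k)
    case (Suc k)
    have "(R ^^ Suc k) x = R (x - e k * x)"
      by (simp only: funpow.simps comp_apply Suc)
    also have "\<dots> = x - (e k + b * b - b * b * e k) * x"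
      by (simp add: R_def algebra_simps)
    finally show ?case
      by (simp add: e_def)
  qed (simp add: e_def)
  have R_contr: "norm ((R ^^ k) x) \<le> norm x" for k x
  proof (induction k)
    case (Suc k)
    have "norm (R y) \<le> norm y" for y
      unfolding R_def by (rule norm_diff_square_le[OF b])
    from order_trans[OF this Suc] show ?case
      by simp
  qed simp
  \<comment> \<open>Three uses of \<open>square_norm_diff_mult_le\<close> lead from \<open>a\<close>
    through \<open>d\<close> and \<open>d * d\<close> to the fourth power of \<open>d\<close>, which
    contains \<open>b * b\<close>. This is the origin of the exponent \<open>8\<close>.\<close>
  define C where "C = 2 * norm (d * d) / s\<^sup>2"
  obtain m where m: "C / \<epsilon> ^ 8 < real (Suc m)"
    using reals_Archimedean2[of "C / \<epsilon> ^ 8"] by (metis less_Suc_eq of_nat_less_iff order_less_trans)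
  define E where "E = (1 / real (Suc m)) *\<^sub>R (\<Sum>k<Suc m. e k)"
  have E: "x - E * x = (1 / real (Suc m)) *\<^sub>R (\<Sum>k<Suc m. (R ^^ k) x)" for x
    unfolding Rk E_def
    by (simp only: sum_subtractf sum_constant_scaleR card_lessThan scaleR_diff_right mult_scaleR_left
        sum_distrib_right scaleR_scaleR) simp
  have E_contr: "norm (x - E * x) \<le> norm x" for x
  proof -
    have "norm (\<Sum>k<Suc m. (R ^^ k) x) \<le> real (Suc m) * norm x"
      using sum_norm_bound[of "{..<Suc m}" "\<lambda>k. (R ^^ k) x" "norm x"] R_contr by simp
    then have "(1 / real (Suc m)) * norm (\<Sum>k<Suc m. (R ^^ k) x) \<le> (1 / real (Suc m)) * (real (Suc m) * norm x)"
      by (rule mult_left_mono) simp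
    moreover have "norm (x - E * x) = (1 / real (Suc m)) * norm (\<Sum>k<Suc m. (R ^^ k) x)"
      unfolding E norm_scaleR by simp
    ultimately show ?thesis
      by simp
  qed
  \<comment> \<open>\<open>b * b\<close> acts as \<open>1 - R\<close>, so the mean telescopes to its
    first and last term.\<close>
  have E_b: "norm (b * (b * x) - E * (b * (b * x))) \<le> 2 * norm x / real (Suc m)" for x
  proof -
    have "(R ^^ k) (b * (b * x)) = (R ^^ k) x - (R ^^ Suc k) x" for k
    proof -
      have "(R ^^ k) (b * (b * x)) = (R ^^ k) (x - R x)"
        by (simp add: R_def)
      also have "\<dots> = (R ^^ k) x - (R ^^ k) (R x)"
        unfolding Rk by (simp add: algebra_simps)
      finally show ?thesis
        by (simp add: funpow_swap1)
    qed
    then have "b * (b * x) - E * (b * (b * x)) = (1 / real (Suc m)) *\<^sub>R (x - (R ^^ Suc m) x)"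
      unfolding E using sum_lessThan_telescope'[of "\<lambda>k. (R ^^ k) x" "Suc m"]
      by (simp only: funpow_0)
    also have "norm \<dots> = norm (x - (R ^^ Suc m) x) / real (Suc m)"
      by simp
    also have "norm (x - (R ^^ Suc m) x) \<le> norm x + norm x"
      by (rule order_trans[OF norm_triangle_ineq4 add_left_mono[OF R_contr]])
    finally show ?thesis
      by (simp add: divide_right_mono)
  qed
  note L = square_norm_diff_mult_le[of E, OF E_contr]
  have star_d: "star d = d" "star (d * d) = d * d"
    by (simp_all add: d_def star_mult star_star mult.assoc)
  have "norm (a - E * a) ^ 8 = (((norm (a - E * a))\<^sup>2)\<^sup>2)\<^sup>2"
    by simp
  also have "\<dots> \<le> ((norm (d - E * d))\<^sup>2)\<^sup>2"
    using L[of a] by (intro power_mono) (auto simp: d_def)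
  also have "\<dots> \<le> (norm (d * d - E * (d * d)))\<^sup>2"
    using L[of d] by (intro power_mono) (auto simp: star_d)
  also have "\<dots> \<le> norm (d * d * (d * d) - E * (d * d * (d * d)))"
    using L[of "d * d"] by (simp add: star_d)
  also have "d * d * (d * d) = (1 / s\<^sup>2) *\<^sub>R (b * (b * (d * d)))"
    using s by (simp add: b_def power2_eq_square mult.assoc)
  also have "norm ((1 / s\<^sup>2) *\<^sub>R (b * (b * (d * d))) - E * ((1 / s\<^sup>2) *\<^sub>R (b * (b * (d * d)))))
      = norm (b * (b * (d * d)) - E * (b * (b * (d * d)))) / s\<^sup>2"
    by (simp flip: scaleR_diff_right)
  also have "\<dots> \<le> (2 * norm (d * d) / real (Suc m)) / s\<^sup>2"
    by (intro divide_right_mono E_b) simp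
  also have "\<dots> = C / real (Suc m)"
    by (simp add: C_def)
  also have "\<dots> < \<epsilon> ^ 8"
    using m \<epsilon> by (simp add: field_simps)
  finally have "norm (a - E * a) < \<epsilon>"
    by (rule power_less_imp_less_base) (use \<epsilon> in simp)
  then show ?thesis
    using E_contr by blast
qed

text \<open>For one more element a unit \<open>f\<close> is taken for the remainder
  \<open>a - e * a\<close>; passing to \<open>(1 - f) * (1 - e)\<close>, a product of contractions,
  does not spoil the earlier estimates. The bound \<open>2\<close> comes from writing
  \<open>e * x\<close> as \<open>x - (x - e * x)\<close>.\<close>

lemma approximate_unit:
  fixes S :: "'a::cstar_algebra set"
  assumes "finite S" and \<epsilon>: "0 < \<epsilon>"
  shows "\<exists>e. norm e \<le> 2 \<and> (\<forall>a\<in>S. norm (a - e * a) < \<epsilon>)"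
proof -
  have "\<exists>e. (\<forall>x. norm (x - e * x) \<le> norm x) \<and> (\<forall>a\<in>S. norm (a - e * a) < \<epsilon>)"
    using assms(1)
  proof (induction S)
    case empty
    show ?case
      by (rule exI[of _ 0]) simp
  next
    case (insert a S)
    then obtain e where e: "\<And>x. norm (x - e * x) \<le> norm x" "\<And>a. a \<in> S \<Longrightarrow> norm (a - e * a) < \<epsilon>"
      by blast
    obtain f where f: "\<And>x. norm (x - f * x) \<le> norm x" "norm ((a - e * a) - f * (a - e * a)) < \<epsilon>"
      using approximate_unit_single[OF \<epsilon>] by blast
    define g where "g = e + f - f * e"
    have g: "x - g * x = (x - e * x) - f * (x - e * x)" for x
      by (simp add: g_def algebra_simps)
    show ?case
    proof (intro exI[of _ g] conjI allI ballI)
      show "norm (x - g * x) \<le> norm x" for x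
        unfolding g using f(1) e(1) order_trans by blast
      show "norm (x - g * x) < \<epsilon>" if "x \<in> insert a S" for x
        unfolding g using that f(2) e(2) order_le_less_trans[OF f(1)] by blast
    qed
  qed
  then obtain e where e: "\<And>x. norm (x - e * x) \<le> norm x" "\<forall>a\<in>S. norm (a - e * a) < \<epsilon>"
    by blast
  have "norm e \<le> 2"
  proof (rule norm_le_of_left_mult)
    show "norm (e * x) \<le> 2 * norm x" for x
      using norm_triangle_ineq4[of x "x - e * x"] e(1)[of x] by simp
  qed simp
  then show ?thesis
    using e(2) by blast
qed

section \<open>Completely positive maps\<close>

locale cp_map =
  fixes H :: "'h::chilbert_space set" and \<phi> :: "'a::cstar_algebra \<Rightarrow> 'h \<Rightarrow> 'h"
  assumes hilbert_H: "hilbert_space H" and cp: "completely_positive H \<phi>"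
begin

lemma bounded_phi: "bounded_op H H (\<phi> a)"
  and phi_add: "h \<in> H \<Longrightarrow> \<phi> (a + b) h = \<phi> a h + \<phi> b h"
  and phi_scaleC: "h \<in> H \<Longrightarrow> \<phi> (c *\<^sub>C a) h = c *\<^sub>C \<phi> a h"
  using cp unfolding completely_positive_def linear_into_ops_def by auto

lemma phi_scaleR: "h \<in> H \<Longrightarrow> \<phi> (r *\<^sub>R a) h = r *\<^sub>R \<phi> a h"
  by (simp add: scaleR_scaleC phi_scaleC)

lemma phi_zero: "h \<in> H \<Longrightarrow> \<phi> 0 h = 0"
  using phi_scaleC[of h 0 0] by simp

lemma phi_diff: "h \<in> H \<Longrightarrow> \<phi> (a - b) h = \<phi> a h - \<phi> b h"
  using phi_add[of h "a - b" b] by simp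

text \<open>The matrix with entries \<open>star (a i) * a j\<close> is positive as the square of a
  matrix whose row \<open>0\<close> consists of the \<open>a i\<close> and whose other rows
  vanish.\<close>

lemma phi_psd:
  assumes F: "finite F" and h: "\<And>i. i \<in> F \<Longrightarrow> h i \<in> H"
  shows "(\<Sum>i\<in>F. \<Sum>j\<in>F. cinner (h i) (\<phi> (star (a i) * a j) (h j))) \<in> \<real>\<^sub>\<ge>\<^sub>0"
proof -
  let ?n = "card F"
  obtain f where f: "bij_betw f {..<?n} F"
    using ex_bij_betw_nat_finite[OF F] by (auto simp: atLeast0LessThan)
  let ?b = "\<lambda>k i. if k = (0::nat) then a (f i) else 0"
  have "star (a (f i)) * a (f j) = (\<Sum>k<?n. star (?b k i) * ?b k j)" if "i < ?n" for i j
  proof -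
    have "(\<Sum>k<?n. star (?b k i) * ?b k j) = (\<Sum>k<?n. if k = 0 then star (a (f i)) * a (f j) else 0)"
      by (intro sum.cong) auto
    then show ?thesis
      using that by auto
  qed
  then have "positive_matrix ?n (\<lambda>i j. star (a (f i)) * a (f j))"
    unfolding positive_matrix_def by (intro exI[of _ ?b]) blast
  then have "positive_op_matrix H ?n (\<lambda>i j. \<phi> (star (a (f i)) * a (f j)))"
    using cp unfolding completely_positive_def by blast
  moreover have "\<forall>i<?n. h (f i) \<in> H"
    using f h by (auto simp: bij_betw_def)
  ultimately have "(\<Sum>i<?n. \<Sum>j<?n. cinner (h (f i)) (\<phi> (star (a (f i)) * a (f j)) (h (f j)))) \<in> \<real>\<^sub>\<ge>\<^sub>0"
    unfolding positive_op_matrix_def by (elim allE[of _ "\<lambda>i. h (f i)"]) blast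
  also have "(\<Sum>i<?n. \<Sum>j<?n. cinner (h (f i)) (\<phi> (star (a (f i)) * a (f j)) (h (f j))))
      = (\<Sum>i\<in>F. \<Sum>j\<in>F. cinner (h i) (\<phi> (star (a i) * a j) (h j)))"
    by (simp only: sum.reindex_bij_betw[OF f, of "\<lambda>j. cinner (h (f i)) (\<phi> (star (a (f i)) * a j) (h j))" for i]
        sum.reindex_bij_betw[OF f, of "\<lambda>i. \<Sum>j\<in>F. cinner (h i) (\<phi> (star (a i) * a j) (h j))"])
  finally show ?thesis .
qed

lemma phi_square_nonneg: "h \<in> H \<Longrightarrow> 0 \<le> Re (cinner h (\<phi> (star a * a) h))"
  using phi_psd[of "{()}" "\<lambda>_. h" "\<lambda>_. a"] by (simp add: complex_nonneg_Reals_iff)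

text \<open>The hypothesis says that \<open>1 - p / t\<close> is a contraction in the unitization; for self-adjoint \<open>p\<close>
  this is positivity, in a form that is visibly preserved by sums and limits.\<close>

lemma phi_nonneg:
  assumes p: "star p = p" and t: "0 \<le> t" and contr: "\<And>x. norm (t *\<^sub>R x - p * x) \<le> t * norm x"
    and h: "h \<in> H"
  shows "0 \<le> Re (cinner h (\<phi> p h))"
proof (cases "t = 0")
  case True
  then have "norm p \<le> 0"
    by - (rule norm_le_of_left_mult, use contr in auto)
  then show ?thesis
    using h by (simp add: phi_zero)
next
  case False
  then have t: "0 < t"
    using t by simp
  have d: "norm (1 *\<^sub>R x + (- (1 / t)) *\<^sub>R p * x) \<le> norm x" for x
  proof -
    have "1 *\<^sub>R x + (- (1 / t)) *\<^sub>R p * x = (1 / t) *\<^sub>R (t *\<^sub>R x - p * x)"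
      using t by (simp add: scaleR_diff_right)
    then show ?thesis
      using contr[of x] t by (simp only: norm_scaleR) (simp add: field_simps)
  qed
  have "star ((- (1 / t)) *\<^sub>R p) = (- (1 / t)) *\<^sub>R p"
    by (simp only: star_scaleR p)
  then obtain \<rho> :: real and c where c: "\<rho>\<^sup>2 - 2 * \<rho> + 1 = 0"
    "c * c + (2 * \<rho>) *\<^sub>R c - 2 *\<^sub>R c + (- (1 / t)) *\<^sub>R p = 0" "star c = c"
    using cstar_sqrt[of 1 "(- (1 / t)) *\<^sub>R p", OF zero_le_one order_refl _ d] by blast
  \<comment> \<open>For \<open>\<eta> = 1\<close> the scalar equation has the double root
    \<open>1\<close>. The square root \<open>1 - (\<rho> + c)\<close> is therefore
    \<open>- c\<close> and lies in the algebra itself.\<close>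
  have "(\<rho> - 1)\<^sup>2 = 0"
    using c(1) by (simp add: power2_diff)
  then have "c * c = (1 / t) *\<^sub>R p"
    using c(2) by simp
  then have "p = star (sqrt t *\<^sub>R c) * (sqrt t *\<^sub>R c)"
    using t by (simp add: star_scaleR c(3))
  then show ?thesis
    using phi_square_nonneg[OF h, of "sqrt t *\<^sub>R c"] by simp
qed

text \<open>A gliding hump: if the bound failed along \<open>x\<^sub>n\<close>, \<open>h\<^sub>n\<close>, the single bounded operator
  \<open>\<phi> (\<Sum> 2\<^sup>-\<^sup>n x\<^sub>n\<^sup>2)\<close> would dominate all the humps.\<close>

lemma phi_selfadjoint_square_bounded:
  "\<exists>C. \<forall>x h. star x = x \<longrightarrow> norm x \<le> 1 \<longrightarrow> h \<in> H \<longrightarrow> norm h \<le> 1 \<longrightarrow> Re (cinner h (\<phi> (x * x) h)) \<le> C"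
proof (rule ccontr)
  assume "\<not> ?thesis"
  \<comment> \<open>The humps \<open>4 ^ Suc n\<close> outgrow the weights
    \<open>(1/2) ^ Suc n\<close>: a weighted hump is still at least
    \<open>2 ^ Suc n\<close>.\<close>
  then have "\<exists>x h. star x = x \<and> norm x \<le> 1 \<and> h \<in> H \<and> norm h \<le> 1 \<and> 4 ^ Suc n < Re (cinner h (\<phi> (x * x) h))"
    for n :: nat
    by (metis not_le)
  then obtain x h where x: "\<And>n. star (x n) = x n" "\<And>n. norm (x n) \<le> 1"
    and h: "\<And>n. h n \<in> H" "\<And>n. norm (h n) \<le> 1"
    and big: "\<And>n. 4 ^ Suc n < Re (cinner (h n) (\<phi> (x n * x n) (h n)))"
    by metis
  define p where "p n = x n * x n" for n
  have p: "star (p n) = p n" "norm (p n) \<le> 1" for n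
    using x[of n] norm_mult_ineq[of "x n" "x n"] mult_mono[of "norm (x n)" 1 "norm (x n)" 1]
    by (auto simp: p_def star_mult)
  have p_contr: "norm (y - p n * y) \<le> norm y" for n y
    using norm_diff_square_le[OF x] by (simp add: p_def mult.assoc)
  have half: "summable (\<lambda>n. (1/2::real) ^ Suc n)"
    by (simp add: summable_mult)
  have "summable (\<lambda>n. (1/2) ^ Suc n *\<^sub>R p n)"
  proof (rule summable_comparison_test'[OF half, where N = 0])
    show "norm ((1/2) ^ Suc n *\<^sub>R p n) \<le> (1/2) ^ Suc n" for n
      using mult_left_mono[OF p(2)[of n], of "(1/2) ^ Suc n"] by simp
  qed
  then obtain P where P: "(\<lambda>n. (1/2) ^ Suc n *\<^sub>R p n) sums P"
    by (auto simp: summable_def)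
  \<comment> \<open>Removing one hump leaves a positive element: a weighted sum of the other
    squares, to which \<open>phi_nonneg\<close> applies with \<open>t\<close> the sum of their
    weights.\<close>
  have tail: "0 \<le> Re (cinner g (\<phi> (P - (1/2) ^ Suc k *\<^sub>R p k) g))" if g: "g \<in> H" for k g
  proof -
    define w where "w n = (if n = k then 0 else (1/2::real) ^ Suc n)" for n
    have w0: "0 \<le> w n" for n
      by (simp add: w_def)
    have "summable w"
      by (rule summable_comparison_test'[OF half, where N = 0]) (simp add: w_def)
    then obtain t where t: "w sums t"
      by (auto simp: summable_def)
    define q where "q = P - (1/2) ^ Suc k *\<^sub>R p k"
    have q: "(\<lambda>n. w n *\<^sub>R p n) sums q"
    proof -
      have "(\<lambda>n. if n = k then (1/2) ^ Suc n *\<^sub>R p n else 0) sums ((1/2) ^ Suc k *\<^sub>R p k)"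
        by (rule sums_single)
      from sums_diff[OF P this] show ?thesis
        unfolding q_def by (rule sums_cong[THEN iffD1, rotated]) (simp add: w_def)
    qed
    show ?thesis
      unfolding q_def[symmetric]
    proof (rule phi_nonneg[OF _ _ _ g, where t = t])
      have "(\<lambda>n. w n *\<^sub>R p n) sums star q"
        using bounded_linear.sums[OF bounded_linear_star q] by (simp add: star_scaleR p)
      then show "star q = q"
        using q sums_unique2 by blast
      show "0 \<le> t"
        using sums_le[OF w0 sums_zero t] .
      show "norm (t *\<^sub>R y - q * y) \<le> t * norm y" for y
      proof -
        have "(\<lambda>n. w n *\<^sub>R y - w n *\<^sub>R p n * y) sums (t *\<^sub>R y - q * y)"
          by (intro sums_diff sums_scaleR_left sums_mult2 t q)
        moreover have "(\<lambda>n. w n * norm y) sums (t * norm y)"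
          by (rule sums_mult2[OF t])
        moreover have "norm (w n *\<^sub>R y - w n *\<^sub>R p n * y) \<le> w n * norm y" for n
        proof -
          have "w n *\<^sub>R y - w n *\<^sub>R p n * y = w n *\<^sub>R (y - p n * y)"
            by (simp add: scaleR_diff_right)
          then show ?thesis
            using mult_left_mono[OF p_contr w0] w0[of n] by simp
        qed
        ultimately show ?thesis
          using norm_suminf_le[of "\<lambda>n. w n *\<^sub>R y - w n *\<^sub>R p n * y" "\<lambda>n. w n * norm y"]
          by (auto simp: sums_iff)
      qed
    qed
  qed
  obtain B where B: "B \<ge> 0" "\<And>g. g \<in> H \<Longrightarrow> norm (\<phi> P g) \<le> B * norm g"
    using bounded_op_bound[OF bounded_phi] by blast
  obtain k where k: "B < 2 ^ k"
    using real_arch_pow[of 2 B] by auto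
  have "(2::real) ^ Suc k = (1/2) ^ Suc k * 4 ^ Suc k"
    by (simp only: power_mult_distrib[symmetric]) simp
  also have "\<dots> \<le> (1/2) ^ Suc k * Re (cinner (h k) (\<phi> (p k) (h k)))"
    using big[of k] by (intro mult_left_mono) (auto simp: p_def)
  also have "\<dots> \<le> Re (cinner (h k) (\<phi> P (h k)))"
    using tail[OF h(1), of k k] h(1)[of k]
    by (simp add: phi_diff phi_scaleR cinner_diff_right cinner_scaleR_right del: power_Suc of_real_power)
  also have "\<dots> \<le> norm (h k) * norm (\<phi> P (h k))"
    using complex_Re_le_cmod cmod_cinner_le order_trans by blast
  also have "\<dots> \<le> 1 * (B * 1)"
    using h B by (intro mult_mono order_trans[OF B(2)] mult_left_mono) auto
  finally show False
    using k B(1) by simp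
qed

text \<open>Homogeneity gives the self-adjoint case. If \<open>x\<close> and \<open>y\<close> are
  the real and imaginary part of \<open>a\<close>, the positive element \<open>a * star a\<close>
  completes \<open>star a * a\<close> to \<open>2 *\<^sub>R (x * x) + 2 *\<^sub>R (y * y)\<close>,
  whence the factor \<open>4\<close>.\<close>

lemma phi_square_bounded:
  "\<exists>C\<ge>0. \<forall>a. \<forall>h\<in>H. Re (cinner h (\<phi> (star a * a) h)) \<le> C * (norm a)\<^sup>2 * (norm h)\<^sup>2"
proof -
  obtain C where C: "\<And>x h. star x = x \<Longrightarrow> norm x \<le> 1 \<Longrightarrow> h \<in> H \<Longrightarrow> norm h \<le> 1 \<Longrightarrow>
      Re (cinner h (\<phi> (x * x) h)) \<le> C"
    using phi_selfadjoint_square_bounded by blast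
  have C0: "0 \<le> C"
    using C[of 0 0] hilbert_space_0[OF hilbert_H] by simp
  have sa: "Re (cinner h (\<phi> (x * x) h)) \<le> C * (norm x)\<^sup>2 * (norm h)\<^sup>2" if x: "star x = x" and h: "h \<in> H" for x h
  proof (cases "x = 0 \<or> h = 0")
    case True
    then show ?thesis
      using h by (auto simp: phi_zero)
  next
    case False
    define y g where "y = (1 / norm x) *\<^sub>R x" and "g = (1 / norm h) *\<^sub>R h"
    have y: "star y = y" "norm y \<le> 1" and g: "g \<in> H" "norm g \<le> 1"
      using False x h by (simp_all add: y_def g_def star_scaleR hilbert_space_scaleR[OF hilbert_H])
    have "\<phi> (x * x) h = ((norm x)\<^sup>2 * norm h) *\<^sub>R \<phi> (y * y) g"
    proof -
      have "x * x = (norm x)\<^sup>2 *\<^sub>R (y * y)" "h = norm h *\<^sub>R g"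
        using False by (simp_all add: y_def g_def power2_eq_square)
      then show ?thesis
        using g by (metis bounded_op_scaleR[OF bounded_phi] phi_scaleR h scaleR_scaleR)
    qed
    then have "Re (cinner h (\<phi> (x * x) h)) = Re (cinner (norm h *\<^sub>R g) (((norm x)\<^sup>2 * norm h) *\<^sub>R \<phi> (y * y) g))"
      using False by (simp add: g_def)
    also have "\<dots> = norm h * ((norm x)\<^sup>2 * norm h) * Re (cinner g (\<phi> (y * y) g))"
      by (simp add: cinner_scaleR_left cinner_scaleR_right del: of_real_mult of_real_power)
    also have "\<dots> \<le> norm h * ((norm x)\<^sup>2 * norm h) * C"
      using y g by (intro mult_left_mono C) auto
    finally show ?thesis
      by (simp add: power2_eq_square mult.assoc mult.commute mult.left_commute)
  qed
  have "Re (cinner h (\<phi> (star a * a) h)) \<le> (4 * C) * (norm a)\<^sup>2 * (norm h)\<^sup>2" if h: "h \<in> H" for a h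
  proof -
    define x y where "x = (1/2) *\<^sub>R (a + star a)" and "y = (\<i> / 2) *\<^sub>C (star a - a)"
    have x: "star x = x" "norm x \<le> norm a"
      using norm_triangle_ineq[of a "star a"] by (auto simp: x_def star_scaleR star_add star_star add.commute)
    have y: "star y = y" "norm y \<le> norm a"
    proof -
      have "star y = (- (\<i> / 2)) *\<^sub>C (a - star a)"
        by (simp add: y_def star_scaleC star_diff star_star)
      also have "\<dots> = y"
        by (simp only: y_def complex_vector.scale_minus_left complex_vector.scale_minus_right[symmetric] minus_diff_eq)
      finally show "star y = y" .
      show "norm y \<le> norm a"
        using norm_triangle_ineq4[of "star a" a] by (simp add: y_def norm_scaleC norm_divide)
    qed
    have "star a * a + star (star a) * star a = 2 *\<^sub>R (x * x) + 2 *\<^sub>R (y * y)"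
    proof -
      have "2 *\<^sub>R x = a + star a"
        by (simp add: x_def)
      then have "4 *\<^sub>R (x * x) = (a + star a) * (a + star a)"
        by (metis mult_scaleR_left mult_scaleR_right scaleR_scaleR num_double numeral_times_numeral)
      moreover have "4 *\<^sub>R (y * y) = - ((star a - a) * (star a - a))"
        by (simp add: y_def scaleC_mult_left scaleC_mult_right scaleC_scaleC scaleR_scaleC)
      ultimately have "4 *\<^sub>R (x * x) + 4 *\<^sub>R (y * y) = 2 *\<^sub>R (star a * a + a * star a)"
        by (simp add: scaleR_2 algebra_simps)
      then have "(1/2) *\<^sub>R (4 *\<^sub>R (x * x) + 4 *\<^sub>R (y * y)) = star a * a + a * star a"
        by simp
      then show ?thesis
        by (simp add: scaleR_add_right star_star)
    qed
    from arg_cong[OF this, of "\<lambda>z. Re (cinner h (\<phi> z h))"]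
    have "Re (cinner h (\<phi> (star a * a) h)) + Re (cinner h (\<phi> (star (star a) * star a) h))
        = 2 * Re (cinner h (\<phi> (x * x) h)) + 2 * Re (cinner h (\<phi> (y * y) h))"
      using h by (simp add: phi_add phi_scaleR cinner_add_right cinner_scaleR_right)
    also have "\<dots> \<le> 2 * (C * (norm a)\<^sup>2 * (norm h)\<^sup>2) + 2 * (C * (norm a)\<^sup>2 * (norm h)\<^sup>2)"
      using x y C0 by (intro add_mono mult_left_mono order_trans[OF sa[OF _ h]] mult_right_mono power_mono) auto
    finally show ?thesis
      using phi_square_nonneg[OF h, of "star a"] by simp
  qed
  then show ?thesis
    using C0 by (intro exI[of _ "4 * C"]) auto
qed

end

section \<open>Hilbert modules\<close>

context hilbert_module
begin

lemma ip_add_left: "ip (x + y) z = ip x z + ip y z"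
  by (metis ip_add_right ip_star star_add)

lemma ip_scaleC_left: "ip (c *\<^sub>C x) y = cnj c *\<^sub>C ip x y"
  by (metis ip_scaleC_right ip_star star_scaleC)

lemma ip_diff_right: "ip x (y - z) = ip x y - ip x z"
  using ip_add_right[of x "y - z" z] by simp

lemma ip_diff_left: "ip (x - y) z = ip x z - ip y z"
  using ip_add_left[of "x - y" y z] by simp

lemma ip_act_left: "ip (act x a) y = star a * ip x y"
  by (metis ip_act_right ip_star star_mult)

lemma mult_ip: "a * ip x y = ip (act x (star a)) y"
  by (simp add: ip_act_left star_star)

lemma norm_ip_self: "norm (ip x x) = (norm x)\<^sup>2"
  by (simp add: norm_eq_ip)

lemma ip_eqI: "(\<And>z. ip z x = ip z y) \<Longrightarrow> x = y"
  using ip_definite[of "x - y"] by (simp add: ip_diff_right)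

text \<open>A crude Cauchy-Schwarz inequality: for unit vectors, polarization bounds
  \<open>4 *\<^sub>R ip x y\<close> by four squares, each at most \<open>4\<close>. It serves the
  continuity of \<open>ip\<close>.\<close>

lemma norm_ip_le: "norm (ip x y) \<le> 4 * norm x * norm y"
proof (cases "x = 0 \<or> y = 0")
  case True
  then show ?thesis
    using ip_diff_right[of x 0 0] ip_diff_left[of 0 0 y] by auto
next
  case False
  have unit: "norm (ip x y) \<le> 4" if xy: "norm x = 1" "norm y = 1" for x y
  proof -
    have "4 *\<^sub>R ip x y = (ip (x + y) (x + y) - ip (x - y) (x - y))
        + \<i> *\<^sub>C (ip (x - \<i> *\<^sub>C y) (x - \<i> *\<^sub>C y) - ip (x + \<i> *\<^sub>C y) (x + \<i> *\<^sub>C y))"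
    proof -
      have "ip (x + y) (x + y) - ip (x - y) (x - y) = 2 *\<^sub>R ip x y + 2 *\<^sub>R ip y x"
        by (simp add: ip_add_left ip_add_right ip_diff_left ip_diff_right scaleR_2)
      moreover have "ip (x - \<i> *\<^sub>C y) (x - \<i> *\<^sub>C y) - ip (x + \<i> *\<^sub>C y) (x + \<i> *\<^sub>C y)
          = 2 *\<^sub>R (\<i> *\<^sub>C ip y x) - 2 *\<^sub>R (\<i> *\<^sub>C ip x y)"
        by (simp add: ip_add_left ip_add_right ip_diff_left ip_diff_right ip_scaleC_left ip_scaleC_right scaleR_2
            scaleC_add_right scaleC_diff_right)
      then have "\<i> *\<^sub>C (ip (x - \<i> *\<^sub>C y) (x - \<i> *\<^sub>C y) - ip (x + \<i> *\<^sub>C y) (x + \<i> *\<^sub>C y))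
          = 2 *\<^sub>R ip x y - 2 *\<^sub>R ip y x"
        by (simp add: scaleC_diff_right scaleR_2 scaleC_add_right)
      moreover have "4 *\<^sub>R ip x y = 2 *\<^sub>R ip x y + 2 *\<^sub>R ip x y"
        by (simp flip: scaleR_add_left)
      ultimately show ?thesis
        by simp
    qed
    then have "4 * norm (ip x y) = norm ((ip (x + y) (x + y) - ip (x - y) (x - y))
        + \<i> *\<^sub>C (ip (x - \<i> *\<^sub>C y) (x - \<i> *\<^sub>C y) - ip (x + \<i> *\<^sub>C y) (x + \<i> *\<^sub>C y)))"
      by (metis abs_numeral norm_scaleR)
    also have "\<dots> \<le> (norm (ip (x + y) (x + y)) + norm (ip (x - y) (x - y)))
        + norm (\<i> *\<^sub>C (ip (x - \<i> *\<^sub>C y) (x - \<i> *\<^sub>C y) - ip (x + \<i> *\<^sub>C y) (x + \<i> *\<^sub>C y)))"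
      by (rule order_trans[OF norm_triangle_ineq add_right_mono[OF norm_triangle_ineq4]])
    also have "norm (\<i> *\<^sub>C (ip (x - \<i> *\<^sub>C y) (x - \<i> *\<^sub>C y) - ip (x + \<i> *\<^sub>C y) (x + \<i> *\<^sub>C y)))
        \<le> norm (ip (x - \<i> *\<^sub>C y) (x - \<i> *\<^sub>C y)) + norm (ip (x + \<i> *\<^sub>C y) (x + \<i> *\<^sub>C y))"
      by (simp add: norm_scaleC norm_triangle_ineq4)
    finally have "4 * norm (ip x y) \<le> ((norm (x + y))\<^sup>2 + (norm (x - y))\<^sup>2)
        + ((norm (x - \<i> *\<^sub>C y))\<^sup>2 + (norm (x + \<i> *\<^sub>C y))\<^sup>2)"
      by (simp add: norm_ip_self)
    also have "\<dots> \<le> (2\<^sup>2 + 2\<^sup>2) + (2\<^sup>2 + 2\<^sup>2)"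
      using norm_triangle_ineq[of x y] norm_triangle_ineq4[of x y]
        norm_triangle_ineq[of x "\<i> *\<^sub>C y"] norm_triangle_ineq4[of x "\<i> *\<^sub>C y"] xy
      by (intro add_mono power_mono) (auto simp: norm_scaleC)
    finally show ?thesis
      by simp
  qed
  let ?x = "(1 / norm x) *\<^sub>R x" and ?y = "(1 / norm y) *\<^sub>R y"
  have "ip ?x ?y = (1 / (norm x * norm y)) *\<^sub>R ip x y"
    by (simp add: scaleR_scaleC ip_scaleC_left ip_scaleC_right scaleC_scaleC)
  moreover have "norm (ip ?x ?y) \<le> 4"
    using False by (intro unit) auto
  ultimately show ?thesis
    using False by (simp add: field_simps)
qed

lemma bounded_bilinear_ip: "bounded_bilinear ip"
proof
  show "\<exists>K. \<forall>x y. norm (ip x y) \<le> norm x * norm y * K"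
    using norm_ip_le by (intro exI[of _ 4]) (simp add: mult.commute mult.left_commute)
qed (simp_all add: ip_add_left ip_add_right scaleR_scaleC ip_scaleC_left ip_scaleC_right)

text \<open>If \<open>ip x x\<close> is \<open>star b * b\<close>, then \<open>x - act x e\<close>
  and \<open>b - b * e\<close> have the same norm; after taking adjoints, the left approximate unit
  for the elements \<open>star b\<close> applies.\<close>

lemma act_approximate_unit:
  assumes S: "finite S" and \<epsilon>: "0 < \<epsilon>"
  shows "\<exists>e. norm e \<le> 2 \<and> (\<forall>x\<in>S. norm (x - act x e) < \<epsilon>)"
proof -
  obtain b where b: "\<And>x. ip x x = star (b x) * b x"
    using ip_positive by metis
  obtain e where e: "norm e \<le> 2" "\<forall>a\<in>(star \<circ> b) ` S. norm (a - e * a) < \<epsilon>"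
    using approximate_unit[OF finite_imageI[OF S] \<epsilon>] by blast
  have "norm (x - act x (star e)) < \<epsilon>" if "x \<in> S" for x
  proof -
    have "ip (x - act x (star e)) (x - act x (star e)) = star (b x - b x * star e) * (b x - b x * star e)"
      by (simp add: ip_diff_left ip_diff_right ip_act_left ip_act_right b[of x] star_diff star_mult star_star
          algebra_simps)
    then have "(norm (x - act x (star e)))\<^sup>2 = (norm (b x - b x * star e))\<^sup>2"
      by (metis norm_ip_self cstar_identity)
    then have "norm (x - act x (star e)) = norm (star (b x - b x * star e))"
      by simp
    also have "star (b x - b x * star e) = star (b x) - e * star (b x)"
      by (simp add: star_diff star_mult star_star)
    finally show ?thesis
      using e(2) that by simp
  qed
  then show ?thesis
    using e(1) by (intro exI[of _ "star e"]) auto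
qed

text \<open>The definition of a morphism mentions inner products only; compatibility with the action
  follows by testing against the range of \<open>\<eta>\<close>, which is everything.\<close>

lemma morphism_act:
  assumes \<psi>: "star_hom \<psi>" "\<And>x y. ip (\<eta> x) (\<eta> y) = \<psi> (ip x y)" and \<eta>: "surj \<eta>"
  shows "act (\<eta> x) (\<psi> a) = \<eta> (act x a)"
proof (rule ip_eqI)
  fix z
  obtain y where "z = \<eta> y"
    using \<eta> by (metis surjD)
  then show "ip z (act (\<eta> x) (\<psi> a)) = ip z (\<eta> (act x a))"
    using \<psi> by (simp add: ip_act_right star_hom_def)
qed

end


section \<open>The Stinespring construction\<close>

locale cp_module = hilbert_module act ip + cp_map H \<phi>
  for act :: "'x::cbanach \<Rightarrow> 'a::cstar_algebra \<Rightarrow> 'x" and ip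
    and H :: "'h::chilbert_space set" and \<phi> :: "'a \<Rightarrow> 'h \<Rightarrow> 'h" +
  fixes K :: "'k::chilbert_space set" and \<Phi> :: "'x \<Rightarrow> 'h \<Rightarrow> 'k"
  assumes hilbert_K: "hilbert_space K"
    and bounded_Phi: "bounded_op H K (\<Phi> x)"
    and adj_Phi: "h \<in> H \<Longrightarrow> adj H (\<Phi> x) (\<Phi> y h) = \<phi> (ip x y) h"
begin

lemma cinner_Phi: "g \<in> H \<Longrightarrow> h \<in> H \<Longrightarrow> cinner (\<Phi> x g) (\<Phi> y h) = cinner g (\<phi> (ip x y) h)"
  by (metis adj_Phi bounded_Phi cinner_adj hilbert_H)

definition \<phi>_bound :: real where
  "\<phi>_bound = (SOME C. 0 \<le> C \<and> (\<forall>a. \<forall>h\<in>H. Re (cinner h (\<phi> (star a * a) h)) \<le> C * (norm a)\<^sup>2 * (norm h)\<^sup>2))"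

lemma phi_bound_nonneg: "0 \<le> \<phi>_bound"
  and phi_bound: "h \<in> H \<Longrightarrow> Re (cinner h (\<phi> (star a * a) h)) \<le> \<phi>_bound * (norm a)\<^sup>2 * (norm h)\<^sup>2"
  using someI_ex[OF phi_square_bounded[unfolded Bex_def], folded \<phi>_bound_def] by auto

text \<open>\<open>\<Phi>\<close> is not given as a linear map; expanding the square of the
  difference by \<open>cinner_Phi\<close> produces \<open>ip (x - y) (x - y)\<close>, where the
  bound on \<open>\<phi>\<close> applies.\<close>

lemma norm_Phi_diff:
  assumes h: "h \<in> H"
  shows "norm (\<Phi> x h - \<Phi> y h) \<le> sqrt \<phi>_bound * norm (x - y) * norm h"
proof -
  obtain b where b: "ip (x - y) (x - y) = star b * b"
    using ip_positive by blast
  have "(norm (\<Phi> x h - \<Phi> y h))\<^sup>2 = Re (cinner (\<Phi> x h - \<Phi> y h) (\<Phi> x h - \<Phi> y h))"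
    by (simp add: cinner_self)
  also have "cinner (\<Phi> x h - \<Phi> y h) (\<Phi> x h - \<Phi> y h) = cinner h (\<phi> (ip (x - y) (x - y)) h)"
    using h by (simp add: cinner_diff_left cinner_diff_right cinner_Phi ip_diff_left ip_diff_right phi_diff)
  also have "Re \<dots> \<le> \<phi>_bound * (norm b)\<^sup>2 * (norm h)\<^sup>2"
    unfolding b by (rule phi_bound[OF h])
  also have "(norm b)\<^sup>2 = (norm (x - y))\<^sup>2"
    by (simp flip: cstar_identity norm_ip_self b)
  also have "\<phi>_bound * (norm (x - y))\<^sup>2 * (norm h)\<^sup>2 = (sqrt \<phi>_bound * norm (x - y) * norm h)\<^sup>2"
    using phi_bound_nonneg by (simp add: power_mult_distrib)
  finally show ?thesis
    by (rule power2_le_imp_le) (simp add: phi_bound_nonneg)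
qed

section \<open>The completed tensor product\<close>

text \<open>A choice of vectors with prescribed inner products replaces quotient and completion, and
  it lives in the ambient type of the existence claim.\<close>

definition emb :: "'a \<times> 'h \<Rightarrow> ('a \<times> 'h) ell2" where
  "emb = (SOME e. \<forall>i\<in>UNIV \<times> H. \<forall>j\<in>UNIV \<times> H. cinner (e i) (e j) = cinner (snd i) (\<phi> (star (fst i) * fst j) (snd j)))"

text \<open>The class of \<open>a \<otimes> h\<close> in the completion of \<open>A \<otimes> H\<close>.\<close>

definition tensor :: "'a \<Rightarrow> 'h \<Rightarrow> ('a \<times> 'h) ell2"  (infix "\<odot>" 70) where
  "a \<odot> h = emb (a, h)"

lemma cinner_tensor:
  assumes "g \<in> H" "h \<in> H"
  shows "cinner (a \<odot> g) (b \<odot> h) = cinner g (\<phi> (star a * b) h)"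
proof -
  have "\<exists>e :: 'a \<times> 'h \<Rightarrow> ('a \<times> 'h) ell2. \<forall>i\<in>UNIV \<times> H. \<forall>j\<in>UNIV \<times> H.
      cinner (e i) (e j) = cinner (snd i) (\<phi> (star (fst i) * fst j) (snd j))"
  proof (rule kernel_realization)
    fix F :: "('a \<times> 'h) set" and c :: "'a \<times> 'h \<Rightarrow> complex"
    assume F: "finite F" "F \<subseteq> UNIV \<times> H"
    then have FH: "snd i \<in> H" if "i \<in> F" for i
      using that by auto
    \<comment> \<open>Absorbing the scalars into the vectors turns the form into an instance of
      \<open>phi_psd\<close>.\<close>
    have "(\<Sum>i\<in>F. \<Sum>j\<in>F. cnj (c i) * c j * cinner (snd i) (\<phi> (star (fst i) * fst j) (snd j)))
      = (\<Sum>i\<in>F. \<Sum>j\<in>F. cinner (c i *\<^sub>C snd i) (\<phi> (star (fst i) * fst j) (c j *\<^sub>C snd j)))"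
      using FH by (intro sum.cong refl)
        (simp add: bounded_op_scaleC[OF bounded_phi] cinner_scaleC_left cinner_scaleC_right)
    also have "\<dots> \<in> \<real>\<^sub>\<ge>\<^sub>0"
      using FH F(1) hilbert_H by (intro phi_psd) (auto intro: hilbert_space_scaleC)
    finally show "(\<Sum>i\<in>F. \<Sum>j\<in>F. cnj (c i) * c j * cinner (snd i) (\<phi> (star (fst i) * fst j) (snd j))) \<in> \<real>\<^sub>\<ge>\<^sub>0" .
  qed
  from someI_ex[OF this, folded emb_def] show ?thesis
    using assms by (simp add: tensor_def)
qed

lemma norm_tensor: "h \<in> H \<Longrightarrow> norm (a \<odot> h) \<le> sqrt \<phi>_bound * norm a * norm h"
proof -
  assume h: "h \<in> H"
  have "(norm (a \<odot> h))\<^sup>2 = Re (cinner (a \<odot> h) (a \<odot> h))"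
    by (simp add: cinner_self)
  also have "\<dots> \<le> \<phi>_bound * (norm a)\<^sup>2 * (norm h)\<^sup>2"
    unfolding cinner_tensor[OF h h] by (rule phi_bound[OF h])
  also have "\<dots> = (sqrt \<phi>_bound * norm a * norm h)\<^sup>2"
    using phi_bound_nonneg by (simp add: power_mult_distrib)
  finally show ?thesis
    by (rule power2_le_imp_le) (simp add: phi_bound_nonneg)
qed

text \<open>The vectors are known only through their inner products, so linearity is obtained by
  showing that the defect has norm zero.\<close>

lemma tensor_diff_left:
  assumes h: "h \<in> H"
  shows "(a - b) \<odot> h = a \<odot> h - b \<odot> h"
proof -
  have "cinner ((a - b) \<odot> h - (a \<odot> h - b \<odot> h)) ((a - b) \<odot> h - (a \<odot> h - b \<odot> h)) = 0"
    using h by (simp add: cinner_diff_left cinner_diff_right cinner_tensor star_diff left_diff_distrib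
        right_diff_distrib phi_diff)
  then show ?thesis
    by (simp add: cinner_self_eq_0)
qed

lemma tensor_diff_right:
  assumes h: "g \<in> H" "h \<in> H"
  shows "a \<odot> (g - h) = a \<odot> g - a \<odot> h"
proof -
  have gh: "g - h \<in> H"
    using hilbert_space_diff[OF hilbert_H] h by blast
  have "cinner (a \<odot> (g - h) - (a \<odot> g - a \<odot> h)) (a \<odot> (g - h) - (a \<odot> g - a \<odot> h)) = 0"
    using h gh by (simp add: cinner_diff_left cinner_diff_right cinner_tensor
        bounded_op_diff[OF bounded_phi hilbert_H])
  then show ?thesis
    by (simp add: cinner_self_eq_0)
qed

text \<open>For the strong continuity of the group action, under which both factors move.\<close>

lemma tendsto_tensor:
  assumes a: "(a \<longlongrightarrow> a0) F" and h: "(h \<longlongrightarrow> h0) F" and H: "\<And>t. h t \<in> H" "h0 \<in> H"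
  shows "((\<lambda>t. a t \<odot> h t) \<longlongrightarrow> a0 \<odot> h0) F"
proof (rule LIM_zero_cancel, rule Lim_null_comparison)
  let ?c = "sqrt \<phi>_bound"
  show "\<forall>\<^sub>F t in F. norm (a t \<odot> h t - a0 \<odot> h0)
      \<le> ?c * norm (a t - a0) * norm (h t) + ?c * norm a0 * norm (h t - h0)"
  proof (intro always_eventually allI)
    fix t
    have "a t \<odot> h t - a0 \<odot> h0 = (a t - a0) \<odot> h t + a0 \<odot> (h t - h0)"
      using H by (simp add: tensor_diff_left tensor_diff_right)
    then show "norm (a t \<odot> h t - a0 \<odot> h0)
        \<le> ?c * norm (a t - a0) * norm (h t) + ?c * norm a0 * norm (h t - h0)"
      using norm_triangle_ineq[of "(a t - a0) \<odot> h t" "a0 \<odot> (h t - h0)"]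
        norm_tensor[OF H(1), of "a t - a0" t] norm_tensor[OF hilbert_space_diff[OF hilbert_H H(1) H(2)], of a0 t]
      by simp
  qed
  have "((\<lambda>t. ?c * norm (a t - a0) * norm (h t) + ?c * norm a0 * norm (h t - h0)) \<longlongrightarrow>
      ?c * norm (a0 - a0) * norm h0 + ?c * norm a0 * norm (h0 - h0)) F"
    by (intro tendsto_intros a h)
  then show "((\<lambda>t. ?c * norm (a t - a0) * norm (h t) + ?c * norm a0 * norm (h t - h0)) \<longlongrightarrow> 0) F"
    by simp
qed

text \<open>Boundedness of left multiplication on the completion: for \<open>\<parallel>b\<parallel> \<le> 1\<close> write \<open>1 - b\<^sup>*b = (1 - c)\<^sup>2\<close>
  and use positivity at the vectors \<open>(1 - c) a\<^sub>i\<close>.\<close>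

lemma norm_sum_mult_tensor:
  assumes F: "finite F" and h: "\<And>i. i \<in> F \<Longrightarrow> h i \<in> H"
  shows "norm (\<Sum>i\<in>F. k i *\<^sub>C ((b * a i) \<odot> h i)) \<le> norm b * norm (\<Sum>i\<in>F. k i *\<^sub>C (a i \<odot> h i))"
proof -
  have contr: "norm (\<Sum>i\<in>F. k i *\<^sub>C ((b * a i) \<odot> h i)) \<le> norm (\<Sum>i\<in>F. k i *\<^sub>C (a i \<odot> h i))"
    if b: "norm b \<le> 1" for b
  proof -
    have "norm (0 *\<^sub>R x + star b * b * x) \<le> norm x" for x
    proof -
      have "norm (star b * b * x) \<le> (norm b)\<^sup>2 * norm x"
        using norm_mult_ineq[of "star b * b" x] by (simp add: cstar_identity)
      also have "\<dots> \<le> 1 * norm x"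
        using b by (intro mult_right_mono power_le_one) auto
      finally show ?thesis by simp
    qed
    moreover have "star (star b * b) = star b * b"
      by (simp add: star_mult star_star)
    ultimately obtain \<rho> :: real and c where c: "\<rho>\<^sup>2 - 2 * \<rho> + 0 = 0" "\<rho> \<le> 1"
      "c * c + (2 * \<rho>) *\<^sub>R c - 2 *\<^sub>R c + star b * b = 0" "star c = c"
      using cstar_sqrt[of 0 "star b * b", OF order_refl zero_le_one] by metis
    have "\<rho> = 0"
      using c(1,2) by (auto simp: power2_eq_square right_diff_distrib[symmetric] mult_2[symmetric])
    then have cc: "c * c = 2 *\<^sub>R c - star b * b"
      using c(3) by (simp add: algebra_simps)
    \<comment> \<open>The difference of the two Gram matrices is itself a Gram matrix of tensors, so
      the difference of the squared norms is a squared norm.\<close>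
    have "star (x - c * x) * (y - c * y) = star x * y - star (b * x) * (b * y)" for x y
    proof -
      have "c * (c * y) = c * y + c * y - star b * (b * y)"
        using arg_cong[OF cc, of "\<lambda>z. z * y"] by (simp add: mult.assoc left_diff_distrib scaleR_2 distrib_right)
      then show ?thesis
        by (simp add: star_diff star_mult c(4) left_diff_distrib right_diff_distrib mult.assoc distrib_left)
    qed
    then have "cinner ((x - c * x) \<odot> g) ((y - c * y) \<odot> g') = cinner (x \<odot> g) (y \<odot> g') - cinner ((b * x) \<odot> g) ((b * y) \<odot> g')"
      if "g \<in> H" "g' \<in> H" for x y g g'
      using that by (simp add: cinner_tensor phi_diff cinner_diff_right)
    then have "(norm (\<Sum>i\<in>F. k i *\<^sub>C ((a i - c * a i) \<odot> h i)))\<^sup>2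
        = (norm (\<Sum>i\<in>F. k i *\<^sub>C (a i \<odot> h i)))\<^sup>2 - (norm (\<Sum>i\<in>F. k i *\<^sub>C ((b * a i) \<odot> h i)))\<^sup>2"
      unfolding norm_sum_sq minus_complex.sel[symmetric] sum_subtractf[symmetric] right_diff_distrib[symmetric]
      using h by (intro arg_cong[where f = Re] sum.cong refl) simp
    then have "(norm (\<Sum>i\<in>F. k i *\<^sub>C ((b * a i) \<odot> h i)))\<^sup>2 \<le> (norm (\<Sum>i\<in>F. k i *\<^sub>C (a i \<odot> h i)))\<^sup>2"
      using zero_le_power2[of "norm (\<Sum>i\<in>F. k i *\<^sub>C ((a i - c * a i) \<odot> h i))"] by linarith
    then show ?thesis
      by (rule power2_le_imp_le) simp
  qed
  show ?thesis
  proof (cases "b = 0")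
    case True
    have "0 \<odot> g = 0" if "g \<in> H" for g
      using tensor_diff_left[OF that, of 0 0] by simp
    then show ?thesis
      using True h by simp
  next
    case False
    have scale: "(r *\<^sub>R x) \<odot> g = r *\<^sub>R (x \<odot> g)" if g: "g \<in> H" for r x g
    proof -
      have "cinner ((r *\<^sub>R x) \<odot> g - r *\<^sub>R (x \<odot> g)) ((r *\<^sub>R x) \<odot> g - r *\<^sub>R (x \<odot> g)) = 0"
        using g by (simp add: cinner_diff_left cinner_diff_right cinner_scaleR_left cinner_scaleR_right
            cinner_tensor star_scaleR phi_scaleR)
      then show ?thesis
        by (simp add: cinner_self_eq_0)
    qed
    define b' where "b' = (1 / norm b) *\<^sub>R b"
    have b': "norm b' \<le> 1" "b = norm b *\<^sub>R b'"
      using False by (simp_all add: b'_def)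
    have "(\<Sum>i\<in>F. k i *\<^sub>C ((b * a i) \<odot> h i)) = norm b *\<^sub>R (\<Sum>i\<in>F. k i *\<^sub>C ((b' * a i) \<odot> h i))"
      unfolding scaleR_sum_right
    proof (intro sum.cong refl)
      fix i assume "i \<in> F"
      have "(b * a i) \<odot> h i = norm b *\<^sub>R ((b' * a i) \<odot> h i)"
        using scale[OF h[OF \<open>i \<in> F\<close>], of "norm b" "b' * a i"] b'(2) by (metis mult_scaleR_left)
      then show "k i *\<^sub>C ((b * a i) \<odot> h i) = norm b *\<^sub>R (k i *\<^sub>C ((b' * a i) \<odot> h i))"
        by (simp add: scaleR_scaleC scaleC_scaleC mult.commute)
    qed
    then show ?thesis
      using mult_left_mono[OF contr[OF b'(1)], of "norm b"] by simp
  qed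
qed

text \<open>With \<open>ip x x = star b * b\<close>, the vectors
  \<open>\<Phi> (act x (a i)) (h i)\<close> and \<open>(b * a i) \<odot> h i\<close> have the same
  Gram matrix.\<close>

lemma norm_sum_Phi_act:
  assumes F: "finite F" and h: "\<And>i. i \<in> F \<Longrightarrow> h i \<in> H"
  shows "norm (\<Sum>i\<in>F. k i *\<^sub>C \<Phi> (act x (a i)) (h i)) \<le> norm x * norm (\<Sum>i\<in>F. k i *\<^sub>C (a i \<odot> h i))"
proof -
  obtain b where b: "ip x x = star b * b"
    using ip_positive by blast
  have "(norm (\<Sum>i\<in>F. k i *\<^sub>C \<Phi> (act x (a i)) (h i)))\<^sup>2 = (norm (\<Sum>i\<in>F. k i *\<^sub>C ((b * a i) \<odot> h i)))\<^sup>2"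
    unfolding norm_sum_sq using h
    by (intro arg_cong[where f = Re] sum.cong refl)
      (simp add: cinner_Phi cinner_tensor ip_act_left ip_act_right b star_mult mult.assoc)
  then have "norm (\<Sum>i\<in>F. k i *\<^sub>C \<Phi> (act x (a i)) (h i)) = norm (\<Sum>i\<in>F. k i *\<^sub>C ((b * a i) \<odot> h i))"
    by simp
  moreover have "norm b = norm x"
    using norm_ip_self[of x] by (simp add: b cstar_identity)
  moreover have "norm (\<Sum>i\<in>F. k i *\<^sub>C ((b * a i) \<odot> h i)) \<le> norm b * norm (\<Sum>i\<in>F. k i *\<^sub>C (a i \<odot> h i))"
    using F h by (rule norm_sum_mult_tensor)
  ultimately show ?thesis
    by simp
qed

section \<open>The two spaces and the representation of the module\<close>

abbreviation "gens \<equiv> (UNIV :: 'x set) \<times> (UNIV :: 'x set) \<times> H"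

definition gen :: "'x \<times> 'x \<times> 'h \<Rightarrow> ('a \<times> 'h) ell2" where
  "gen = (\<lambda>(x, y, h). ip x y \<odot> h)"

text \<open>Spanned by inner products only: by \<open>adj_pi_Phi\<close> its generators are the
  images of the vectors \<open>\<Phi> y h\<close> under the adjoints of the representation, as the
  second spanning condition demands.\<close>

definition H\<^sub>\<Phi> :: "('a \<times> 'h) ell2 set" where
  "H\<^sub>\<Phi> = closure (cspan (gen ` gens))"

definition K\<^sub>\<Phi> :: "'k set" where
  "K\<^sub>\<Phi> = closure (cspan {\<Phi> x h | x h. h \<in> H})"

lemma hilbert_H1: "hilbert_space H\<^sub>\<Phi>"
  and hilbert_K1: "hilbert_space K\<^sub>\<Phi>"
  by (simp_all add: H\<^sub>\<Phi>_def K\<^sub>\<Phi>_def hilbert_space_closure_cspan)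

lemma tensor_ip_mem: "h \<in> H \<Longrightarrow> ip x y \<odot> h \<in> H\<^sub>\<Phi>"
  unfolding H\<^sub>\<Phi>_def gen_def by (rule closure_cspan_superset) force

lemma Phi_mem: "h \<in> H \<Longrightarrow> \<Phi> x h \<in> K\<^sub>\<Phi>"
  unfolding K\<^sub>\<Phi>_def by (rule closure_cspan_superset) blast

lemma K1_subset: "K\<^sub>\<Phi> \<subseteq> K"
  unfolding K\<^sub>\<Phi>_def using hilbert_K bounded_op_mem[OF bounded_Phi] by (intro closure_cspan_minimal) auto

lemma H1_op_eqI:
  assumes "bounded_op H\<^sub>\<Phi> L S" "bounded_op H\<^sub>\<Phi> L' T"
    and "\<And>x y h. h \<in> H \<Longrightarrow> S (ip x y \<odot> h) = T (ip x y \<odot> h)" and "\<xi> \<in> H\<^sub>\<Phi>"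
  shows "S \<xi> = T \<xi>"
  using assms unfolding H\<^sub>\<Phi>_def by (elim bounded_op_eq_on_dense) (auto simp: gen_def)

lemma H1_eqI:
  assumes "\<xi> \<in> H\<^sub>\<Phi>" "\<zeta> \<in> H\<^sub>\<Phi>"
    and "\<And>x y h. h \<in> H \<Longrightarrow> cinner (ip x y \<odot> h) \<xi> = cinner (ip x y \<odot> h) \<zeta>"
  shows "\<xi> = \<zeta>"
  using assms unfolding H\<^sub>\<Phi>_def by (elim cinner_eqI_dense) (auto simp: gen_def)

lemma K1_eqI:
  assumes "\<xi> \<in> K\<^sub>\<Phi>" "\<zeta> \<in> K\<^sub>\<Phi>"
    and "\<And>x h. h \<in> H \<Longrightarrow> cinner (\<Phi> x h) \<xi> = cinner (\<Phi> x h) \<zeta>"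
  shows "\<xi> = \<zeta>"
  using assms unfolding K\<^sub>\<Phi>_def by (elim cinner_eqI_dense) auto

lemma H1_extension:
  assumes "\<And>F c. finite F \<Longrightarrow> F \<subseteq> gens \<Longrightarrow> norm (\<Sum>i\<in>F. c i *\<^sub>C g i) \<le> B * norm (\<Sum>i\<in>F. c i *\<^sub>C gen i)"
    and "hilbert_space L" "\<And>i. i \<in> gens \<Longrightarrow> g i \<in> L" "0 \<le> B"
  shows "\<exists>T. bounded_op H\<^sub>\<Phi> L T \<and> (\<forall>i\<in>gens. T (gen i) = g i)"
  using bounded_extension[of gens g B gen L] assms unfolding H\<^sub>\<Phi>_def by (meson image_subsetI)

lemma pi_exists:
  "\<exists>T. bounded_op H\<^sub>\<Phi> K\<^sub>\<Phi> T \<and> (\<forall>i\<in>gens. T (gen i) = (\<lambda>(y, z, h). \<Phi> (act x (ip y z)) h) i)"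
proof (rule H1_extension[OF _ hilbert_K1])
  show "norm (\<Sum>i\<in>F. c i *\<^sub>C (case i of (y, z, h) \<Rightarrow> \<Phi> (act x (ip y z)) h)) \<le> norm x * norm (\<Sum>i\<in>F. c i *\<^sub>C gen i)"
    if "finite F" "F \<subseteq> gens" for F c
    using norm_sum_Phi_act[of F "\<lambda>(y, z, h). h" c x "\<lambda>(y, z, h). ip y z"] that
    by (auto simp: gen_def split_beta subset_iff)
qed (auto simp: Phi_mem)

definition \<pi>\<^sub>\<Phi> :: "'x \<Rightarrow> ('a \<times> 'h) ell2 \<Rightarrow> 'k" where
  "\<pi>\<^sub>\<Phi> x = (SOME T. bounded_op H\<^sub>\<Phi> K\<^sub>\<Phi> T \<and> (\<forall>i\<in>gens. T (gen i) = (\<lambda>(y, z, h). \<Phi> (act x (ip y z)) h) i))"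

lemma bounded_pi: "bounded_op H\<^sub>\<Phi> K\<^sub>\<Phi> (\<pi>\<^sub>\<Phi> x)"
  and pi_tensor: "h \<in> H \<Longrightarrow> \<pi>\<^sub>\<Phi> x (ip y z \<odot> h) = \<Phi> (act x (ip y z)) h"
  using someI_ex[OF pi_exists, of x, folded \<pi>\<^sub>\<Phi>_def] by (auto simp: gen_def)

text \<open>\<open>b * ip y z\<close> is \<open>ip (act y (star b)) z\<close>, so left
  multiplication sends generators to generators.\<close>

lemma piA_exists:
  "\<exists>T. bounded_op H\<^sub>\<Phi> H\<^sub>\<Phi> T \<and> (\<forall>i\<in>gens. T (gen i) = (\<lambda>(y, z, h). (b * ip y z) \<odot> h) i)"
proof (rule H1_extension[OF _ hilbert_H1])
  show "norm (\<Sum>i\<in>F. c i *\<^sub>C (case i of (y, z, h) \<Rightarrow> (b * ip y z) \<odot> h)) \<le> norm b * norm (\<Sum>i\<in>F. c i *\<^sub>C gen i)"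
    if "finite F" "F \<subseteq> gens" for F c
    using norm_sum_mult_tensor[of F "\<lambda>(y, z, h). h" c b "\<lambda>(y, z, h). ip y z"] that
    by (auto simp: gen_def split_beta subset_iff)
qed (auto simp: mult_ip tensor_ip_mem)

definition \<pi>\<^sub>A :: "'a \<Rightarrow> ('a \<times> 'h) ell2 \<Rightarrow> ('a \<times> 'h) ell2" where
  "\<pi>\<^sub>A b = (SOME T. bounded_op H\<^sub>\<Phi> H\<^sub>\<Phi> T \<and> (\<forall>i\<in>gens. T (gen i) = (\<lambda>(y, z, h). (b * ip y z) \<odot> h) i))"

lemma bounded_piA: "bounded_op H\<^sub>\<Phi> H\<^sub>\<Phi> (\<pi>\<^sub>A b)"
  and piA_tensor: "h \<in> H \<Longrightarrow> \<pi>\<^sub>A b (ip y z \<odot> h) = (b * ip y z) \<odot> h"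
  using someI_ex[OF piA_exists, of b, folded \<pi>\<^sub>A_def] by (auto simp: gen_def)

text \<open>Tested on \<open>ip x' y' \<odot> g\<close>: moving \<open>ip x' y'\<close> out of
  \<open>ip (act x (ip x' y')) y\<close> leaves the Gram entry with
  \<open>ip x y \<odot> h\<close>.\<close>

lemma adj_pi_Phi: "h \<in> H \<Longrightarrow> adj H\<^sub>\<Phi> (\<pi>\<^sub>\<Phi> x) (\<Phi> y h) = ip x y \<odot> h"
proof (rule H1_eqI)
  fix x' y' g assume h: "h \<in> H" "g \<in> H"
  show "cinner (ip x' y' \<odot> g) (adj H\<^sub>\<Phi> (\<pi>\<^sub>\<Phi> x) (\<Phi> y h)) = cinner (ip x' y' \<odot> g) (ip x y \<odot> h)"
    using h by (simp add: cinner_adj[OF hilbert_H1 bounded_pi] tensor_ip_mem pi_tensor cinner_Phi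
        cinner_tensor ip_act_left)
qed (auto simp: adj_mem[OF hilbert_H1 bounded_pi] tensor_ip_mem)

lemma star_rep_piA: "star_rep H\<^sub>\<Phi> \<pi>\<^sub>A"
  unfolding star_rep_def linear_into_ops_def
proof (intro conjI allI ballI bounded_piA)
  fix \<xi> assume \<xi>: "\<xi> \<in> H\<^sub>\<Phi>"
  fix a b c
  note plus = bounded_op_plus[OF bounded_piA[of a] bounded_piA[of b] hilbert_H1]
  note scaled = bounded_op_scaled[OF bounded_piA[of a] hilbert_H1, of c]
  have lin: "(a + b) \<odot> h = a \<odot> h + b \<odot> h" "(c *\<^sub>C a) \<odot> h = c *\<^sub>C (a \<odot> h)" if h: "h \<in> H" for a b h
  proof -
    show "(a + b) \<odot> h = a \<odot> h + b \<odot> h"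
      using tensor_diff_left[OF h, of "a + b" b] by simp
    have "cinner ((c *\<^sub>C a) \<odot> h - c *\<^sub>C (a \<odot> h)) ((c *\<^sub>C a) \<odot> h - c *\<^sub>C (a \<odot> h)) = 0"
      using h by (simp add: cinner_diff_left cinner_diff_right cinner_scaleC_left cinner_scaleC_right
          cinner_tensor star_scaleC scaleC_mult_left scaleC_mult_right phi_scaleC)
    then show "(c *\<^sub>C a) \<odot> h = c *\<^sub>C (a \<odot> h)"
      by (simp add: cinner_self_eq_0)
  qed
  show "\<pi>\<^sub>A (a + b) \<xi> = \<pi>\<^sub>A a \<xi> + \<pi>\<^sub>A b \<xi>"
    by (rule H1_op_eqI[OF bounded_piA plus _ \<xi>]) (simp add: piA_tensor distrib_right lin)
  show "\<pi>\<^sub>A (c *\<^sub>C a) \<xi> = c *\<^sub>C \<pi>\<^sub>A a \<xi>"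
    by (rule H1_op_eqI[OF bounded_piA scaled _ \<xi>]) (simp add: piA_tensor scaleC_mult_left lin)
  \<comment> \<open>The inner value \<open>b * ip y z\<close> is first rewritten as an inner
    product, so that \<open>piA_tensor\<close> applies a second time.\<close>
  show "\<pi>\<^sub>A (a * b) \<xi> = \<pi>\<^sub>A a (\<pi>\<^sub>A b \<xi>)"
    by (rule H1_op_eqI[OF bounded_piA bounded_op_compose[OF bounded_piA bounded_piA] _ \<xi>])
      (simp add: piA_tensor mult_ip[of b], simp add: ip_act_left star_star mult.assoc)
  show "\<pi>\<^sub>A (star a) \<xi> = adj H\<^sub>\<Phi> (\<pi>\<^sub>A a) \<xi>"
  proof (rule H1_op_eqI[OF bounded_piA bounded_op_adj[OF hilbert_H1 bounded_piA] _ \<xi>])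
    fix x y h assume h: "h \<in> H"
    show "\<pi>\<^sub>A (star a) (ip x y \<odot> h) = adj H\<^sub>\<Phi> (\<pi>\<^sub>A a) (ip x y \<odot> h)"
    proof (rule H1_eqI)
      fix x' y' g assume g: "g \<in> H"
      show "cinner (ip x' y' \<odot> g) (\<pi>\<^sub>A (star a) (ip x y \<odot> h))
          = cinner (ip x' y' \<odot> g) (adj H\<^sub>\<Phi> (\<pi>\<^sub>A a) (ip x y \<odot> h))"
        using h g by (simp add: cinner_adj[OF hilbert_H1 bounded_piA] tensor_ip_mem piA_tensor
            cinner_tensor star_mult mult.assoc)
    qed (use h in \<open>auto simp: bounded_op_mem[OF bounded_piA] tensor_ip_mem adj_mem[OF hilbert_H1 bounded_piA]\<close>)
  qed
qed

lemma module_rep_pi: "module_rep ip H\<^sub>\<Phi> K\<^sub>\<Phi> \<pi>\<^sub>\<Phi>"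
  unfolding module_rep_def
proof (intro conjI allI bounded_pi exI[of _ \<pi>\<^sub>A] star_rep_piA ballI)
  fix x y \<xi> assume \<xi>: "\<xi> \<in> H\<^sub>\<Phi>"
  have "bounded_op H\<^sub>\<Phi> H\<^sub>\<Phi> (\<lambda>\<xi>. adj H\<^sub>\<Phi> (\<pi>\<^sub>\<Phi> x) (\<pi>\<^sub>\<Phi> y \<xi>))"
    by (rule bounded_op_compose[OF bounded_pi bounded_op_adj[OF hilbert_H1 bounded_pi]])
  then show "adj H\<^sub>\<Phi> (\<pi>\<^sub>\<Phi> x) (\<pi>\<^sub>\<Phi> y \<xi>) = \<pi>\<^sub>A (ip x y) \<xi>"
    by (rule H1_op_eqI[OF _ bounded_piA _ \<xi>]) (simp add: pi_tensor piA_tensor adj_pi_Phi ip_act_right)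
qed

section \<open>The operator \<open>V\<^sub>\<Phi>\<close> and the projection
  \<open>W\<^sub>\<Phi>\<close>\<close>

text \<open>A unit would give \<open>cinner (1 \<odot> ?s) ?\<xi> = cinner ?s ?s\<close>, and
  Cauchy-Schwarz would finish. Approximate units adapted to the \<open>x i\<close> give this
  identity in the limit, and the bound on their norms is the factor \<open>2\<close>.\<close>

lemma norm_sum_phi_ip:
  assumes F: "finite F" and h: "\<And>i. i \<in> F \<Longrightarrow> h i \<in> H"
  shows "norm (\<Sum>i\<in>F. k i *\<^sub>C \<phi> (ip (x i) (y i)) (h i))
    \<le> 2 * sqrt \<phi>_bound * norm (\<Sum>i\<in>F. k i *\<^sub>C (ip (x i) (y i) \<odot> h i))" (is "norm ?s \<le> _ * norm ?\<xi>")
proof -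
  have s: "?s \<in> H"
  proof -
    have "?s \<in> cspan H"
      using h bounded_op_mem[OF bounded_phi]
      by (intro complex_vector.span_sum complex_vector.span_scale complex_vector.span_base) auto
    then show ?thesis
      using hilbert_H by (simp add: hilbert_space_def complex_vector.span_eq_iff[THEN iffD2])
  qed
  have "\<exists>e. norm e \<le> 2 \<and> (\<forall>z\<in>x ` F. norm (z - act z e) < inverse (real (Suc n)))" for n
    using F by (intro act_approximate_unit) auto
  then obtain e where e: "\<And>n. norm (e n) \<le> 2"
    "\<And>n i. i \<in> F \<Longrightarrow> norm (x i - act (x i) (e n)) < inverse (real (Suc n))"
    by (metis imageI)
  have lim: "(\<lambda>n. \<Phi> (act (x i) (e n)) ?s) \<longlonglongrightarrow> \<Phi> (x i) ?s" if i: "i \<in> F" for i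
  proof (rule LIM_zero_cancel, rule Lim_null_comparison)
    show "\<forall>\<^sub>F n in sequentially. norm (\<Phi> (act (x i) (e n)) ?s - \<Phi> (x i) ?s)
        \<le> sqrt \<phi>_bound * inverse (real (Suc n)) * norm ?s"
    proof (intro always_eventually allI)
      fix n
      have "norm (act (x i) (e n) - x i) \<le> inverse (real (Suc n))"
        using e(2)[OF i, of n] by (simp add: norm_minus_commute)
      then show "norm (\<Phi> (act (x i) (e n)) ?s - \<Phi> (x i) ?s) \<le> sqrt \<phi>_bound * inverse (real (Suc n)) * norm ?s"
        using phi_bound_nonneg
        by (intro order_trans[OF norm_Phi_diff[OF s]] mult_right_mono mult_left_mono) auto
    qed
    have "(\<lambda>n. sqrt \<phi>_bound * inverse (real (Suc n)) * norm ?s) \<longlonglongrightarrow> sqrt \<phi>_bound * 0 * norm ?s"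
      by (intro tendsto_intros LIMSEQ_inverse_real_of_nat)
    then show "(\<lambda>n. sqrt \<phi>_bound * inverse (real (Suc n)) * norm ?s) \<longlonglongrightarrow> 0"
      by simp
  qed
  \<comment> \<open>\<open>e n \<odot> ?s\<close> need not lie in \<open>H\<^sub>\<Phi>\<close>; it
    only serves as a test vector for \<open>?\<xi>\<close>.\<close>
  have approx: "(\<Sum>i\<in>F. k i * cinner (\<Phi> (act (x i) (e n)) ?s) (\<Phi> (y i) (h i))) = cinner (e n \<odot> ?s) ?\<xi>" for n
    unfolding cinner_sum_right cinner_scaleC_right
    using h s by (intro sum.cong refl) (simp add: cinner_Phi cinner_tensor ip_act_left)
  have "(\<lambda>n. \<Sum>i\<in>F. k i * cinner (\<Phi> (act (x i) (e n)) ?s) (\<Phi> (y i) (h i))) \<longlonglongrightarrow>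
      (\<Sum>i\<in>F. k i * cinner (\<Phi> (x i) ?s) (\<Phi> (y i) (h i)))"
    by (intro tendsto_intros tendsto_cinner lim) auto
  also have "(\<Sum>i\<in>F. k i * cinner (\<Phi> (x i) ?s) (\<Phi> (y i) (h i))) = cinner ?s ?s"
    unfolding cinner_sum_right[of ?s] cinner_scaleC_right
    using h s by (intro sum.cong refl) (simp add: cinner_Phi)
  finally have "(\<lambda>n. cinner (e n \<odot> ?s) ?\<xi>) \<longlonglongrightarrow> cinner ?s ?s"
    by (simp only: approx)
  then have "cmod (cinner ?s ?s) \<le> 2 * sqrt \<phi>_bound * norm ?s * norm ?\<xi>"
  proof (rule LIMSEQ_le_const2[OF tendsto_norm], intro exI[of _ 0] allI impI)
    fix n
    have "norm (e n \<odot> ?s) \<le> sqrt \<phi>_bound * 2 * norm ?s"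
      using e(1) phi_bound_nonneg
      by (intro order_trans[OF norm_tensor[OF s]] mult_right_mono mult_left_mono) auto
    then show "cmod (cinner (e n \<odot> ?s) ?\<xi>) \<le> 2 * sqrt \<phi>_bound * norm ?s * norm ?\<xi>"
      by (intro order_trans[OF cmod_cinner_le] mult_right_mono) auto
  qed
  then have "norm ?s * norm ?s \<le> (2 * sqrt \<phi>_bound * norm ?\<xi>) * norm ?s"
    by (simp add: cinner_self power2_eq_square norm_mult mult.commute mult.left_commute)
  then show ?thesis
    using phi_bound_nonneg by (cases "?s = 0") (auto simp: mult_le_cancel_right)
qed

lemma Vadj_exists:
  "\<exists>T. bounded_op H\<^sub>\<Phi> H T \<and> (\<forall>i\<in>gens. T (gen i) = (\<lambda>(x, y, h). \<phi> (ip x y) h) i)"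
proof (rule H1_extension[OF _ hilbert_H])
  show "norm (\<Sum>i\<in>F. c i *\<^sub>C (case i of (x, y, h) \<Rightarrow> \<phi> (ip x y) h)) \<le> (2 * sqrt \<phi>_bound) * norm (\<Sum>i\<in>F. c i *\<^sub>C gen i)"
    if "finite F" "F \<subseteq> gens" for F c
    using norm_sum_phi_ip[of F "\<lambda>(x, y, h). h" c "\<lambda>(x, y, h). x" "\<lambda>(x, y, h). y"] that
    by (auto simp: gen_def split_beta subset_iff)
qed (auto simp: phi_bound_nonneg bounded_op_mem[OF bounded_phi])

definition Vadj :: "('a \<times> 'h) ell2 \<Rightarrow> 'h" where
  "Vadj = (SOME T. bounded_op H\<^sub>\<Phi> H T \<and> (\<forall>i\<in>gens. T (gen i) = (\<lambda>(x, y, h). \<phi> (ip x y) h) i))"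

lemma bounded_Vadj: "bounded_op H\<^sub>\<Phi> H Vadj"
  and Vadj_tensor: "h \<in> H \<Longrightarrow> Vadj (ip x y \<odot> h) = \<phi> (ip x y) h"
  using someI_ex[OF Vadj_exists, folded Vadj_def] by (auto simp: gen_def)

definition V\<^sub>\<Phi> :: "'h \<Rightarrow> ('a \<times> 'h) ell2" where
  "V\<^sub>\<Phi> = adj H\<^sub>\<Phi> Vadj"

lemma bounded_V: "bounded_op H H\<^sub>\<Phi> V\<^sub>\<Phi>"
  unfolding V\<^sub>\<Phi>_def by (rule bounded_op_adj[OF hilbert_H1 bounded_Vadj])

text \<open>Expresses \<open>V\<^sub>\<Phi>\<close> through \<open>\<Phi>\<close> alone; the
  factorization of \<open>\<Phi>\<close> and the covariance of \<open>V\<^sub>\<Phi>\<close> are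
  both read off from it.\<close>

lemma cinner_V: "g \<in> H \<Longrightarrow> h \<in> H \<Longrightarrow> cinner (ip x y \<odot> g) (V\<^sub>\<Phi> h) = cinner (\<Phi> y g) (\<Phi> x h)"
  by (simp add: V\<^sub>\<Phi>_def cinner_adj[OF hilbert_H1 bounded_Vadj] tensor_ip_mem Vadj_tensor
      cinner_adj_left[OF hilbert_H bounded_Phi] flip: adj_Phi)

lemma pi_V: "h \<in> H \<Longrightarrow> \<pi>\<^sub>\<Phi> x (V\<^sub>\<Phi> h) = \<Phi> x h"
proof (rule K1_eqI)
  assume h: "h \<in> H"
  note V = bounded_op_mem[OF bounded_V h]
  show "\<pi>\<^sub>\<Phi> x (V\<^sub>\<Phi> h) \<in> K\<^sub>\<Phi>" "\<Phi> x h \<in> K\<^sub>\<Phi>"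
    using h by (simp_all add: bounded_op_mem[OF bounded_pi V] Phi_mem)
  fix y g assume g: "g \<in> H"
  have "cinner (\<Phi> y g) (\<pi>\<^sub>\<Phi> x (V\<^sub>\<Phi> h)) = cinner (adj H\<^sub>\<Phi> (\<pi>\<^sub>\<Phi> x) (\<Phi> y g)) (V\<^sub>\<Phi> h)"
    by (rule cinner_adj_left[OF hilbert_H1 bounded_pi V, symmetric])
  then show "cinner (\<Phi> y g) (\<pi>\<^sub>\<Phi> x (V\<^sub>\<Phi> h)) = cinner (\<Phi> y g) (\<Phi> x h)"
    using g h by (simp add: adj_pi_Phi cinner_V)
qed

text \<open>The adjoint of the inclusion \<open>K\<^sub>\<Phi> \<subseteq> K\<close>, that is, the orthogonal projection.\<close>

definition W\<^sub>\<Phi> :: "'k \<Rightarrow> 'k" where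
  "W\<^sub>\<Phi> = adj K\<^sub>\<Phi> (\<lambda>k. k)"

lemma bounded_incl: "bounded_op K\<^sub>\<Phi> K (\<lambda>k. k)"
  using K1_subset by (intro bounded_opI[where B = 1]) auto

lemma bounded_W: "bounded_op K K\<^sub>\<Phi> W\<^sub>\<Phi>"
  unfolding W\<^sub>\<Phi>_def by (rule bounded_op_adj[OF hilbert_K1 bounded_incl])

lemma cinner_W: "k \<in> K\<^sub>\<Phi> \<Longrightarrow> cinner k (W\<^sub>\<Phi> l) = cinner k l"
  unfolding W\<^sub>\<Phi>_def by (rule cinner_adj[OF hilbert_K1 bounded_incl])

lemma W_id: "k \<in> K\<^sub>\<Phi> \<Longrightarrow> W\<^sub>\<Phi> k = k"
  unfolding W\<^sub>\<Phi>_def by (rule adj_eqI[OF hilbert_K1]) auto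

lemma adj_W: "k \<in> K\<^sub>\<Phi> \<Longrightarrow> adj K W\<^sub>\<Phi> k = k"
  unfolding W\<^sub>\<Phi>_def by (rule adj_adj[OF hilbert_K1 bounded_incl hilbert_K])

lemma coisometry_W: "coisometry K K\<^sub>\<Phi> W\<^sub>\<Phi>"
  unfolding coisometry_def by (simp add: bounded_W adj_W W_id)

lemma span_pi_V: "closure (cspan {\<pi>\<^sub>\<Phi> x (V\<^sub>\<Phi> h) | x h. h \<in> H}) = K\<^sub>\<Phi>"
proof -
  have "{\<pi>\<^sub>\<Phi> x (V\<^sub>\<Phi> h) | x h. h \<in> H} = {\<Phi> x h | x h. h \<in> H}"
    by (auto simp: pi_V; metis pi_V)
  then show ?thesis
    by (simp add: K\<^sub>\<Phi>_def)
qed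

text \<open>Every generator of \<open>H\<^sub>\<Phi>\<close> already has the required form, since
  \<open>W\<^sub>\<Phi>\<close> fixes \<open>\<Phi> y h\<close>.\<close>

lemma span_adj_pi_W: "closure (cspan {adj H\<^sub>\<Phi> (\<pi>\<^sub>\<Phi> x) (W\<^sub>\<Phi> k) | x k. k \<in> K}) = H\<^sub>\<Phi>"
proof
  show "closure (cspan {adj H\<^sub>\<Phi> (\<pi>\<^sub>\<Phi> x) (W\<^sub>\<Phi> k) | x k. k \<in> K}) \<subseteq> H\<^sub>\<Phi>"
    by (intro closure_cspan_minimal hilbert_H1) (auto intro: adj_mem[OF hilbert_H1 bounded_pi])
  have "ip x y \<odot> h \<in> closure (cspan {adj H\<^sub>\<Phi> (\<pi>\<^sub>\<Phi> x) (W\<^sub>\<Phi> k) | x k. k \<in> K})" if h: "h \<in> H" for x y h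
  proof -
    have "ip x y \<odot> h = adj H\<^sub>\<Phi> (\<pi>\<^sub>\<Phi> x) (W\<^sub>\<Phi> (\<Phi> y h))"
      using h by (simp add: W_id Phi_mem adj_pi_Phi)
    then show ?thesis
      using bounded_op_mem[OF bounded_Phi h] by (intro closure_cspan_superset) blast
  qed
  then show "H\<^sub>\<Phi> \<subseteq> closure (cspan {adj H\<^sub>\<Phi> (\<pi>\<^sub>\<Phi> x) (W\<^sub>\<Phi> k) | x k. k \<in> K})"
    unfolding H\<^sub>\<Phi>_def[symmetric] by (subst H\<^sub>\<Phi>_def, intro closure_cspan_minimal hilbert_space_closure_cspan)
      (auto simp: gen_def)
qed

end

section \<open>Covariance\<close>

lemma hilbert_space_preimage:
  assumes "bounded_op H K T" "hilbert_space H" "hilbert_space L"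
  shows "hilbert_space {x \<in> H. T x \<in> L}"
proof -
  have "closed (H \<inter> T -` L)"
    using assms bounded_op_continuous_on by (intro continuous_closed_preimage) (auto simp: hilbert_space_def)
  moreover have "H \<inter> T -` L = {x \<in> H. T x \<in> L}"
    by auto
  moreover have "T 0 = 0"
    using bounded_op_scaleC[OF assms(1) hilbert_space_0[OF assms(2)], of 0] by simp
  then have "csubspace {x \<in> H. T x \<in> L}"
    using assms by (auto simp: complex_vector.subspace_def hilbert_space_0 hilbert_space_add
        hilbert_space_scaleC bounded_op_add bounded_op_scaleC)
  ultimately show ?thesis
    by (simp add: hilbert_space_def)
qed

text \<open>The operator at \<open>0\<close> is idempotent by the group law and injective by
  unitarity.\<close>

lemma unitary_rep_zero:
  assumes "hilbert_space H" "unitary_rep H u" "h \<in> H"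
  shows "u 0 h = h"
proof -
  have U: "unitary_op H H (u 0)"
    using assms by (auto simp: unitary_rep_def)
  have "u 0 h = u 0 (u 0 h)"
    using assms by (metis unitary_rep_def add_0)
  then show ?thesis
    using unitary_op_adj_left[OF assms(1) U] assms(3) bounded_op_mem[OF unitary_op_bounded[OF assms(1) U]]
    by metis
qed

lemma unitary_rep_minus_right:
  assumes "hilbert_space H" "unitary_rep H u" "h \<in> H"
  shows "u t (u (- t) h) = h"
  using unitary_rep_zero[OF assms] assms by (metis unitary_rep_def add.right_inverse)

text \<open>The common contraction bound makes convergence of vectors uniform in \<open>t\<close>,
  so the vectors with continuous orbit form a closed subspace.\<close>

lemma continuous_on_op_family_dense:
  fixes v :: "'g::topological_space \<Rightarrow> 'h::chilbert_space \<Rightarrow> 'k::chilbert_space"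
  assumes v: "\<And>t. bounded_op (closure (cspan E)) K (v t)"
    and contr: "\<And>t x. x \<in> closure (cspan E) \<Longrightarrow> norm (v t x) \<le> norm x"
    and E: "\<And>x. x \<in> E \<Longrightarrow> continuous_on UNIV (\<lambda>t. v t x)"
    and x: "x \<in> closure (cspan E)"
  shows "continuous_on UNIV (\<lambda>t. v t x)"
proof -
  let ?H = "closure (cspan E)"
  note H = hilbert_space_closure_cspan[of E]
  let ?M = "{x \<in> ?H. continuous_on UNIV (\<lambda>t. v t x)}"
  have "v t 0 = 0" for t
    using bounded_op_scaleC[OF v hilbert_space_0[OF H], of t 0] by simp
  then have "csubspace ?M"
    using H by (auto simp: complex_vector.subspace_def hilbert_space_0 hilbert_space_add hilbert_space_scaleC
        bounded_op_add[OF v] bounded_op_scaleC[OF v] intro!: continuous_on_add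
        bounded_linear.continuous_on[OF bounded_linear_scaleC])
  moreover have "closed ?M"
    unfolding closed_sequential_limits
  proof (intro allI impI, elim conjE)
    fix X l assume X: "\<forall>n. X n \<in> ?M" and l: "X \<longlonglongrightarrow> l"
    have lH: "l \<in> ?H"
      using X l H by (auto simp: hilbert_space_def intro: closed_sequentially)
    have "uniform_limit UNIV (\<lambda>n t. v t (X n)) (\<lambda>t. v t l) sequentially"
    proof (rule uniform_limitI)
      fix e :: real assume "0 < e"
      with l have "\<forall>\<^sub>F n in sequentially. dist (X n) l < e"
        by (rule tendstoD)
      then show "\<forall>\<^sub>F n in sequentially. \<forall>t\<in>UNIV. dist (v t (X n)) (v t l) < e"
      proof (rule eventually_mono, intro ballI)
        fix n t assume "dist (X n) l < e"
        moreover have "v t (X n) - v t l = v t (X n - l)"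
          using X lH by (simp add: bounded_op_diff[OF v H])
        moreover have "norm (v t (X n - l)) \<le> norm (X n - l)"
          using X lH by (intro contr hilbert_space_diff[OF H]) auto
        ultimately show "dist (v t (X n)) (v t l) < e"
          by (simp add: dist_norm)
      qed
    qed
    then have "continuous_on UNIV (\<lambda>t. v t l)"
      using X by (intro uniform_limit_theorem[where F = sequentially]) auto
    then show "l \<in> ?M"
      using lH by simp
  qed
  ultimately have "?H \<subseteq> ?M"
    using E by (intro closure_cspan_minimal) (auto simp: hilbert_space_def closure_cspan_superset)
  then show ?thesis
    using x by auto
qed

locale covariant_cp_module = cp_module act ip H \<phi> K \<Phi>
  for act :: "'x::cbanach \<Rightarrow> 'a::cstar_algebra \<Rightarrow> 'x" and ip
    and H :: "'h::chilbert_space set" and \<phi> and K :: "'k::chilbert_space set" and \<Phi> +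
  fixes \<eta> :: "'g::topological_group_add \<Rightarrow> 'x \<Rightarrow> 'x" and u :: "'g \<Rightarrow> 'h \<Rightarrow> 'h" and u' :: "'g \<Rightarrow> 'k \<Rightarrow> 'k"
  assumes action: "continuous_action ip \<eta>"
    and unitary_u: "unitary_rep H u"
    and unitary_u': "unitary_rep K u'"
    and covariant_Phi: "covariant \<eta> H \<Phi> u u'"
begin

lemma unitary_op_u: "unitary_op H H (u t)"
  and u_add: "h \<in> H \<Longrightarrow> u (s + t) h = u s (u t h)"
  and continuous_u: "h \<in> H \<Longrightarrow> continuous_on UNIV (\<lambda>t. u t h)"
  using unitary_u by (auto simp: unitary_rep_def)

lemma unitary_op_u': "unitary_op K K (u' t)"
  and u'_add: "k \<in> K \<Longrightarrow> u' (s + t) k = u' s (u' t k)"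
  and continuous_u': "k \<in> K \<Longrightarrow> continuous_on UNIV (\<lambda>t. u' t k)"
  using unitary_u' by (auto simp: unitary_rep_def)

lemmas bounded_u = unitary_op_bounded[OF hilbert_H unitary_op_u]
lemmas bounded_u' = unitary_op_bounded[OF hilbert_K unitary_op_u']
lemmas cinner_u' = unitary_op_cinner[OF hilbert_K unitary_op_u']
lemmas u_mem = bounded_op_mem[OF bounded_u]

lemma surj_eta: "surj (\<eta> t)"
  using action unfolding continuous_action_def module_isomorphism_def by (meson bij_is_surj)

lemma eta_add: "\<eta> (s + t) x = \<eta> s (\<eta> t x)"
  using action unfolding continuous_action_def by simp

lemma continuous_eta: "continuous_on UNIV (\<lambda>t. \<eta> t x)"
proof -
  have "continuous_on UNIV (\<lambda>(t, x). \<eta> t x)"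
    using action unfolding continuous_action_def by blast
  then have "continuous_on UNIV (\<lambda>t. (\<lambda>(t, x). \<eta> t x) (t, x))"
    by (rule continuous_on_compose2) (auto intro!: continuous_intros)
  then show ?thesis
    by simp
qed

lemma eta_morphism:
  obtains \<psi> where "star_hom \<psi>" "\<And>x y. ip (\<eta> t x) (\<eta> t y) = \<psi> (ip x y)"
  using action unfolding continuous_action_def module_isomorphism_def module_morphism_def by blast

lemma eta_act_ip: "act (\<eta> t x) (ip (\<eta> t y) (\<eta> t z)) = \<eta> t (act x (ip y z))"
proof -
  obtain \<psi> where \<psi>: "star_hom \<psi>" "\<And>x y. ip (\<eta> t x) (\<eta> t y) = \<psi> (ip x y)"
    using eta_morphism[of t] by blast
  show ?thesis
    unfolding \<psi>(2) by (rule morphism_act[OF \<psi> surj_eta])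
qed

lemma Phi_eta: "h \<in> H \<Longrightarrow> \<Phi> (\<eta> t x) (u t h) = u' t (\<Phi> x h)"
  using covariant_Phi u_mem unitary_op_adj_left[OF hilbert_H unitary_op_u] unfolding covariant_def by metis

section \<open>The group actions on \<open>H\<^sub>\<Phi>\<close> and
  \<open>K\<^sub>\<Phi>\<close>\<close>

text \<open>Covariance is given for \<open>\<Phi>\<close> and not for \<open>\<phi>\<close>, so both
  sides are rewritten as inner products of values of \<open>\<Phi>\<close>, one of them at the
  triple product \<open>act x (ip x' y')\<close>; \<open>eta_act_ip\<close> pulls
  \<open>\<eta> t\<close> out of it.\<close>

lemma cinner_tensor_eta:
  assumes "g \<in> H" "h \<in> H"
  shows "cinner (ip (\<eta> t x) (\<eta> t y) \<odot> u t g) (ip (\<eta> t x') (\<eta> t y') \<odot> u t h)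
    = cinner (ip x y \<odot> g) (ip x' y' \<odot> h)"
proof -
  have *: "cinner (ip x y \<odot> g) (ip x' y' \<odot> h) = cinner (\<Phi> y g) (\<Phi> (act x (ip x' y')) h)"
    if "g \<in> H" "h \<in> H" for x y x' y' g h
    using that by (simp add: cinner_tensor cinner_Phi ip_star ip_act_right)
  show ?thesis
    using assms bounded_op_mem[OF bounded_Phi]
    by (simp add: * u_mem eta_act_ip Phi_eta cinner_u')
qed

text \<open>Surjectivity of \<open>\<eta> t\<close> and \<open>u t\<close>: the moved generators
  span the same space, and every generator can be written as a moved one.\<close>

lemma gens_eta:
  "(\<lambda>(x, y, h). ip (\<eta> t x) (\<eta> t y) \<odot> u t h) ` gens = gen ` gens"
proof
  show "(\<lambda>(x, y, h). ip (\<eta> t x) (\<eta> t y) \<odot> u t h) ` gens \<subseteq> gen ` gens"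
    by (force simp: gen_def u_mem)
  show "gen ` gens \<subseteq> (\<lambda>(x, y, h). ip (\<eta> t x) (\<eta> t y) \<odot> u t h) ` gens"
  proof clarify
    fix x y h assume h: "h \<in> H"
    obtain x' y' where "x = \<eta> t x'" "y = \<eta> t y'"
      using surj_eta by (metis surjD)
    moreover have "h = u t (u (- t) h)"
      using unitary_rep_minus_right[OF hilbert_H unitary_u h] by simp
    ultimately show "gen (x, y, h) \<in> (\<lambda>(x, y, h). ip (\<eta> t x) (\<eta> t y) \<odot> u t h) ` gens"
      using u_mem[OF h] by (intro image_eqI[of _ _ "(x', y', u (- t) h)"]) (auto simp: gen_def)
  qed
qed

lemma v_exists: "\<exists>U. unitary_op H\<^sub>\<Phi> H\<^sub>\<Phi> U \<and>
    (\<forall>i\<in>gens. U (gen i) = (\<lambda>(x, y, h). ip (\<eta> t x) (\<eta> t y) \<odot> u t h) i)"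
  using gens_eta by (intro unitary_op_of_gram) (auto simp: H\<^sub>\<Phi>_def gen_def cinner_tensor_eta)

definition v\<^sub>\<Phi> :: "'g \<Rightarrow> ('a \<times> 'h) ell2 \<Rightarrow> ('a \<times> 'h) ell2" where
  "v\<^sub>\<Phi> t = (SOME U. unitary_op H\<^sub>\<Phi> H\<^sub>\<Phi> U \<and>
    (\<forall>i\<in>gens. U (gen i) = (\<lambda>(x, y, h). ip (\<eta> t x) (\<eta> t y) \<odot> u t h) i))"

lemma unitary_op_v: "unitary_op H\<^sub>\<Phi> H\<^sub>\<Phi> (v\<^sub>\<Phi> t)"
  and v_tensor: "h \<in> H \<Longrightarrow> v\<^sub>\<Phi> t (ip x y \<odot> h) = ip (\<eta> t x) (\<eta> t y) \<odot> u t h"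
  using someI_ex[OF v_exists, of t, folded v\<^sub>\<Phi>_def] by (auto simp: gen_def)

lemmas bounded_v = unitary_op_bounded[OF hilbert_H1 unitary_op_v]
lemmas cinner_v = unitary_op_cinner[OF hilbert_H1 unitary_op_v]

lemma unitary_rep_v: "unitary_rep H\<^sub>\<Phi> v\<^sub>\<Phi>"
  unfolding unitary_rep_def
proof (intro conjI allI ballI unitary_op_v)
  fix \<xi> assume \<xi>: "\<xi> \<in> H\<^sub>\<Phi>"
  show "v\<^sub>\<Phi> (s + t) \<xi> = v\<^sub>\<Phi> s (v\<^sub>\<Phi> t \<xi>)" for s t
    by (rule H1_op_eqI[OF bounded_v bounded_op_compose[OF bounded_v bounded_v] _ \<xi>])
      (simp add: v_tensor eta_add u_add u_mem)
  show "continuous_on UNIV (\<lambda>t. v\<^sub>\<Phi> t \<xi>)"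
  proof (rule continuous_on_op_family_dense[of "gen ` gens", folded H\<^sub>\<Phi>_def, OF bounded_v _ _ \<xi>])
    show "norm (v\<^sub>\<Phi> t \<zeta>) \<le> norm \<zeta>" if "\<zeta> \<in> H\<^sub>\<Phi>" for t \<zeta>
      using unitary_op_norm[OF hilbert_H1 unitary_op_v that] by simp
    fix \<zeta> assume "\<zeta> \<in> gen ` gens"
    then obtain x y h where \<zeta>: "\<zeta> = ip x y \<odot> h" "h \<in> H"
      by (auto simp: gen_def)
    have "continuous_on UNIV (\<lambda>t. ip (\<eta> t x) (\<eta> t y) \<odot> u t h)"
      using continuous_eta continuous_u[OF \<zeta>(2)] unfolding continuous_on_def
      by (auto intro!: tendsto_tensor bounded_bilinear.tendsto[OF bounded_bilinear_ip] u_mem \<zeta>(2))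
    then show "continuous_on UNIV (\<lambda>t. v\<^sub>\<Phi> t \<zeta>)"
      using \<zeta> by (simp add: v_tensor)
  qed
qed

text \<open>The vectors moved into \<open>K\<^sub>\<Phi>\<close> form a closed subspace that
  contains every \<open>\<Phi> x h\<close>. Hence the second unitary representation is simply
  \<open>u'\<close> restricted.\<close>

lemma u'_mem_K1: "k \<in> K\<^sub>\<Phi> \<Longrightarrow> u' t k \<in> K\<^sub>\<Phi>"
proof -
  have "K\<^sub>\<Phi> \<subseteq> {k \<in> K. u' t k \<in> K\<^sub>\<Phi>}"
    unfolding K\<^sub>\<Phi>_def[symmetric]
    by (subst K\<^sub>\<Phi>_def, intro closure_cspan_minimal hilbert_space_preimage[OF bounded_u' hilbert_K hilbert_K1])
      (auto simp: bounded_op_mem[OF bounded_Phi] Phi_eta[symmetric] Phi_mem u_mem)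
  then show "k \<in> K\<^sub>\<Phi> \<Longrightarrow> u' t k \<in> K\<^sub>\<Phi>"
    by auto
qed

lemma bounded_u'_K1: "bounded_op K\<^sub>\<Phi> K\<^sub>\<Phi> (u' t)"
  by (rule bounded_op_subset[OF bounded_u' K1_subset u'_mem_K1])

lemma unitary_op_u'_K1: "unitary_op K\<^sub>\<Phi> K\<^sub>\<Phi> (u' t)"
proof (rule unitary_opI[OF hilbert_K1 bounded_u'_K1])
  show "norm (u' t k) = norm k" if "k \<in> K\<^sub>\<Phi>" for k
    using that K1_subset by (auto intro!: unitary_op_norm[OF hilbert_K unitary_op_u'])
  show "K\<^sub>\<Phi> \<subseteq> u' t ` K\<^sub>\<Phi>"
  proof
    fix k assume k: "k \<in> K\<^sub>\<Phi>"
    then show "k \<in> u' t ` K\<^sub>\<Phi>"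
      using unitary_rep_minus_right[OF hilbert_K unitary_u', of k t] K1_subset u'_mem_K1[OF k, of "- t"]
      by (metis image_eqI subsetD)
  qed
qed

lemma unitary_rep_u'_K1: "unitary_rep K\<^sub>\<Phi> u'"
  unfolding unitary_rep_def using unitary_op_u'_K1 u'_add continuous_u' K1_subset by blast

lemma covariant_pi: "covariant \<eta> H\<^sub>\<Phi> \<pi>\<^sub>\<Phi> v\<^sub>\<Phi> u'"
  unfolding covariant_def
proof (intro allI ballI)
  fix t x \<xi> assume \<xi>: "\<xi> \<in> H\<^sub>\<Phi>"
  \<comment> \<open>Substituting \<open>\<xi> = v\<^sub>\<Phi> t \<zeta>\<close> removes the adjoint
    and leaves an identity of operators that can be checked on generators.\<close>
  define \<zeta> where "\<zeta> = adj H\<^sub>\<Phi> (v\<^sub>\<Phi> t) \<xi>"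
  have \<zeta>: "\<zeta> \<in> H\<^sub>\<Phi>" "v\<^sub>\<Phi> t \<zeta> = \<xi>"
    unfolding \<zeta>_def using adj_mem[OF hilbert_H1 bounded_v] unitary_op_adj_right[OF hilbert_H1 unitary_op_v \<xi>]
    by auto
  have "\<pi>\<^sub>\<Phi> (\<eta> t x) (v\<^sub>\<Phi> t \<zeta>) = u' t (\<pi>\<^sub>\<Phi> x \<zeta>)"
    by (rule H1_op_eqI[OF bounded_op_compose[OF bounded_v bounded_pi]
          bounded_op_compose[OF bounded_pi bounded_u'_K1] _ \<zeta>(1)])
      (simp add: v_tensor pi_tensor u_mem eta_act_ip Phi_eta)
  then show "\<pi>\<^sub>\<Phi> (\<eta> t x) \<xi> = u' t (\<pi>\<^sub>\<Phi> x (adj H\<^sub>\<Phi> (v\<^sub>\<Phi> t) \<xi>))"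
    by (simp add: \<zeta>(2) flip: \<zeta>_def)
qed

lemma v_V:
  assumes h: "h \<in> H"
  shows "v\<^sub>\<Phi> t (V\<^sub>\<Phi> h) = V\<^sub>\<Phi> (u t h)"
proof -
  note V = bounded_op_mem[OF bounded_V]
  have "cinner \<xi> (v\<^sub>\<Phi> t (V\<^sub>\<Phi> h)) = cinner \<xi> (V\<^sub>\<Phi> (u t h))" if "\<xi> \<in> gen ` gens" for \<xi>
  proof -
    \<comment> \<open>Writing the test vector as a moved generator lets the unitary
      \<open>v\<^sub>\<Phi> t\<close> cancel.\<close>
    obtain x y g where \<xi>: "\<xi> = ip (\<eta> t x) (\<eta> t y) \<odot> u t g" and g: "g \<in> H"
      using \<open>\<xi> \<in> gen ` gens\<close> unfolding gens_eta[of t, symmetric] by auto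
    have "cinner \<xi> (v\<^sub>\<Phi> t (V\<^sub>\<Phi> h)) = cinner (v\<^sub>\<Phi> t (ip x y \<odot> g)) (v\<^sub>\<Phi> t (V\<^sub>\<Phi> h))"
      using g by (simp add: \<xi> v_tensor)
    also have "\<dots> = cinner (\<Phi> y g) (\<Phi> x h)"
      using g h by (simp add: cinner_v tensor_ip_mem V cinner_V)
    also have "\<dots> = cinner \<xi> (V\<^sub>\<Phi> (u t h))"
      using g h by (simp add: \<xi> cinner_V u_mem Phi_eta cinner_u' bounded_op_mem[OF bounded_Phi])
    finally show ?thesis .
  qed
  then show ?thesis
    using V[OF h] V[OF u_mem[OF h]] bounded_op_mem[OF bounded_v]
    by (intro cinner_eqI_dense[of _ "gen ` gens"]) (auto simp flip: H\<^sub>\<Phi>_def)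
qed

lemma w_W:
  assumes k: "k \<in> K"
  shows "u' t (W\<^sub>\<Phi> k) = W\<^sub>\<Phi> (u' t k)"
proof (rule cinner_eqI[OF hilbert_K1])
  note Wk = bounded_op_mem[OF bounded_W k]
  show "u' t (W\<^sub>\<Phi> k) \<in> K\<^sub>\<Phi>" "W\<^sub>\<Phi> (u' t k) \<in> K\<^sub>\<Phi>"
    using u'_mem_K1[OF Wk] bounded_op_mem[OF bounded_W] bounded_op_mem[OF bounded_u' k] by auto
  fix l assume l: "l \<in> K\<^sub>\<Phi>"
  \<comment> \<open>Every test vector is \<open>u' t m\<close> with \<open>m\<close> in the same
    space, so both sides reduce to \<open>cinner m k\<close>.\<close>
  define m where "m = u' (- t) l"
  have m: "m \<in> K\<^sub>\<Phi>" "l = u' t m"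
    using unitary_rep_minus_right[OF hilbert_K unitary_u', of l t] K1_subset l u'_mem_K1
    by (auto simp: m_def)
  then show "cinner l (u' t (W\<^sub>\<Phi> k)) = cinner l (W\<^sub>\<Phi> (u' t k))"
    using l k K1_subset Wk by (simp add: cinner_W m(2)[symmetric]) (simp add: m(2) cinner_u' cinner_W subsetD[OF K1_subset])
qed

lemma covariant_stinespring_Phi:
  "covariant_stinespring ip \<eta> H K u u' \<Phi> H\<^sub>\<Phi> K\<^sub>\<Phi> \<pi>\<^sub>\<Phi> v\<^sub>\<Phi> u' V\<^sub>\<Phi> W\<^sub>\<Phi>"
  unfolding covariant_stinespring_def covariant_rep_def
  using hilbert_H1 hilbert_K1 module_rep_pi unitary_rep_v unitary_rep_u'_K1 covariant_pi bounded_V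
    coisometry_W v_V w_W span_pi_V span_adj_pi_W
  by (auto simp: pi_V adj_W Phi_mem)

end


section \<open>Uniqueness\<close>

text \<open>One set of data in isolation, to be instantiated for both constructions that are
  compared.\<close>

locale stinespring = hilbert_module act ip
  for act :: "'x::cbanach \<Rightarrow> 'a::cstar_algebra \<Rightarrow> 'x" and ip +
  fixes \<eta> :: "'g::topological_group_add \<Rightarrow> 'x \<Rightarrow> 'x"
    and H :: "'h::chilbert_space set" and K :: "'k::chilbert_space set"
    and u u' and \<Phi> :: "'x \<Rightarrow> 'h \<Rightarrow> 'k"
    and H1 :: "'h1::chilbert_space set" and K1 :: "'k1::chilbert_space set"
    and \<pi> v w V W
  assumes hilbert_H: "hilbert_space H" and hilbert_K: "hilbert_space K"
    and unitary_u': "unitary_rep K u'"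
    and data: "covariant_stinespring ip \<eta> H K u u' \<Phi> H1 K1 \<pi> v w V W"
begin

lemma hilbert_H1: "hilbert_space H1" and hilbert_K1: "hilbert_space K1"
  and unitary_v: "unitary_op H1 H1 (v t)" and unitary_w: "unitary_op K1 K1 (w t)"
  and bounded_pi: "bounded_op H1 K1 (\<pi> x)"
  and bounded_V: "bounded_op H H1 V" and bounded_W: "bounded_op K K1 W"
  and Phi_eq: "h \<in> H \<Longrightarrow> \<Phi> x h = adj K W (\<pi> x (V h))"
  and v_V: "h \<in> H \<Longrightarrow> v t (V h) = V (u t h)"
  and w_W: "k \<in> K \<Longrightarrow> w t (W k) = W (u' t k)"
  and W_adj: "\<kappa> \<in> K1 \<Longrightarrow> W (adj K W \<kappa>) = \<kappa>"
  and pi_eta: "\<xi> \<in> H1 \<Longrightarrow> \<pi> (\<eta> t x) \<xi> = w t (\<pi> x (adj H1 (v t) \<xi>))"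
  using data unfolding covariant_stinespring_def covariant_rep_def module_rep_def coisometry_def
    unitary_rep_def covariant_def by auto

text \<open>Images of index sets instead of set comprehensions, the form in which
  \<open>unitary_op_of_gram\<close> takes its families.\<close>

lemma span_pi_V: "closure (cspan ((\<lambda>(x, h). \<pi> x (V h)) ` (UNIV \<times> H))) = K1"
  and span_adj_pi_W: "closure (cspan ((\<lambda>(x, k). adj H1 (\<pi> x) (W k)) ` (UNIV \<times> K))) = H1"
proof -
  have "(\<lambda>(x, h). \<pi> x (V h)) ` (UNIV \<times> H) = {\<pi> x (V h) | x h. h \<in> H}"
    "(\<lambda>(x, k). adj H1 (\<pi> x) (W k)) ` (UNIV \<times> K) = {adj H1 (\<pi> x) (W k) | x k. k \<in> K}"
    by force+
  then show "closure (cspan ((\<lambda>(x, h). \<pi> x (V h)) ` (UNIV \<times> H))) = K1"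
    "closure (cspan ((\<lambda>(x, k). adj H1 (\<pi> x) (W k)) ` (UNIV \<times> K))) = H1"
    using data unfolding covariant_stinespring_def by simp_all
qed

lemmas V_mem = bounded_op_mem[OF bounded_V]
lemmas W_mem = bounded_op_mem[OF bounded_W]
lemmas pi_mem = bounded_op_mem[OF bounded_pi]
lemmas adj_pi_mem = adj_mem[OF hilbert_H1 bounded_pi]
lemmas adj_pi_bounded = bounded_op_adj[OF hilbert_H1 bounded_pi]

text \<open>The triple-product identity, which is not part of the definition of a representation:
  expanding the square of the defect gives zero. It is what carries products of the representation
  with its adjoints from one construction to the other.\<close>

lemma pi_adj_pi:
  assumes \<xi>: "\<xi> \<in> H1"
  shows "\<pi> x (adj H1 (\<pi> y) (\<pi> z \<xi>)) = \<pi> (act x (ip y z)) \<xi>"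
proof -
  obtain \<pi>A where A: "star_rep H1 \<pi>A" "\<And>x y h. h \<in> H1 \<Longrightarrow> adj H1 (\<pi> x) (\<pi> y h) = \<pi>A (ip x y) h"
    using data unfolding covariant_stinespring_def covariant_rep_def module_rep_def by auto
  have bA: "bounded_op H1 H1 (\<pi>A a)" and multA: "h \<in> H1 \<Longrightarrow> \<pi>A (a * b) h = \<pi>A a (\<pi>A b h)"
    and starA: "h \<in> H1 \<Longrightarrow> \<pi>A (star a) h = adj H1 (\<pi>A a) h" for a b h
    using A(1) unfolding star_rep_def linear_into_ops_def by auto
  note memA = bounded_op_mem[OF bA]
  define a where "a = ip y z"
  have cp: "cinner (\<pi> p g) (\<pi> q h) = cinner g (\<pi>A (ip p q) h)" if "g \<in> H1" "h \<in> H1" for p q g h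
    using cinner_adj[OF hilbert_H1 bounded_pi that(1), of p "\<pi> q h"] A(2)[OF that(2)] by simp
  have shift: "cinner (\<pi>A a \<xi>) h = cinner \<xi> (\<pi>A (star a) h)" if "h \<in> H1" for h
    using cinner_adj[OF hilbert_H1 bA \<xi>, of a h] starA[OF that] by simp
  let ?D = "\<pi> x (\<pi>A a \<xi>) - \<pi> (act x a) \<xi>"
  have "cinner ?D ?D = 0"
    using \<xi> memA by (simp add: cinner_diff_left cinner_diff_right cp shift ip_act_left ip_act_right
        multA mult.assoc)
  then show ?thesis
    using A(2)[OF \<xi>] by (simp add: cinner_self_eq_0 a_def)
qed

text \<open>\<open>W\<close> is a left inverse of its adjoint on \<open>K1\<close>, so the adjoint
  is isometric there and the Gram matrix depends on \<open>\<Phi>\<close> alone.\<close>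

lemma cinner_pi_V:
  assumes "g \<in> H" "h \<in> H"
  shows "cinner (\<pi> x (V g)) (\<pi> y (V h)) = cinner (\<Phi> x g) (\<Phi> y h)"
proof -
  have "cinner (\<Phi> x g) (\<Phi> y h) = cinner (\<pi> x (V g)) (W (\<Phi> y h))"
    unfolding Phi_eq[OF assms(1)] Phi_eq[OF assms(2)]
    by (rule cinner_adj_left[OF hilbert_K bounded_W adj_mem[OF hilbert_K bounded_W]])
  then show ?thesis
    using assms by (simp add: Phi_eq W_adj pi_mem V_mem)
qed

lemma cinner_W_pi_V: "k \<in> K \<Longrightarrow> h \<in> H \<Longrightarrow> cinner (W k) (\<pi> y (V h)) = cinner k (\<Phi> y h)"
  by (simp add: Phi_eq cinner_adj[OF hilbert_K bounded_W])

text \<open>The group permutes the spanning family of \<open>H1\<close>, so that intertwining the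
  group actions becomes a matter of indices.\<close>

lemma v_adj_pi_W:
  assumes k: "k \<in> K"
  shows "v t (adj H1 (\<pi> x) (W k)) = adj H1 (\<pi> (\<eta> t x)) (W (u' t k))"
proof (rule adj_eqI[OF hilbert_H1, symmetric])
  note bv = unitary_op_bounded[OF hilbert_H1 unitary_v]
  show "v t (adj H1 (\<pi> x) (W k)) \<in> H1"
    by (rule bounded_op_mem[OF bv adj_pi_mem])
  fix \<xi> assume \<xi>: "\<xi> \<in> H1"
  let ?\<zeta> = "adj H1 (v t) \<xi>"
  have \<zeta>: "?\<zeta> \<in> H1" "v t ?\<zeta> = \<xi>"
    using adj_mem[OF hilbert_H1 bv] unitary_op_adj_right[OF hilbert_H1 unitary_v \<xi>] by auto
  have "cinner (\<pi> (\<eta> t x) \<xi>) (W (u' t k)) = cinner (w t (\<pi> x ?\<zeta>)) (w t (W k))"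
    using \<xi> k by (simp add: pi_eta w_W)
  also have "\<dots> = cinner (\<pi> x ?\<zeta>) (W k)"
    using \<zeta>(1) k by (intro unitary_op_cinner[OF hilbert_K1 unitary_w] pi_mem W_mem)
  also have "\<dots> = cinner ?\<zeta> (adj H1 (\<pi> x) (W k))"
    using \<zeta>(1) by (rule cinner_adj[OF hilbert_H1 bounded_pi, symmetric])
  also have "\<dots> = cinner (v t ?\<zeta>) (v t (adj H1 (\<pi> x) (W k)))"
    using \<zeta>(1) by (intro unitary_op_cinner[OF hilbert_H1 unitary_v, symmetric] adj_pi_mem)
  finally show "cinner (\<pi> (\<eta> t x) \<xi>) (W (u' t k)) = cinner \<xi> (v t (adj H1 (\<pi> x) (W k)))"
    unfolding \<zeta>(2) .
qed

end

text \<open>\<open>U2\<close> has to come first: the Gram matrix of the family spanning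
  \<open>K1\<close> is given by \<open>\<Phi>\<close>, whereas that of the family spanning
  \<open>H1\<close> involves the representation composed with its adjoints, and these compositions
  are compared by means of \<open>U2\<close>.\<close>

lemma covariant_stinespring_unique:
  fixes act :: "'x::cbanach \<Rightarrow> 'a::cstar_algebra \<Rightarrow> 'x"
    and \<eta> :: "'g::topological_group_add \<Rightarrow> 'x \<Rightarrow> 'x"
    and H :: "'h::chilbert_space set" and K :: "'k::chilbert_space set"
    and H1 :: "'h1::chilbert_space set" and K1 :: "'k1::chilbert_space set"
    and H2 :: "'h2::chilbert_space set" and K2 :: "'k2::chilbert_space set"
  assumes "hilbert_module act ip" and hilbert: "hilbert_space H" "hilbert_space K"
    and u': "unitary_rep K u'"
    and data1: "covariant_stinespring ip \<eta> H K u u' \<Phi> H1 K1 \<pi>1 v1 w1 V1 W1"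
    and data2: "covariant_stinespring ip \<eta> H K u u' \<Phi> H2 K2 \<pi>2 v2 w2 V2 W2"
  shows "\<exists>U1 U2. unitary_op H1 H2 U1 \<and> unitary_op K1 K2 U2 \<and>
    (\<forall>x. \<forall>h\<in>H1. U2 (\<pi>1 x h) = \<pi>2 x (U1 h)) \<and>
    (\<forall>t. \<forall>h\<in>H1. v2 t (U1 h) = U1 (v1 t h)) \<and>
    (\<forall>t. \<forall>k\<in>K1. w2 t (U2 k) = U2 (w1 t k)) \<and>
    (\<forall>h\<in>H. V2 h = U1 (V1 h)) \<and> (\<forall>k\<in>K. W2 k = U2 (W1 k))"
proof -
  interpret hilbert_module act ip by fact
  interpret A: stinespring act ip \<eta> H K u u' \<Phi> H1 K1 \<pi>1 v1 w1 V1 W1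
    by unfold_locales (fact hilbert u' data1)+
  interpret B: stinespring act ip \<eta> H K u u' \<Phi> H2 K2 \<pi>2 v2 w2 V2 W2
    by unfold_locales (fact hilbert u' data2)+
  have "\<exists>U. unitary_op K1 K2 U \<and> (\<forall>i\<in>UNIV \<times> H. U ((\<lambda>(x, h). \<pi>1 x (V1 h)) i) = (\<lambda>(x, h). \<pi>2 x (V2 h)) i)"
    by (rule unitary_op_of_gram[OF _ A.span_pi_V B.span_pi_V]) (auto simp: A.cinner_pi_V B.cinner_pi_V)
  then obtain U2 where U2: "unitary_op K1 K2 U2" and U2_pi_V: "\<And>x h. h \<in> H \<Longrightarrow> U2 (\<pi>1 x (V1 h)) = \<pi>2 x (V2 h)"
    by auto
  note bU2 = unitary_op_bounded[OF A.hilbert_K1 U2]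
  \<comment> \<open>The inner products of \<open>W1 k\<close> and \<open>W2 k\<close> with the
    respective spanning families are again determined by \<open>\<Phi>\<close>.\<close>
  have U2_W: "U2 (W1 k) = W2 k" if k: "k \<in> K" for k
  proof (rule cinner_eqI_dense)
    show "U2 (W1 k) \<in> closure (cspan ((\<lambda>(x, h). \<pi>2 x (V2 h)) ` (UNIV \<times> H)))"
      "W2 k \<in> closure (cspan ((\<lambda>(x, h). \<pi>2 x (V2 h)) ` (UNIV \<times> H)))"
      unfolding B.span_pi_V using k by (simp_all add: bounded_op_mem[OF bU2] A.W_mem B.W_mem)
    fix \<kappa> assume "\<kappa> \<in> (\<lambda>(x, h). \<pi>2 x (V2 h)) ` (UNIV \<times> H)"
    then obtain x h where \<kappa>: "\<kappa> = \<pi>2 x (V2 h)" and h: "h \<in> H"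
      by auto
    have "cinner (U2 (W1 k)) \<kappa> = cinner (W1 k) (\<pi>1 x (V1 h))"
      unfolding \<kappa> U2_pi_V[OF h, symmetric] using k h
      by (intro unitary_op_cinner[OF A.hilbert_K1 U2] A.W_mem A.pi_mem A.V_mem)
    also have "\<dots> = cinner (W2 k) \<kappa>"
      using k h by (simp add: \<kappa> A.cinner_W_pi_V B.cinner_W_pi_V)
    finally show "cinner \<kappa> (U2 (W1 k)) = cinner \<kappa> (W2 k)"
      by (metis cinner_commute)
  qed
  \<comment> \<open>On the spanning vectors both sides are triple products and collapse by
    \<open>pi_adj_pi\<close>.\<close>
  have intertwine: "U2 (\<pi>1 x (adj H1 (\<pi>1 y) \<kappa>)) = \<pi>2 x (adj H2 (\<pi>2 y) (U2 \<kappa>))" if \<kappa>: "\<kappa> \<in> K1" for x y \<kappa>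
  proof (rule bounded_op_eq_on_dense[of "(\<lambda>(x, h). \<pi>1 x (V1 h)) ` (UNIV \<times> H)", unfolded A.span_pi_V, OF _ _ _ \<kappa>])
    show "bounded_op K1 K2 (\<lambda>\<kappa>. U2 (\<pi>1 x (adj H1 (\<pi>1 y) \<kappa>)))"
      by (rule bounded_op_compose[OF bounded_op_compose[OF A.adj_pi_bounded A.bounded_pi] bU2])
    show "bounded_op K1 K2 (\<lambda>\<kappa>. \<pi>2 x (adj H2 (\<pi>2 y) (U2 \<kappa>)))"
      by (rule bounded_op_compose[OF bounded_op_compose[OF bU2 B.adj_pi_bounded] B.bounded_pi])
    fix \<kappa> assume "\<kappa> \<in> (\<lambda>(x, h). \<pi>1 x (V1 h)) ` (UNIV \<times> H)"
    then show "U2 (\<pi>1 x (adj H1 (\<pi>1 y) \<kappa>)) = \<pi>2 x (adj H2 (\<pi>2 y) (U2 \<kappa>))"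
      by (auto simp: U2_pi_V A.pi_adj_pi A.V_mem B.pi_adj_pi B.V_mem)
  qed
  have "\<exists>U. unitary_op H1 H2 U \<and>
      (\<forall>i\<in>UNIV \<times> K. U ((\<lambda>(x, k). adj H1 (\<pi>1 x) (W1 k)) i) = (\<lambda>(x, k). adj H2 (\<pi>2 x) (W2 k)) i)"
  proof (rule unitary_op_of_gram[OF _ A.span_adj_pi_W B.span_adj_pi_W], clarify)
    fix x y k l assume k: "k \<in> K" and l: "l \<in> K"
    have "cinner (adj H2 (\<pi>2 x) (W2 k)) (adj H2 (\<pi>2 y) (W2 l)) = cinner (W2 k) (\<pi>2 x (adj H2 (\<pi>2 y) (W2 l)))"
      by (rule cinner_adj_left[OF B.hilbert_H1 B.bounded_pi B.adj_pi_mem])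
    also have "\<dots> = cinner (U2 (W1 k)) (U2 (\<pi>1 x (adj H1 (\<pi>1 y) (W1 l))))"
      using k l by (simp add: intertwine U2_W A.W_mem)
    also have "\<dots> = cinner (W1 k) (\<pi>1 x (adj H1 (\<pi>1 y) (W1 l)))"
      using k l by (intro unitary_op_cinner[OF A.hilbert_K1 U2] A.W_mem A.pi_mem A.adj_pi_mem)
    also have "\<dots> = cinner (adj H1 (\<pi>1 x) (W1 k)) (adj H1 (\<pi>1 y) (W1 l))"
      by (rule cinner_adj_left[OF A.hilbert_H1 A.bounded_pi A.adj_pi_mem, symmetric])
    finally show "cinner (adj H2 (\<pi>2 x) (W2 k)) (adj H2 (\<pi>2 y) (W2 l))
        = cinner (adj H1 (\<pi>1 x) (W1 k)) (adj H1 (\<pi>1 y) (W1 l))" .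
  qed
  then obtain U1 where U1: "unitary_op H1 H2 U1"
    and U1_adj: "\<And>x k. k \<in> K \<Longrightarrow> U1 (adj H1 (\<pi>1 x) (W1 k)) = adj H2 (\<pi>2 x) (W2 k)"
    by auto
  note bU1 = unitary_op_bounded[OF A.hilbert_H1 U1]
  note dense = bounded_op_eq_on_dense[of "(\<lambda>(x, k). adj H1 (\<pi>1 x) (W1 k)) ` (UNIV \<times> K)", unfolded A.span_adj_pi_W]
  have "U2 (\<pi>1 x \<xi>) = \<pi>2 x (U1 \<xi>)" if \<xi>: "\<xi> \<in> H1" for x \<xi>
    by (rule dense[OF bounded_op_compose[OF A.bounded_pi bU2] bounded_op_compose[OF bU1 B.bounded_pi] _ \<xi>])
      (auto simp: U1_adj intertwine A.W_mem U2_W)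
  moreover have "v2 t (U1 \<xi>) = U1 (v1 t \<xi>)" if \<xi>: "\<xi> \<in> H1" for t \<xi>
  proof -
    have "u' t k \<in> K" if "k \<in> K" for k
      using u' that bounded_op_mem[OF unitary_op_bounded[OF hilbert(2)]] unfolding unitary_rep_def by blast
    then show ?thesis
      by (intro dense[OF bounded_op_compose[OF bU1 unitary_op_bounded[OF B.hilbert_H1 B.unitary_v]]
            bounded_op_compose[OF unitary_op_bounded[OF A.hilbert_H1 A.unitary_v] bU1] _ \<xi>])
        (auto simp: U1_adj A.v_adj_pi_W B.v_adj_pi_W)
  qed
  moreover have "w2 t (U2 \<kappa>) = U2 (w1 t \<kappa>)" if \<kappa>: "\<kappa> \<in> K1" for t \<kappa>
  proof -
    \<comment> \<open>A coisometry is onto, so every vector of \<open>K1\<close> is some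
      \<open>W1 k\<close>, where the covariance of \<open>W1\<close> and \<open>W2\<close>
      applies.\<close>
    define k where "k = adj K W1 \<kappa>"
    have k: "k \<in> K" "\<kappa> = W1 k"
      using adj_mem[OF hilbert(2) A.bounded_W] A.W_adj[OF \<kappa>] by (auto simp: k_def)
    moreover have "u' t k \<in> K"
      using u' k(1) bounded_op_mem[OF unitary_op_bounded[OF hilbert(2)]] unfolding unitary_rep_def by blast
    ultimately show ?thesis
      by (simp add: U2_W A.w_W B.w_W)
  qed
  moreover have "V2 h = U1 (V1 h)" if h: "h \<in> H" for h
  proof (rule cinner_eqI_dense)
    show "V2 h \<in> closure (cspan ((\<lambda>(x, k). adj H2 (\<pi>2 x) (W2 k)) ` (UNIV \<times> K)))"
      "U1 (V1 h) \<in> closure (cspan ((\<lambda>(x, k). adj H2 (\<pi>2 x) (W2 k)) ` (UNIV \<times> K)))"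
      unfolding B.span_adj_pi_W using h by (simp_all add: bounded_op_mem[OF bU1] A.V_mem B.V_mem)
    fix \<xi> assume "\<xi> \<in> (\<lambda>(x, k). adj H2 (\<pi>2 x) (W2 k)) ` (UNIV \<times> K)"
    then obtain x k where \<xi>: "\<xi> = adj H2 (\<pi>2 x) (W2 k)" and k: "k \<in> K"
      by auto
    \<comment> \<open>The common value \<open>cinner k (\<Phi> x h)\<close> does not depend on the
      construction.\<close>
    have "cinner \<xi> (V2 h) = cinner k (\<Phi> x h)"
      using h k by (simp add: \<xi> cinner_adj_left[OF B.hilbert_H1 B.bounded_pi B.V_mem] B.cinner_W_pi_V)
    also have "\<dots> = cinner (adj H1 (\<pi>1 x) (W1 k)) (V1 h)"
      using h k by (simp add: cinner_adj_left[OF A.hilbert_H1 A.bounded_pi A.V_mem] A.cinner_W_pi_V)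
    also have "\<dots> = cinner \<xi> (U1 (V1 h))"
      unfolding \<xi> U1_adj[OF k, symmetric]
      using h by (intro unitary_op_cinner[OF A.hilbert_H1 U1, symmetric] A.adj_pi_mem A.V_mem)
    finally show "cinner \<xi> (V2 h) = cinner \<xi> (U1 (V1 h))" .
  qed
  ultimately show ?thesis
    using U1 U2 U2_W by (intro exI[of _ U1] exI[of _ U2]) auto
qed


section \<open>The covariant Stinespring theorem\<close>

theorem theorem3p4:
  fixes act :: "'x::cbanach \<Rightarrow> 'a::cstar_algebra \<Rightarrow> 'x"
    and ip :: "'x \<Rightarrow> 'x \<Rightarrow> 'a"
    and \<eta> :: "'g::{topological_group_add,t2_space} \<Rightarrow> 'x \<Rightarrow> 'x"
    and H :: "'h::chilbert_space set"
    and K :: "'k::chilbert_space set"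
    and u :: "'g \<Rightarrow> 'h \<Rightarrow> 'h"
    and u' :: "'g \<Rightarrow> 'k \<Rightarrow> 'k"
    and \<Phi> :: "'x \<Rightarrow> 'h \<Rightarrow> 'k"
  assumes "locally_compact_space (euclidean :: 'g topology)"
    and "hilbert_module act ip"
    and "full_module ip"
    and "continuous_action ip \<eta>"
    and "hilbert_space H"
    and "hilbert_space K"
    and "unitary_rep H u"
    and "unitary_rep K u'"
    and "module_completely_positive ip H K \<Phi>"
    and "covariant \<eta> H \<Phi> u u'"
  shows
    "(\<exists>(H\<^sub>\<Phi> :: ('a \<times> 'h) ell2 set) (K\<^sub>\<Phi> :: 'k set) \<pi>\<^sub>\<Phi> v\<^sub>\<Phi> w\<^sub>\<Phi> V\<^sub>\<Phi> W\<^sub>\<Phi>.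
        covariant_stinespring ip \<eta> H K u u' \<Phi> H\<^sub>\<Phi> K\<^sub>\<Phi> \<pi>\<^sub>\<Phi> v\<^sub>\<Phi> w\<^sub>\<Phi> V\<^sub>\<Phi> W\<^sub>\<Phi>) \<and>
     (\<forall>(H\<^sub>\<Phi> :: 'h1::chilbert_space set) (K\<^sub>\<Phi> :: 'k1::chilbert_space set) \<pi>\<^sub>\<Phi> v\<^sub>\<Phi> w\<^sub>\<Phi> V\<^sub>\<Phi> W\<^sub>\<Phi>
       (H' :: 'h2::chilbert_space set) (K' :: 'k2::chilbert_space set) \<pi>\<^sub>X v w V' W'.
        covariant_stinespring ip \<eta> H K u u' \<Phi> H\<^sub>\<Phi> K\<^sub>\<Phi> \<pi>\<^sub>\<Phi> v\<^sub>\<Phi> w\<^sub>\<Phi> V\<^sub>\<Phi> W\<^sub>\<Phi> \<longrightarrow>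
        covariant_stinespring ip \<eta> H K u u' \<Phi> H' K' \<pi>\<^sub>X v w V' W' \<longrightarrow>
        (\<exists>U\<^sub>1 U\<^sub>2. unitary_op H\<^sub>\<Phi> H' U\<^sub>1 \<and> unitary_op K\<^sub>\<Phi> K' U\<^sub>2 \<and>
           (\<forall>x. \<forall>h\<in>H\<^sub>\<Phi>. U\<^sub>2 (\<pi>\<^sub>\<Phi> x h) = \<pi>\<^sub>X x (U\<^sub>1 h)) \<and>
           (\<forall>t. \<forall>h\<in>H\<^sub>\<Phi>. v t (U\<^sub>1 h) = U\<^sub>1 (v\<^sub>\<Phi> t h)) \<and>
           (\<forall>t. \<forall>k\<in>K\<^sub>\<Phi>. w t (U\<^sub>2 k) = U\<^sub>2 (w\<^sub>\<Phi> t k)) \<and>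
           (\<forall>h\<in>H. V' h = U\<^sub>1 (V\<^sub>\<Phi> h)) \<and>
           (\<forall>k\<in>K. W' k = U\<^sub>2 (W\<^sub>\<Phi> k))))"
proof
  obtain \<phi> where \<phi>: "completely_positive H \<phi>" "\<And>x. bounded_op H K (\<Phi> x)"
    "\<And>x y h. h \<in> H \<Longrightarrow> adj H (\<Phi> x) (\<Phi> y h) = \<phi> (ip x y) h"
    using assms(9) unfolding module_completely_positive_def by auto
  interpret hilbert_module act ip by fact
  interpret covariant_cp_module act ip H \<phi> K \<Phi> \<eta> u u'
    by unfold_locales (use assms \<phi> in auto)
  show "\<exists>(H1 :: ('a \<times> 'h) ell2 set) (K1 :: 'k set) \<pi> v w V W.
      covariant_stinespring ip \<eta> H K u u' \<Phi> H1 K1 \<pi> v w V W"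
    using covariant_stinespring_Phi by blast
qed (intro allI impI covariant_stinespring_unique[OF assms(2,5,6,8)])

end
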